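(* Let $L$ be a 4-dimensional real connected Lie group whose Lie algebra has a basis $\{X_1,X_2,X_3,X_4\}$ of left-invariant vector fields with commutators $$[X_1,X_4]=[X_2,X_3]=\lambda_1X_1+\lambda_2X_2+\lambda_3X_3+\lambda_4X_4,$$ $$[X_1,X_3]=-[X_2,X_4]=\lambda_2X_1-\lambda_1X_2+\lambda_4X_3-\lambda_3X_4,$$ $[X_1,X_2]=[X_3,X_4]=0$, where $\lambda_1,\dots,\lambda_4\in\mathbb{R}$ are not all zero. Let $H=(J_1,J_2,J_3)$ be the left-invariant almost hypercomplex structure given by $J_1X_1=X_2$, $J_1X_2=-X_1$, $J_1X_3=-X_4$, $J_1X_4=X_3$; $J_2X_1=X_3$, $J_2X_2=X_4$, $J_2X_3=-X_1$, $J_2X_4=-X_2$; $J_3X_1=-X_4$, $J_3X_2=X_3$, $J_3X_3=-X_2$, $J_3X_4=X_1$, and let $g$ be the left-invariant pseudo-Riemannian metric with $g(X_1,X_1)=g(X_2,X_2)=-g(X_3,X_3)=-g(X_4,X_4)=1$ and $g(X_i,X_j)=0$ for $i\ne j$. Let $(L,H,G)$ be the resulting almost $(H,G)$-manifold. Then: (i) $(L,H,G)$ is a locally conformal pseudo-hyper-Kähler manifold; (ii) it is locally conformally flat and its curvature tensor has the form $R=-\frac12(g\odot\rho)+\frac{\tau}{12}(g\odot g)$, where $\rho$ and $\tau$ are the Ricci tensor and the scalar curvature of $g$; (iii) it is $D$-flat (the curvature tensor of the $(H,G)$-connection $D$ vanishes), and the torsion of $D$ is not $D$-parallel.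
   Context: An almost $(H,G)$-manifold is a $4n$-dimensional smooth manifold $M$ with a triple $H=(J_1,J_2,J_3)$ of almost complex structures satisfying $J_\alpha=J_\beta\circ J_\gamma=-J_\gamma\circ J_\beta$, $J_\alpha^2=-I$ for all cyclic permutations $(\alpha,\beta,\gamma)$ of $(1,2,3)$, and a pseudo-Riemannian metric $g$ with $g(x,y)=\varepsilon_\alpha g(J_\alpha x,J_\alpha y)$, where $\varepsilon_1=1$, $\varepsilon_2=\varepsilon_3=-1$. $G=(g,g_1,g_2,g_3)$, where $g_\alpha(x,y)=g(J_\alpha x,y)$. $\nabla$ denotes the Levi-Civita connection of $g$. $(M,H,G)$ is pseudo-hyper-Kähler if $\nabla J_\alpha=0$ for $\alpha=1,2,3$. It is locally conformal pseudo-hyper-Kähler if every point has an open neighbourhood carrying a smooth function $u$ such that the structure generated by $H$ and $e^{2u}g$ on this neighbourhood is pseudo-hyper-Kähler. Conventions: $R(x,y)z=\nabla_x\nabla_yz-\nabla_y\nabla_xz-\nabla_{[x,y]}z$, $R(x,y,z,w)=g(R(x,y)z,w)$, $\rho(y,z)=g^{ij}R(e_i,y,z,e_j)$, $\tau=g^{jk}\rho(e_j,e_k)$. For $(0,2)$-tensors $a,h$: $(a\odot h)(x,y,z,w)=a(x,z)h(y,w)-a(y,z)h(x,w)+a(y,w)h(x,z)-a(x,w)h(y,z)$. The $(H,G)$-connection is the linear connection $D_yz=\nabla_yz+\frac14\sum_{\alpha=1}^3(\nabla_yJ_\alpha)J_\alpha z$; its torsion $T$ is $D$-parallel if $DT=0$;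 its curvature is $K(x,y)z=D_xD_yz-D_yD_xz-D_{[x,y]}z$. *)

theory Defs
  imports
    "HOL-Analysis.Analysis"
    "HOL-Algebra.Group"
    "HOL-Library.Function_Algebras"
begin

instantiation "fun" :: (type, real_vector) real_vector
begin

definition scaleR_fun :: "real \<Rightarrow> ('a \<Rightarrow> 'b) \<Rightarrow> 'a \<Rightarrow> 'b"
  where "scaleR_fun r f = (\<lambda>x. r *\<^sub>R f x)"

instance
  by standard (auto simp: scaleR_fun_def plus_fun_def fun_eq_iff algebra_simps)

end

text \<open>For open \<open>S\<close> in a finite-dimensional space, \<open>Ck_on k S f\<close> is the usual class \<open>C\<^sup>k\<close>.\<close>

fun Ck_on :: "nat \<Rightarrow> 'e::real_normed_vector set \<Rightarrow> ('e \<Rightarrow> 'f::real_normed_vector) \<Rightarrow> bool" where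
  "Ck_on 0 S f \<longleftrightarrow> continuous_on S f"
| "Ck_on (Suc k) S f \<longleftrightarrow> (\<forall>x\<in>S. f differentiable (at x)) \<and>
     (\<forall>v. Ck_on k S (\<lambda>x. frechet_derivative f (at x) v))"

definition smooth_on :: "'e::real_normed_vector set \<Rightarrow> ('e \<Rightarrow> 'f::real_normed_vector) \<Rightarrow> bool" where
  "smooth_on S f \<longleftrightarrow> (\<forall>k. Ck_on k S f)"

text \<open>A chart is a pair of its domain and the coordinate map, whose values off the domain are
  irrelevant. An atlas need not be maximal.\<close>

type_synonym ('a, 'e) atlas = "('a set \<times> ('a \<Rightarrow> 'e)) set"

definition chart :: "'a::topological_space set \<times> ('a \<Rightarrow> 'e::euclidean_space) \<Rightarrow> bool" where
  "chart = (\<lambda>(U, \<phi>). open U \<and> open (\<phi> ` U) \<and> (\<exists>\<psi>. homeomorphism U (\<phi> ` U) \<phi> \<psi>))"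

definition smooth_manifold ::
    "('a::{t2_space,second_countable_topology}, 'e::euclidean_space) atlas \<Rightarrow> bool" where
  "smooth_manifold M \<longleftrightarrow>
     (\<forall>c\<in>M. chart c) \<and> (\<Union>(U, \<phi>)\<in>M. U) = UNIV \<and>
     (\<forall>(U, \<phi>)\<in>M. \<forall>(V, \<psi>)\<in>M. smooth_on (\<phi> ` (U \<inter> V)) (\<psi> \<circ> inv_into U \<phi>))"

definition smooth_map ::
    "('a::topological_space, 'e::euclidean_space) atlas \<Rightarrow>
     ('b::topological_space, 'f::euclidean_space) atlas \<Rightarrow> ('a \<Rightarrow> 'b) \<Rightarrow> bool" where
  "smooth_map M N F \<longleftrightarrow> continuous_on UNIV F \<and>
     (\<forall>(U, \<phi>)\<in>M. \<forall>(V, \<psi>)\<in>N. smooth_on (\<phi> ` (U \<inter> F -` V)) (\<psi> \<circ> F \<circ> inv_into U \<phi>))"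

definition product_atlas :: "('a, 'e) atlas \<Rightarrow> ('b, 'f) atlas \<Rightarrow> ('a \<times> 'b, 'e \<times> 'f) atlas" where
  "product_atlas M N = {(U \<times> V, map_prod \<phi> \<psi>) | U \<phi> V \<psi>. (U, \<phi>) \<in> M \<and> (V, \<psi>) \<in> N}"

definition lie_group ::
    "('a::{t2_space,second_countable_topology}, 'r) monoid_scheme \<Rightarrow>
     ('a, 'e::euclidean_space) atlas \<Rightarrow> bool" where
  "lie_group L M \<longleftrightarrow> group L \<and> carrier L = UNIV \<and> smooth_manifold M \<and>
     smooth_map (product_atlas M M) M (\<lambda>(x, y). x \<otimes>\<^bsub>L\<^esub> y) \<and>
     smooth_map M M (\<lambda>x. inv\<^bsub>L\<^esub> x)"

definition smooth_fun :: "('a::topological_space, 'e::euclidean_space) atlas \<Rightarrow> 'a set \<Rightarrow> ('a \<Rightarrow> real) \<Rightarrow> bool" where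
  "smooth_fun M W f \<longleftrightarrow> (\<forall>(U, \<phi>)\<in>M. smooth_on (\<phi> ` (U \<inter> W)) (f \<circ> inv_into U \<phi>))"

definition smooth_near :: "('a::topological_space, 'e::euclidean_space) atlas \<Rightarrow> 'a \<Rightarrow> ('a \<Rightarrow> real) \<Rightarrow> bool" where
  "smooth_near M p f \<longleftrightarrow> (\<exists>W. open W \<and> p \<in> W \<and> smooth_fun M W f)"

text \<open>Tangent vectors at \<open>p\<close> are the directional derivatives at \<open>p\<close> in a chart. They act on the
  functions that are smooth near \<open>p\<close>, and are set to 0 on all others, so that equality of tangent
  vectors is equality of functionals.\<close>

type_synonym 'a tvec = "('a \<Rightarrow> real) \<Rightarrow> real"
type_synonym 'a vfield = "'a \<Rightarrow> 'a tvec"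

definition tangent_space :: "('a::topological_space, 'e::euclidean_space) atlas \<Rightarrow> 'a \<Rightarrow> 'a tvec set" where
  "tangent_space M p = {v. \<exists>(U, \<phi>)\<in>M. p \<in> U \<and>
     (\<exists>w. v = (\<lambda>f. if smooth_near M p f
                   then frechet_derivative (f \<circ> inv_into U \<phi>) (at (\<phi> p)) w else 0))}"

definition tangent_map ::
    "('b::topological_space, 'f::euclidean_space) atlas \<Rightarrow> ('a \<Rightarrow> 'b) \<Rightarrow> 'a \<Rightarrow> 'a tvec \<Rightarrow> 'b tvec" where
  "tangent_map N F p v = (\<lambda>f. if smooth_near N (F p) f then v (f \<circ> F) else 0)"

text \<open>All objects below live on an open subset \<open>W\<close> of the manifold, regarded as a manifold in its
  own right; \<open>W = UNIV\<close> gives the whole manifold. The fields on \<open>W\<close> are extended by 0.\<close>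

definition vector_fields :: "('a::topological_space, 'e::euclidean_space) atlas \<Rightarrow> 'a set \<Rightarrow> 'a vfield set" where
  "vector_fields M W = {X.
     (\<forall>p\<in>W. X p \<in> tangent_space M p) \<and> (\<forall>p. p \<notin> W \<longrightarrow> X p = 0) \<and>
     (\<forall>V f. open V \<and> V \<subseteq> W \<and> smooth_fun M V f \<longrightarrow> smooth_fun M V (\<lambda>p. X p f))}"

definition fscale :: "('a \<Rightarrow> real) \<Rightarrow> 'a vfield \<Rightarrow> 'a vfield" where
  "fscale f X = (\<lambda>p. f p *\<^sub>R X p)"

definition lie_bracket ::
    "('a::topological_space, 'e::euclidean_space) atlas \<Rightarrow> 'a vfield \<Rightarrow> 'a vfield \<Rightarrow> 'a vfield" where
  "lie_bracket M X Y = (\<lambda>p f. if smooth_near M p f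
     then X p (\<lambda>q. Y q f) - Y p (\<lambda>q. X q f) else 0)"

definition lie_algebra ::
    "('a::topological_space, 'r) monoid_scheme \<Rightarrow> ('a, 'e::euclidean_space) atlas \<Rightarrow> 'a vfield set" where
  "lie_algebra L M = {X \<in> vector_fields M UNIV.
     \<forall>a p. tangent_map M (\<lambda>x. a \<otimes>\<^bsub>L\<^esub> x) p (X p) = X (a \<otimes>\<^bsub>L\<^esub> p)}"

definition is_basis :: "('i::finite \<Rightarrow> 'v::real_vector) \<Rightarrow> 'v set \<Rightarrow> bool" where
  "is_basis e S \<longleftrightarrow> inj e \<and> independent (range e) \<and> span (range e) = S"

type_synonym 'a endo = "'a \<Rightarrow> 'a tvec \<Rightarrow> 'a tvec"
type_synonym 'a bform = "'a \<Rightarrow> 'a tvec \<Rightarrow> 'a tvec \<Rightarrow> real"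

definition endo_on :: "('a::topological_space, 'e::euclidean_space) atlas \<Rightarrow> 'a set \<Rightarrow> 'a endo \<Rightarrow> bool" where
  "endo_on M W J \<longleftrightarrow> (\<forall>p\<in>W. \<forall>v\<in>tangent_space M p. J p v \<in> tangent_space M p \<and>
     (\<forall>w\<in>tangent_space M p. J p (v + w) = J p v + J p w) \<and> (\<forall>c. J p (c *\<^sub>R v) = c *\<^sub>R J p v))"

definition endo_app :: "'a set \<Rightarrow> 'a endo \<Rightarrow> 'a vfield \<Rightarrow> 'a vfield" where
  "endo_app W J X = (\<lambda>p. if p \<in> W then J p (X p) else 0)"

definition smooth_endo :: "('a::topological_space, 'e::euclidean_space) atlas \<Rightarrow> 'a set \<Rightarrow> 'a endo \<Rightarrow> bool" where
  "smooth_endo M W J \<longleftrightarrow> endo_on M W J \<and>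
     (\<forall>V X. open V \<and> V \<subseteq> W \<and> X \<in> vector_fields M V \<longrightarrow> endo_app V J X \<in> vector_fields M V)"

definition bilinear_sym_on :: "('a::topological_space, 'e::euclidean_space) atlas \<Rightarrow> 'a set \<Rightarrow> 'a bform \<Rightarrow> bool" where
  "bilinear_sym_on M W g \<longleftrightarrow> (\<forall>p\<in>W. \<forall>v\<in>tangent_space M p. \<forall>w\<in>tangent_space M p.
     g p v w = g p w v \<and> (\<forall>c. g p (c *\<^sub>R v) w = c * g p v w) \<and>
     (\<forall>u\<in>tangent_space M p. g p (u + v) w = g p u w + g p v w))"

definition pseudo_metric :: "('a::topological_space, 'e::euclidean_space) atlas \<Rightarrow> 'a set \<Rightarrow> 'a bform \<Rightarrow> bool" where
  "pseudo_metric M W g \<longleftrightarrow> bilinear_sym_on M W g \<and>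
     (\<forall>p\<in>W. \<forall>v\<in>tangent_space M p. (\<forall>w\<in>tangent_space M p. g p v w = 0) \<longrightarrow> v = 0) \<and>
     (\<forall>V X Y. open V \<and> V \<subseteq> W \<and> X \<in> vector_fields M V \<and> Y \<in> vector_fields M V \<longrightarrow>
        smooth_fun M V (\<lambda>p. g p (X p) (Y p)))"

definition conformal :: "('a \<Rightarrow> real) \<Rightarrow> 'a bform \<Rightarrow> 'a bform" where
  "conformal u g = (\<lambda>p v w. exp (2 * u p) * g p v w)"

type_synonym 'a conn = "'a vfield \<Rightarrow> 'a vfield \<Rightarrow> 'a vfield"

definition linear_connection ::
    "('a::topological_space, 'e::euclidean_space) atlas \<Rightarrow> 'a set \<Rightarrow> 'a conn \<Rightarrow> bool" where
  "linear_connection M W D \<longleftrightarrow>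
     (\<forall>X\<in>vector_fields M W. \<forall>Y\<in>vector_fields M W. D X Y \<in> vector_fields M W \<and>
        (\<forall>Z\<in>vector_fields M W. D (X + Y) Z = D X Z + D Y Z \<and> D X (Y + Z) = D X Y + D X Z) \<and>
        (\<forall>f. smooth_fun M W f \<longrightarrow> D (fscale f X) Y = fscale f (D X Y) \<and>
           D X (fscale f Y) = fscale f (D X Y) + fscale (\<lambda>p. X p f) Y))"

definition torsion ::
    "('a::topological_space, 'e::euclidean_space) atlas \<Rightarrow> 'a conn \<Rightarrow> 'a vfield \<Rightarrow> 'a vfield \<Rightarrow> 'a vfield" where
  "torsion M D X Y = D X Y - D Y X - lie_bracket M X Y"

definition curvature ::
    "('a::topological_space, 'e::euclidean_space) atlas \<Rightarrow> 'a conn \<Rightarrow>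
     'a vfield \<Rightarrow> 'a vfield \<Rightarrow> 'a vfield \<Rightarrow> 'a vfield" where
  "curvature M D X Y Z = D X (D Y Z) - D Y (D X Z) - D (lie_bracket M X Y) Z"

definition flat_connection ::
    "('a::topological_space, 'e::euclidean_space) atlas \<Rightarrow> 'a set \<Rightarrow> 'a conn \<Rightarrow> bool" where
  "flat_connection M W D \<longleftrightarrow>
     (\<forall>X\<in>vector_fields M W. \<forall>Y\<in>vector_fields M W. \<forall>Z\<in>vector_fields M W.
        curvature M D X Y Z = 0)"

definition parallel_torsion ::
    "('a::topological_space, 'e::euclidean_space) atlas \<Rightarrow> 'a set \<Rightarrow> 'a conn \<Rightarrow> bool" where
  "parallel_torsion M W D \<longleftrightarrow>
     (\<forall>X\<in>vector_fields M W. \<forall>Y\<in>vector_fields M W. \<forall>Z\<in>vector_fields M W.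
        D X (torsion M D Y Z) - torsion M D (D X Y) Z - torsion M D Y (D X Z) = 0)"

definition endo_deriv :: "'a set \<Rightarrow> 'a conn \<Rightarrow> 'a endo \<Rightarrow> 'a vfield \<Rightarrow> 'a vfield \<Rightarrow> 'a vfield" where
  "endo_deriv W D J Y Z = D Y (endo_app W J Z) - endo_app W J (D Y Z)"

definition parallel_endo ::
    "('a::topological_space, 'e::euclidean_space) atlas \<Rightarrow> 'a set \<Rightarrow> 'a conn \<Rightarrow> 'a endo \<Rightarrow> bool" where
  "parallel_endo M W D J \<longleftrightarrow>
     (\<forall>Y\<in>vector_fields M W. \<forall>Z\<in>vector_fields M W. endo_deriv W D J Y Z = 0)"

definition is_levi_civita ::
    "('a::topological_space, 'e::euclidean_space) atlas \<Rightarrow> 'a set \<Rightarrow> 'a bform \<Rightarrow> 'a conn \<Rightarrow> bool" where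
  "is_levi_civita M W g D \<longleftrightarrow> linear_connection M W D \<and>
     (\<forall>X\<in>vector_fields M W. \<forall>Y\<in>vector_fields M W. torsion M D X Y = 0) \<and>
     (\<forall>X\<in>vector_fields M W. \<forall>Y\<in>vector_fields M W. \<forall>Z\<in>vector_fields M W. \<forall>p\<in>W.
        X p (\<lambda>q. g q (Y q) (Z q)) = g p (D X Y p) (Z p) + g p (Y p) (D X Z p))"

text \<open>On a pseudo-Riemannian manifold the Levi-Civita connection exists and is unique as an
  operation on \<open>vector_fields M W\<close>; \<open>SOME\<close> only makes a choice of its values elsewhere.\<close>

definition levi_civita ::
    "('a::topological_space, 'e::euclidean_space) atlas \<Rightarrow> 'a set \<Rightarrow> 'a bform \<Rightarrow> 'a conn" where
  "levi_civita M W g = (SOME D. is_levi_civita M W g D)"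

text \<open>The curvature is tensorial, so \<open>riemann\<close> does not depend on the extensions of tangent
  vectors to fields. Likewise the contraction of a bilinear form with the inverse of the metric
  does not depend on the basis.\<close>

definition extend ::
    "('a::topological_space, 'e::euclidean_space) atlas \<Rightarrow> 'a set \<Rightarrow> 'a \<Rightarrow> 'a tvec \<Rightarrow> 'a vfield" where
  "extend M W p v = (SOME X. X \<in> vector_fields M W \<and> X p = v)"

definition riemann ::
    "('a::topological_space, 'e::euclidean_space) atlas \<Rightarrow> 'a set \<Rightarrow> 'a bform \<Rightarrow>
     'a \<Rightarrow> 'a tvec \<Rightarrow> 'a tvec \<Rightarrow> 'a tvec \<Rightarrow> 'a tvec \<Rightarrow> real" where
  "riemann M W g p x y z w =
     g p (curvature M (levi_civita M W g) (extend M W p x) (extend M W p y) (extend M W p z) p) w"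

definition contract ::
    "('a::topological_space, real^'n) atlas \<Rightarrow> 'a bform \<Rightarrow> 'a \<Rightarrow> ('a tvec \<Rightarrow> 'a tvec \<Rightarrow> real) \<Rightarrow> real" where
  "contract M g p b =
     (let e = (SOME e :: 'n \<Rightarrow> 'a tvec. is_basis e (tangent_space M p));
          ginv = matrix_inv (\<chi> i j. g p (e i) (e j))
      in \<Sum>i\<in>UNIV. \<Sum>j\<in>UNIV. ginv $ i $ j * b (e i) (e j))"

definition ricci :: "('a::topological_space, real^'n) atlas \<Rightarrow> 'a set \<Rightarrow> 'a bform \<Rightarrow> 'a bform" where
  "ricci M W g p y z = contract M g p (\<lambda>x w. riemann M W g p x y z w)"

definition scalar_curvature :: "('a::topological_space, real^'n) atlas \<Rightarrow> 'a set \<Rightarrow> 'a bform \<Rightarrow> 'a \<Rightarrow> real" where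
  "scalar_curvature M W g p = contract M g p (ricci M W g p)"

definition kulkarni_nomizu ::
    "('v \<Rightarrow> 'v \<Rightarrow> real) \<Rightarrow> ('v \<Rightarrow> 'v \<Rightarrow> real) \<Rightarrow> 'v \<Rightarrow> 'v \<Rightarrow> 'v \<Rightarrow> 'v \<Rightarrow> real" where
  "kulkarni_nomizu a h x y z w = a x z * h y w - a y z * h x w + a y w * h x z - a x w * h y z"

definition locally_conformally_flat ::
    "('a::topological_space, 'e::euclidean_space) atlas \<Rightarrow> 'a bform \<Rightarrow> bool" where
  "locally_conformally_flat M g \<longleftrightarrow>
     (\<forall>p. \<exists>W u. open W \<and> p \<in> W \<and> smooth_fun M W u \<and>
        flat_connection M W (levi_civita M W (conformal u g)))"

text \<open>The triple \<open>H\<close> is a family indexed by \<open>{1..3}\<close>; the associated forms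
  \<open>g\<^sub>\<alpha>(x,y) = g(J\<^sub>\<alpha> x,y)\<close> are determined by \<open>H\<close> and \<open>g\<close>.\<close>

definition eps :: "nat \<Rightarrow> real" where
  "eps \<alpha> = (if \<alpha> = 1 then 1 else - 1)"

definition almost_HG ::
    "('a::topological_space, real^'n) atlas \<Rightarrow> 'a set \<Rightarrow> (nat \<Rightarrow> 'a endo) \<Rightarrow> 'a bform \<Rightarrow> bool" where
  "almost_HG M W H g \<longleftrightarrow> 4 dvd CARD('n) \<and>
     (\<forall>\<alpha>\<in>{1..3}. smooth_endo M W (H \<alpha>)) \<and> pseudo_metric M W g \<and>
     (\<forall>p\<in>W. \<forall>x\<in>tangent_space M p.
        (\<forall>(\<alpha>, \<beta>, \<gamma>)\<in>{(1, 2, 3), (2, 3, 1), (3, 1, 2)}.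
           H \<alpha> p x = H \<beta> p (H \<gamma> p x) \<and> H \<alpha> p x = - H \<gamma> p (H \<beta> p x)) \<and>
        (\<forall>\<alpha>\<in>{1..3}. H \<alpha> p (H \<alpha> p x) = - x \<and>
           (\<forall>y\<in>tangent_space M p. g p x y = eps \<alpha> * g p (H \<alpha> p x) (H \<alpha> p y))))"

definition pseudo_hyper_kaehler ::
    "('a::topological_space, real^'n) atlas \<Rightarrow> 'a set \<Rightarrow> (nat \<Rightarrow> 'a endo) \<Rightarrow> 'a bform \<Rightarrow> bool" where
  "pseudo_hyper_kaehler M W H g \<longleftrightarrow> almost_HG M W H g \<and>
     (\<forall>\<alpha>\<in>{1..3}. parallel_endo M W (levi_civita M W g) (H \<alpha>))"

definition locally_conformal_pseudo_hyper_kaehler ::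
    "('a::topological_space, real^'n) atlas \<Rightarrow> (nat \<Rightarrow> 'a endo) \<Rightarrow> 'a bform \<Rightarrow> bool" where
  "locally_conformal_pseudo_hyper_kaehler M H g \<longleftrightarrow> almost_HG M UNIV H g \<and>
     (\<forall>p. \<exists>W u. open W \<and> p \<in> W \<and> smooth_fun M W u \<and>
        pseudo_hyper_kaehler M W H (conformal u g))"

definition HG_connection ::
    "('a::topological_space, 'e::euclidean_space) atlas \<Rightarrow> 'a set \<Rightarrow> (nat \<Rightarrow> 'a endo) \<Rightarrow> 'a bform \<Rightarrow> 'a conn" where
  "HG_connection M W H g Y Z = levi_civita M W g Y Z +
     (1/4) *\<^sub>R (\<Sum>\<alpha>=1..3. endo_deriv W (levi_civita M W g) (H \<alpha>) Y (endo_app W (H \<alpha>) Z))"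

end

(* The left-invariant fields are a global frame, because one that vanishes at a point is zero. On
   R^4 = C^2, with the complex structure X1 -> X2, X3 -> X4, the bracket is
   [x, y] = omega(x) y - omega(y) x for the complex valued form omega = alpha + i beta with
   alpha = (l4, l3, -l2, -l1), beta = (-l3, l4, l1, -l2), and the three J are complex linear.

   (1) omega vanishes on brackets, so alpha is closed and alpha = du locally. The Levi-Civita
   connection of e^{2u} g is x, y |-> omega(x) y in the frame. It commutes with the J, and it is flat
   because the operators omega(x) commute and omega vanishes on brackets.

   (2) The Levi-Civita connection of g differs from this one by the usual conformal terms, which gives
   R = g KN A (KN = Kulkarni-Nomizu) for the symmetric form
   A = (1/2)|alpha|^2 g - beta (x) beta. Contracting twice expresses A by rho and tau.

   (3) D is x, y |-> (1/2) i beta(x) y in the frame, which is flat for the same reason as in (1).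
   If its torsion were parallel, then evaluating the condition on X1, X3 and each X_i in turn would
   give squares of the l_i equal to zero. *)

theory Submission
  imports Defs
begin

text \<open>The definitions quantify over all vector fields on an open set and choose the
  Levi-Civita connection by \<open>SOME\<close>, so the work lies in reaching algebra on R^4. The
  bridge is \<open>agrees\<close>: on fields over W, a connection is the componentwise derivative in
  the frame plus a fixed bilinear map. Its curvature and torsion, and its derivatives of
  endomorphisms with constant coefficients, then involve no derivatives of the arguments, and
  uniqueness transfers this to the chosen connection.

  Origin of A: flatness of e^{2u} g forces A = -(nabla alpha - alpha (x) alpha + (1/2)|alpha|^2 g),
  where nabla alpha = alpha (x) alpha + beta (x) beta - |alpha|^2 g. So A is minus the Schouten
  tensor of g.

  Origin of the factor 1/2 in D: since each J squares to -I, D_y is (1/4)(nabla_y - sum of J nabla_y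
  J), the projection of nabla_y onto the operators that commute with all J. The summand i beta(y) of
  nabla_y is already of this kind, and the remaining summand projects to -(1/2) i beta(y).\<close>

section \<open>Calculus of C^k maps on open sets\<close>

lemma Ck_on_subset: "Ck_on k S f \<Longrightarrow> T \<subseteq> S \<Longrightarrow> Ck_on k T f"
proof (induction k arbitrary: f)
  case 0
  then show ?case by (auto intro: continuous_on_subset)
next
  case (Suc k)
  then show ?case by auto
qed

text \<open>Openness matters: a derivative at a point looks at a whole neighbourhood, so agreement
  on \<open>S\<close> has to include one.\<close>

lemma Ck_on_cong:
  assumes "open S" "\<And>x. x \<in> S \<Longrightarrow> f x = g x" "Ck_on k S f"
  shows "Ck_on k S g"
  using assms(2,3)
proof (induction k arbitrary: f g)
  case 0
  then show ?case by (simp cong: continuous_on_cong)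
next
  case (Suc k)
  have df: "(f has_derivative frechet_derivative f (at x)) (at x)" if "x \<in> S" for x
    using Suc.prems(2) that by (simp add: frechet_derivative_works)
  have dg: "(g has_derivative frechet_derivative f (at x)) (at x)" if "x \<in> S" for x
    using has_derivative_transform_within_open[OF df[OF that] assms(1) that] Suc.prems(1) by auto
  have eq: "frechet_derivative f (at x) v = frechet_derivative g (at x) v" if "x \<in> S" for x v
    using frechet_derivative_at[OF dg[OF that]] by simp
  have "Ck_on k S (\<lambda>x. frechet_derivative g (at x) v)" for v
    using Suc.IH[OF eq] Suc.prems(2) by simp
  then show ?case
    using dg by (auto simp: differentiable_def)
qed

lemma Ck_on_local:
  assumes "\<And>x. x \<in> S \<Longrightarrow> \<exists>T. x \<in> T \<and> open T \<and> Ck_on k T f"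
  shows "Ck_on k S f"
  using assms
proof (induction k arbitrary: f)
  case 0
  show ?case
    unfolding Ck_on.simps
  proof (rule continuous_at_imp_continuous_on, rule ballI)
    fix x assume "x \<in> S"
    then obtain T where "x \<in> T" "open T" "continuous_on T f"
      using 0 by auto
    then show "isCont f x"
      by (simp add: continuous_on_eq_continuous_at)
  qed
next
  case (Suc k)
  have "f differentiable (at x)" if "x \<in> S" for x
    using Suc.prems[OF that] by auto
  moreover have "Ck_on k S (\<lambda>x. frechet_derivative f (at x) v)" for v
  proof (rule Suc.IH)
    fix x assume "x \<in> S"
    then show "\<exists>T. x \<in> T \<and> open T \<and> Ck_on k T (\<lambda>x. frechet_derivative f (at x) v)"
      using Suc.prems[OF \<open>x \<in> S\<close>] by auto
  qed
  ultimately show ?case by simp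
qed

lemma Ck_on_SucD: "Ck_on (Suc k) S f \<Longrightarrow> Ck_on k S f"
proof (induction k arbitrary: f)
  case 0
  then show ?case
    by (auto intro!: continuous_at_imp_continuous_on differentiable_imp_continuous_within)
next
  case (Suc k)
  have "Ck_on (Suc k) S (\<lambda>x. frechet_derivative f (at x) v)" for v
    using Suc.prems[THEN Ck_on.simps(2)[THEN iffD1]] by blast
  then show ?case
    using Suc.IH Suc.prems[THEN Ck_on.simps(2)[THEN iffD1]] Ck_on.simps(2)[of k S f] by blast
qed

text \<open>\<open>frechet_derivative\<close> is a choice; here any formula \<open>f'\<close> for
  the derivative may take its place, provided it is C^k in each fixed direction. The closure rules
  below go through this.\<close>

lemma Ck_on_SucI:
  assumes "open S" "\<And>x. x \<in> S \<Longrightarrow> (f has_derivative f' x) (at x)"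
    and "\<And>v. Ck_on k S (\<lambda>x. f' x v)"
  shows "Ck_on (Suc k) S f"
proof -
  have "frechet_derivative f (at x) = f' x" if "x \<in> S" for x
    using frechet_derivative_at[OF assms(2)[OF that]] by simp
  then have "Ck_on k S (\<lambda>x. frechet_derivative f (at x) v)" for v
    by (intro Ck_on_cong[OF assms(1) _ assms(3)[of v]]) simp
  then show ?thesis
    using assms(2) by (auto simp: differentiable_def)
qed

lemma Ck_on_has_derivative:
  "Ck_on (Suc k) S f \<Longrightarrow> x \<in> S \<Longrightarrow> (f has_derivative frechet_derivative f (at x)) (at x)"
  by (simp add: frechet_derivative_works)

lemma Ck_on_const: "open S \<Longrightarrow> Ck_on k S (\<lambda>x. c)"
  by (induction k arbitrary: c) simp_all

lemma Ck_on_compose_bounded_linear: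
  "open S \<Longrightarrow> bounded_linear h \<Longrightarrow> Ck_on k S f \<Longrightarrow> Ck_on k S (\<lambda>x. h (f x))"
proof (induction k arbitrary: f)
  case 0
  then show ?case by (simp add: bounded_linear.continuous_on)
next
  case (Suc k)
  show ?case
  proof (rule Ck_on_SucI[where f'="\<lambda>x v. h (frechet_derivative f (at x) v)"])
    show "Ck_on k S (\<lambda>x. h (frechet_derivative f (at x) v))" for v
      using Suc.prems(3) by (intro Suc.IH[OF Suc.prems(1,2)]) simp
    show "((\<lambda>x. h (f x)) has_derivative (\<lambda>v. h (frechet_derivative f (at x) v))) (at x)"
      if "x \<in> S" for x
      by (rule bounded_linear.has_derivative[OF Suc.prems(2) Ck_on_has_derivative[OF Suc.prems(3) that]])
  qed (rule Suc.prems(1))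
qed

lemma Ck_on_add:
  "open S \<Longrightarrow> Ck_on k S f \<Longrightarrow> Ck_on k S g \<Longrightarrow> Ck_on k S (\<lambda>x. f x + g x)"
proof (induction k arbitrary: f g)
  case 0
  then show ?case by (simp add: continuous_on_add)
next
  case (Suc k)
  show ?case
  proof (rule Ck_on_SucI[OF Suc.prems(1), where
        f'="\<lambda>x v. frechet_derivative f (at x) v + frechet_derivative g (at x) v"])
    show "Ck_on k S (\<lambda>x. frechet_derivative f (at x) v + frechet_derivative g (at x) v)" for v
      using Suc.prems(2,3) by (intro Suc.IH[OF Suc.prems(1)]) simp_all
  qed (intro has_derivative_add Ck_on_has_derivative[OF Suc.prems(2)] Ck_on_has_derivative[OF Suc.prems(3)])
qed

lemma Ck_on_mult:
  fixes f g :: "_ \<Rightarrow> real"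
  shows "open S \<Longrightarrow> Ck_on k S f \<Longrightarrow> Ck_on k S g \<Longrightarrow> Ck_on k S (\<lambda>x. f x * g x)"
proof (induction k arbitrary: f g)
  case 0
  then show ?case by (simp add: continuous_on_mult)
next
  case (Suc k)
  show ?case
  proof (rule Ck_on_SucI[where
        f'="\<lambda>x v. f x * frechet_derivative g (at x) v + frechet_derivative f (at x) v * g x"])
    show "Ck_on k S (\<lambda>x. f x * frechet_derivative g (at x) v + frechet_derivative f (at x) v * g x)" for v
      using Suc.prems(2,3)
      by (intro Ck_on_add Suc.IH Suc.prems(1) Ck_on_SucD[OF Suc.prems(2)] Ck_on_SucD[OF Suc.prems(3)])
        simp_all
  qed (intro Suc.prems(1) has_derivative_mult Ck_on_has_derivative[OF Suc.prems(2)]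
      Ck_on_has_derivative[OF Suc.prems(3)])+
qed

text \<open>The derivative of 1/f again contains 1/f, but only C^k is asked of it, which is the
  induction hypothesis for the same \<open>f\<close>.\<close>

lemma Ck_on_inverse:
  fixes f :: "_ \<Rightarrow> real"
  assumes "open S" "\<And>x. x \<in> S \<Longrightarrow> f x \<noteq> 0"
  shows "Ck_on k S f \<Longrightarrow> Ck_on k S (\<lambda>x. inverse (f x))"
proof (induction k)
  case 0
  then show ?case using assms by (auto intro!: continuous_on_inverse)
next
  case (Suc k)
  have 1: "Ck_on k S (\<lambda>x. inverse (f x))"
    using Suc Ck_on_SucD by blast
  show ?case
  proof (rule Ck_on_SucI[OF assms(1), where
        f'="\<lambda>x v. (- 1) * (inverse (f x) * frechet_derivative f (at x) v * inverse (f x))"])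
    show "((\<lambda>x. inverse (f x)) has_derivative
       (\<lambda>v. (- 1) * (inverse (f x) * frechet_derivative f (at x) v * inverse (f x)))) (at x)"
      if "x \<in> S" for x
      using Deriv.has_derivative_inverse[OF assms(2)[OF that] Ck_on_has_derivative[OF Suc.prems that]]
      by simp
  qed (use Suc.prems 1 in \<open>intro Ck_on_mult Ck_on_const assms; simp\<close>)
qed

lemma Ck_on_exp:
  fixes f :: "_ \<Rightarrow> real"
  assumes "open S"
  shows "Ck_on k S f \<Longrightarrow> Ck_on k S (\<lambda>x. exp (f x))"
proof (induction k)
  case 0
  then show ?case by (auto intro!: continuous_on_exp)
next
  case (Suc k)
  show ?case
  proof (rule Ck_on_SucI[OF assms(1), where f'="\<lambda>x v. frechet_derivative f (at x) v * exp (f x)"])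
    show "((\<lambda>x. exp (f x)) has_derivative (\<lambda>v. frechet_derivative f (at x) v * exp (f x))) (at x)"
      if "x \<in> S" for x
      using has_derivative_exp[OF Ck_on_has_derivative[OF Suc.prems that]] .
  qed (use Suc.prems Suc.IH[OF Ck_on_SucD[OF Suc.prems]] in \<open>intro Ck_on_mult assms; simp\<close>)
qed

lemma linear_real_expand:
  fixes h :: "'e::euclidean_space \<Rightarrow> real"
  assumes "linear h"
  shows "h v = (\<Sum>b\<in>Basis. (v \<bullet> b) * h b)"
proof -
  have "h v = h (\<Sum>b\<in>Basis. (v \<bullet> b) *\<^sub>R b)"
    by (simp add: euclidean_representation)
  also have "\<dots> = (\<Sum>b\<in>Basis. (v \<bullet> b) * h b)"
    using assms by (simp add: linear_sum linear_cmul)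
  finally show ?thesis .
qed

lemma Ck_on_sum:
  "open S \<Longrightarrow> (\<And>i. i \<in> I \<Longrightarrow> Ck_on k S (f i)) \<Longrightarrow> Ck_on k S (\<lambda>x. \<Sum>i\<in>I. f i x)"
  by (induction I rule: infinite_finite_induct) (auto intro: Ck_on_add Ck_on_const)

text \<open>The chain rule applies the derivative of \<open>f\<close> to a direction that varies
  with the point, whereas \<open>Ck_on\<close> speaks of fixed directions only. Expanding the
  direction in a basis turns the derivative into a sum of products of C^k functions.\<close>

lemma Ck_on_compose:
  fixes f :: "'e::euclidean_space \<Rightarrow> real" and T :: "'d::real_normed_vector \<Rightarrow> 'e"
  assumes "open S"
  shows "T ` S \<subseteq> S' \<Longrightarrow> Ck_on k S T \<Longrightarrow> Ck_on k S' f \<Longrightarrow> Ck_on k S (\<lambda>x. f (T x))"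
proof (induction k arbitrary: f)
  case 0
  then show ?case by (auto intro: continuous_on_compose2)
next
  case (Suc k)
  note T = \<open>Ck_on (Suc k) S T\<close>
  have df: "(f has_derivative frechet_derivative f (at (T x))) (at (T x))" if "x \<in> S" for x
    using Ck_on_has_derivative[OF Suc.prems(3)] Suc.prems(1) that by auto
  show ?case
  proof (rule Ck_on_SucI[OF assms, where f'="\<lambda>x v.
        \<Sum>b\<in>Basis. (frechet_derivative T (at x) v \<bullet> b) * frechet_derivative f (at (T x)) b"])
    fix x assume x: "x \<in> S"
    have "linear (frechet_derivative f (at (T x)))"
      using df[OF x] by (simp add: has_derivative_linear)
    then show "((\<lambda>x. f (T x)) has_derivative (\<lambda>v.
        \<Sum>b\<in>Basis. (frechet_derivative T (at x) v \<bullet> b) * frechet_derivative f (at (T x)) b)) (at x)"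
      using has_derivative_compose[OF Ck_on_has_derivative[OF T x] df[OF x]]
      by (simp add: linear_real_expand[symmetric])
  next
    fix v
    show "Ck_on k S (\<lambda>x. \<Sum>b\<in>Basis. (frechet_derivative T (at x) v \<bullet> b) * frechet_derivative f (at (T x)) b)"
    proof (intro Ck_on_sum Ck_on_mult assms)
      fix b
      show "Ck_on k S (\<lambda>x. frechet_derivative T (at x) v \<bullet> b)"
        using T by (intro Ck_on_compose_bounded_linear[OF assms bounded_linear_inner_left]) simp
      show "Ck_on k S (\<lambda>x. frechet_derivative f (at (T x)) b)"
        using Suc.prems(3) by (intro Suc.IH[OF Suc.prems(1) Ck_on_SucD[OF T]]) simp
    qed
  qed
qed

lemma smooth_on_differentiable: "smooth_on S f \<Longrightarrow> x \<in> S \<Longrightarrow> f differentiable (at x)"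
  using Ck_on.simps(2)[of 0 S f, THEN iffD1]
  by (simp add: smooth_on_def)

text \<open>Meant for a potential, of which only the gradient is known explicitly. One order of
  differentiability is gained and then dropped.\<close>

lemma smooth_onI_derivative:
  assumes "open S" "\<And>x. x \<in> S \<Longrightarrow> (f has_derivative f' x) (at x)"
    and "\<And>v. smooth_on S (\<lambda>x. f' x v)"
  shows "smooth_on S f"
  unfolding smooth_on_def
proof
  fix k
  show "Ck_on k S f"
    using assms(3) by (intro Ck_on_SucD[OF Ck_on_SucI[OF assms(1,2)]]) (simp_all add: smooth_on_def)
qed

lemma smooth_on_local:
  assumes "\<And>x. x \<in> S \<Longrightarrow> \<exists>T. x \<in> T \<and> open T \<and> smooth_on T f"
  shows "smooth_on S f"
  unfolding smooth_on_def
proof (intro allI Ck_on_local)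
  fix k x assume "x \<in> S"
  then show "\<exists>T. x \<in> T \<and> open T \<and> Ck_on k T f"
    using assms[of x] by (auto simp: smooth_on_def)
qed

lemma smooth_on_subset: "smooth_on S f \<Longrightarrow> T \<subseteq> S \<Longrightarrow> smooth_on T f"
  by (simp add: smooth_on_def Ck_on_subset[of _ S f T])

lemma smooth_on_cong:
  "open S \<Longrightarrow> (\<And>x. x \<in> S \<Longrightarrow> f x = g x) \<Longrightarrow> smooth_on S f \<Longrightarrow> smooth_on S g"
  by (simp add: smooth_on_def Ck_on_cong[of S f g])

section \<open>Charts of a smooth manifold\<close>

locale smooth_mfd =
  fixes M :: "('a::{t2_space,second_countable_topology}, real^'n) atlas"
  assumes smooth_manifold: "smooth_manifold M"
begin

lemma chart_homeomorphism:
  assumes "(U, \<phi>) \<in> M"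
  obtains \<psi> where "homeomorphism U (\<phi> ` U) \<phi> \<psi>"
  using assms smooth_manifold by (fastforce simp: smooth_manifold_def chart_def)

lemma chart_open: "(U, \<phi>) \<in> M \<Longrightarrow> open U"
  using smooth_manifold by (fastforce simp: smooth_manifold_def chart_def)

lemma chart_open_image_domain: "(U, \<phi>) \<in> M \<Longrightarrow> open (\<phi> ` U)"
  using smooth_manifold by (fastforce simp: smooth_manifold_def chart_def)

lemma chart_inj_on:
  assumes "(U, \<phi>) \<in> M"
  shows "inj_on \<phi> U"
proof -
  obtain \<psi> where "homeomorphism U (\<phi> ` U) \<phi> \<psi>"
    using chart_homeomorphism[OF assms] .
  then show ?thesis
    by (intro inj_on_inverseI[of U \<psi>]) (simp add: homeomorphism_def)
qed

lemma chart_continuous: "(U, \<phi>) \<in> M \<Longrightarrow> continuous_on U \<phi>"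
  using chart_homeomorphism[of U \<phi>] by (auto simp: homeomorphism_def)

lemma chart_open_image:
  assumes "(U, \<phi>) \<in> M" "open W"
  shows "open (\<phi> ` (U \<inter> W))"
proof -
  obtain \<psi> where h: "homeomorphism U (\<phi> ` U) \<phi> \<psi>"
    using chart_homeomorphism[OF assms(1)] .
  have "openin (top_of_set (\<phi> ` U)) (\<phi> ` (U \<inter> W))"
    by (rule homeomorphism_imp_open_map[OF h]) (use assms(2) in \<open>auto simp: openin_open\<close>)
  then show ?thesis
    using chart_open_image_domain[OF assms(1)] by (simp add: openin_open_eq)
qed

lemma chart_inv: "(U, \<phi>) \<in> M \<Longrightarrow> p \<in> U \<Longrightarrow> inv_into U \<phi> (\<phi> p) = p"
  by (simp add: chart_inj_on inv_into_f_f)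

lemma chart_at:
  obtains U \<phi> where "(U, \<phi>) \<in> M" "p \<in> U"
proof -
  have "p \<in> (\<Union>(U, \<phi>)\<in>M. U)"
    using smooth_manifold by (simp add: smooth_manifold_def)
  then show thesis using that by auto
qed

lemma chart_change_smooth:
  "(U, \<phi>) \<in> M \<Longrightarrow> (V, \<psi>) \<in> M \<Longrightarrow> smooth_on (\<phi> ` (U \<inter> V)) (\<psi> \<circ> inv_into U \<phi>)"
  using smooth_manifold by (fastforce simp: smooth_manifold_def)

subsection \<open>Smooth functions\<close>

lemma smooth_funI:
  "(\<And>U \<phi>. (U, \<phi>) \<in> M \<Longrightarrow> smooth_on (\<phi> ` (U \<inter> W)) (\<lambda>y. f (inv_into U \<phi> y))) \<Longrightarrow> smooth_fun M W f"
  by (auto simp: smooth_fun_def o_def)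

lemma smooth_funD:
  "smooth_fun M W f \<Longrightarrow> (U, \<phi>) \<in> M \<Longrightarrow> smooth_on (\<phi> ` (U \<inter> W)) (\<lambda>y. f (inv_into U \<phi> y))"
  by (auto simp: smooth_fun_def o_def)

lemma smooth_fun_subset:
  assumes "smooth_fun M W f" "V \<subseteq> W"
  shows "smooth_fun M V f"
proof (rule smooth_funI)
  fix U \<phi> assume "(U, \<phi>) \<in> M"
  from smooth_funD[OF assms(1) this] show "smooth_on (\<phi> ` (U \<inter> V)) (\<lambda>y. f (inv_into U \<phi> y))"
    by (rule smooth_on_subset) (use assms(2) in blast)
qed

lemma smooth_fun_cong:
  assumes "open W" "\<And>p. p \<in> W \<Longrightarrow> f p = h p" "smooth_fun M W f"
  shows "smooth_fun M W h"
proof (rule smooth_funI)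
  fix U \<phi> assume c: "(U, \<phi>) \<in> M"
  have "f (inv_into U \<phi> y) = h (inv_into U \<phi> y)" if "y \<in> \<phi> ` (U \<inter> W)" for y
    using that assms(2) chart_inv[OF c] by auto
  then show "smooth_on (\<phi> ` (U \<inter> W)) (\<lambda>y. h (inv_into U \<phi> y))"
    by (rule smooth_on_cong[OF chart_open_image[OF c assms(1)] _ smooth_funD[OF assms(3) c]])
qed

lemma smooth_fun_local:
  assumes "\<And>p. p \<in> W \<Longrightarrow> \<exists>V. open V \<and> p \<in> V \<and> smooth_fun M V f"
  shows "smooth_fun M W f"
proof (intro smooth_funI smooth_on_local)
  fix U \<phi> y assume c: "(U, \<phi>) \<in> M" and "y \<in> \<phi> ` (U \<inter> W)"
  then obtain p where p: "p \<in> U" "p \<in> W" "y = \<phi> p" by auto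
  then obtain V where V: "open V" "p \<in> V" "smooth_fun M V f"
    using assms by blast
  show "\<exists>T. y \<in> T \<and> open T \<and> smooth_on T (\<lambda>y. f (inv_into U \<phi> y))"
    using chart_open_image[OF c V(1)] smooth_funD[OF V(3) c] p V(2)
    by (intro exI[of _ "\<phi> ` (U \<inter> V)"]) auto
qed

lemma smooth_fun_const: "open W \<Longrightarrow> smooth_fun M W (\<lambda>_. c)"
  by (rule smooth_funI) (simp add: smooth_on_def Ck_on_const chart_open_image)

lemma smooth_fun_add:
  assumes "open W" "smooth_fun M W f" "smooth_fun M W h"
  shows "smooth_fun M W (\<lambda>p. f p + h p)"
  using smooth_funD[OF assms(2)] smooth_funD[OF assms(3)]
  by (intro smooth_funI) (simp add: smooth_on_def Ck_on_add chart_open_image[OF _ assms(1)])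

lemma smooth_fun_mult:
  assumes "open W" "smooth_fun M W f" "smooth_fun M W h"
  shows "smooth_fun M W (\<lambda>p. f p * h p)"
  using smooth_funD[OF assms(2)] smooth_funD[OF assms(3)]
  by (intro smooth_funI) (simp add: smooth_on_def Ck_on_mult chart_open_image[OF _ assms(1)])

lemma smooth_fun_inverse:
  assumes "open W" "smooth_fun M W f" "\<And>p. p \<in> W \<Longrightarrow> f p \<noteq> 0"
  shows "smooth_fun M W (\<lambda>p. inverse (f p))"
proof (rule smooth_funI)
  fix U \<phi> assume c: "(U, \<phi>) \<in> M"
  have "f (inv_into U \<phi> y) \<noteq> 0" if "y \<in> \<phi> ` (U \<inter> W)" for y
    using that assms(3) chart_inv[OF c] by auto
  then show "smooth_on (\<phi> ` (U \<inter> W)) (\<lambda>y. inverse (f (inv_into U \<phi> y)))"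
    using smooth_funD[OF assms(2) c]
    by (simp add: smooth_on_def Ck_on_inverse[OF chart_open_image[OF c assms(1)]])
qed

lemma smooth_fun_exp:
  assumes "open W" "smooth_fun M W f"
  shows "smooth_fun M W (\<lambda>p. exp (f p))"
  using smooth_funD[OF assms(2)]
  by (intro smooth_funI) (simp add: smooth_on_def Ck_on_exp chart_open_image[OF _ assms(1)])

lemma smooth_fun_cmult:
  assumes "open W" "smooth_fun M W f"
  shows "smooth_fun M W (\<lambda>p. c * f p)"
  by (intro smooth_fun_mult smooth_fun_const assms)

lemma smooth_fun_diff:
  assumes "open W" "smooth_fun M W f" "smooth_fun M W h"
  shows "smooth_fun M W (\<lambda>p. f p - h p)"
  using smooth_fun_add[OF assms(1,2) smooth_fun_cmult[OF assms(1,3), of "-1"]] by simp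

lemma smooth_fun_sum:
  assumes "open W"
  shows "(\<And>i. i \<in> I \<Longrightarrow> smooth_fun M W (f i)) \<Longrightarrow> smooth_fun M W (\<lambda>p. \<Sum>i\<in>I. f i p)"
  by (induction I rule: infinite_finite_induct)
    (simp_all add: smooth_fun_add smooth_fun_const assms)

lemma smooth_fun_prod:
  assumes "open W"
  shows "(\<And>i. i \<in> I \<Longrightarrow> smooth_fun M W (f i)) \<Longrightarrow> smooth_fun M W (\<lambda>p. \<Prod>i\<in>I. f i p)"
  by (induction I rule: infinite_finite_induct)
    (simp_all add: smooth_fun_mult smooth_fun_const assms)

text \<open>The Leibniz formula consists of sums and products. This serves Cramer's rule for the
  coefficients of a field in a frame.\<close>

lemma smooth_fun_det:
  fixes A :: "'a \<Rightarrow> real^'k^'k"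
  assumes "open W" "\<And>i j. smooth_fun M W (\<lambda>p. A p $ i $ j)"
  shows "smooth_fun M W (\<lambda>p. det (A p))"
  unfolding det_def
  by (intro smooth_fun_sum smooth_fun_cmult smooth_fun_prod assms)

lemma smooth_fun_coord:
  assumes "(U, \<phi>) \<in> M"
  shows "smooth_fun M U (\<lambda>q. \<phi> q $ j)"
proof (rule smooth_funI)
  fix V \<psi> assume c: "(V, \<psi>) \<in> M"
  show "smooth_on (\<psi> ` (V \<inter> U)) (\<lambda>y. \<phi> (inv_into V \<psi> y) $ j)"
    using chart_change_smooth[OF c assms]
      Ck_on_compose_bounded_linear[OF chart_open_image[OF c chart_open[OF assms]] bounded_linear_vec_nth]
    by (auto simp: smooth_on_def o_def)
qed

text \<open>Smoothness has to be shown in every chart; the transition maps carry it over from the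
  given one.\<close>

lemma smooth_fun_chart:
  assumes c: "(U, \<phi>) \<in> M" and "W \<subseteq> U" "open W" "smooth_on (\<phi> ` W) h"
  shows "smooth_fun M W (\<lambda>q. h (\<phi> q))"
proof (rule smooth_funI)
  fix V \<psi> assume d: "(V, \<psi>) \<in> M"
  have "smooth_on (\<psi> ` (V \<inter> W)) (\<phi> \<circ> inv_into V \<psi>)"
    by (rule smooth_on_subset[OF chart_change_smooth[OF d c]]) (use assms(2) in blast)
  moreover have "(\<phi> \<circ> inv_into V \<psi>) ` (\<psi> ` (V \<inter> W)) \<subseteq> \<phi> ` W"
    using chart_inv[OF d] by auto
  ultimately show "smooth_on (\<psi> ` (V \<inter> W)) (\<lambda>y. h (\<phi> (inv_into V \<psi> y)))"
    using Ck_on_compose[OF chart_open_image[OF d assms(3)], of "\<phi> \<circ> inv_into V \<psi>" _ _ h] assms(4)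
    by (simp add: smooth_on_def)
qed

lemma smooth_nearI: "open V \<Longrightarrow> p \<in> V \<Longrightarrow> smooth_fun M V f \<Longrightarrow> smooth_near M p f"
  by (auto simp: smooth_near_def)

lemma smooth_near_cong:
  assumes "open V" "p \<in> V" "\<And>q. q \<in> V \<Longrightarrow> f q = h q"
  shows "smooth_near M p f \<longleftrightarrow> smooth_near M p h"
proof -
  have "smooth_near M p h" if f: "smooth_near M p f" and eq: "\<And>q. q \<in> V \<Longrightarrow> f q = h q" for f h
  proof -
    obtain W where W: "open W" "p \<in> W" "smooth_fun M W f"
      using f by (auto simp: smooth_near_def)
    have "smooth_fun M (V \<inter> W) h"
      by (rule smooth_fun_cong[OF open_Int[OF assms(1) W(1)] eq smooth_fun_subset[OF W(3)]]) auto
    then show ?thesis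
      using assms(1,2) W(1,2) by (intro smooth_nearI[of "V \<inter> W"]) auto
  qed
  then show ?thesis using assms(3) by force
qed

lemma smooth_near_differentiable:
  assumes "smooth_near M p f" "(U, \<phi>) \<in> M" "p \<in> U"
  shows "(\<lambda>y. f (inv_into U \<phi> y)) differentiable (at (\<phi> p))"
proof -
  obtain W where "open W" "p \<in> W" "smooth_fun M W f"
    using assms(1) unfolding smooth_near_def by blast
  then show ?thesis
    using smooth_on_differentiable[OF smooth_funD[OF _ assms(2)]] assms(3) by blast
qed

subsection \<open>Tangent vectors\<close>

text \<open>The components of \<open>v\<close> in a chart, obtained by letting \<open>v\<close> act
  on the coordinate functions. These are smooth only on the chart domain, which suffices because
  tangent vectors depend on germs.\<close>

definition coords :: "('a \<Rightarrow> real^'n) \<Rightarrow> 'a tvec \<Rightarrow> real^'n" where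
  "coords \<phi> v = (\<chi> j. v (\<lambda>q. \<phi> q $ j))"

lemma coords_nth [simp]: "coords \<phi> v $ j = v (\<lambda>q. \<phi> q $ j)"
  by (simp add: coords_def)

text \<open>Membership in the tangent space provides some chart, not the one at hand. The chain rule
  through the transition map \<open>T\<close> changes the chart, and testing on the coordinate
  functions identifies the transported direction as \<open>coords \<phi> v\<close>.\<close>

lemma tangent_chart:
  assumes v: "v \<in> tangent_space M p" and c: "(U, \<phi>) \<in> M" "p \<in> U" and f: "smooth_near M p f"
  shows "v f = frechet_derivative (\<lambda>y. f (inv_into U \<phi> y)) (at (\<phi> p)) (coords \<phi> v)"
proof -
  obtain V \<psi> w where d: "(V, \<psi>) \<in> M" "p \<in> V" and
    v: "v = (\<lambda>f. if smooth_near M p f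
                   then frechet_derivative (f \<circ> inv_into V \<psi>) (at (\<psi> p)) w else 0)"
    using v by (auto simp: tangent_space_def)
  define T where "T = \<phi> \<circ> inv_into V \<psi>"
  define T' where "T' = frechet_derivative T (at (\<psi> p))"
  have S: "open (\<psi> ` (V \<inter> U))" "\<psi> p \<in> \<psi> ` (V \<inter> U)"
    using chart_open_image[OF d(1) chart_open[OF c(1)]] c(2) d(2) by auto
  have T: "(T has_derivative T') (at (\<psi> p))"
    unfolding T'_def T_def
    using smooth_on_differentiable[OF chart_change_smooth[OF d(1) c(1)] S(2)]
    by (simp add: frechet_derivative_works)
  have Tp: "T (\<psi> p) = \<phi> p"
    using chart_inv[OF d] by (simp add: T_def)
  have eq: "(f \<circ> inv_into V \<psi>) y = ((\<lambda>y. f (inv_into U \<phi> y)) \<circ> T) y" if "y \<in> \<psi> ` (V \<inter> U)" for y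
    using that chart_inv[OF c(1)] chart_inv[OF d(1)] by (auto simp: T_def)
  have "((\<lambda>y. f (inv_into U \<phi> y)) \<circ> T has_derivative
      frechet_derivative (\<lambda>y. f (inv_into U \<phi> y)) (at (\<phi> p)) \<circ> T') (at (\<psi> p))"
    using smooth_near_differentiable[OF f c] Tp
    by (intro diff_chain_at T) (simp add: frechet_derivative_works)
  then have "(f \<circ> inv_into V \<psi> has_derivative
      frechet_derivative (\<lambda>y. f (inv_into U \<phi> y)) (at (\<phi> p)) \<circ> T') (at (\<psi> p))"
    by (rule has_derivative_transform_within_open[OF _ S]) (use eq in simp)
  then have "v f = frechet_derivative (\<lambda>y. f (inv_into U \<phi> y)) (at (\<phi> p)) (T' w)"
    using f by (simp add: v frechet_derivative_at[symmetric])
  moreover have "v (\<lambda>q. \<phi> q $ j) = T' w $ j" for j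
  proof -
    have "(((\<lambda>q. \<phi> q $ j) \<circ> inv_into V \<psi>) has_derivative (\<lambda>x. T' x $ j)) (at (\<psi> p))"
      using bounded_linear.has_derivative[OF bounded_linear_vec_nth T] by (simp add: T_def o_def)
    then have "frechet_derivative ((\<lambda>q. \<phi> q $ j) \<circ> inv_into V \<psi>) (at (\<psi> p)) = (\<lambda>x. T' x $ j)"
      using frechet_derivative_at by metis
    then show ?thesis
      using smooth_nearI[OF chart_open[OF c(1)] c(2) smooth_fun_coord[OF c(1)]] by (simp add: v)
  qed
  then have "coords \<phi> v = T' w"
    by (simp add: vec_eq_iff)
  ultimately show ?thesis by simp
qed

lemma tangent_not_smooth: "v \<in> tangent_space M p \<Longrightarrow> \<not> smooth_near M p f \<Longrightarrow> v f = 0"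
  by (auto simp: tangent_space_def)

text \<open>Working form of \<open>tangent_chart\<close>: a derivative found by the usual rules
  replaces the chosen one.\<close>

lemma tangent_has_derivative:
  assumes "v \<in> tangent_space M p" "(U, \<phi>) \<in> M" "p \<in> U" "smooth_near M p f"
    and "((\<lambda>y. f (inv_into U \<phi> y)) has_derivative F) (at (\<phi> p))"
  shows "v f = F (coords \<phi> v)"
  using tangent_chart[OF assms(1-4)] frechet_derivative_at[OF assms(5)] by simp

lemma smooth_near_has_derivative:
  assumes "smooth_near M p f" "(U, \<phi>) \<in> M" "p \<in> U" "v \<in> tangent_space M p"
  obtains F where "((\<lambda>y. f (inv_into U \<phi> y)) has_derivative F) (at (\<phi> p))" "v f = F (coords \<phi> v)"
  using tangent_chart[OF assms(4,2,3,1)] smooth_near_differentiable[OF assms(1-3)]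
  by (meson frechet_derivative_works)

lemma tangent_eqI:
  assumes "v \<in> tangent_space M p" "w \<in> tangent_space M p" "(U, \<phi>) \<in> M" "p \<in> U"
    and "coords \<phi> v = coords \<phi> w"
  shows "v = w"
proof
  fix f
  show "v f = w f"
    using tangent_chart[OF assms(1,3,4)] tangent_chart[OF assms(2,3,4)] assms(5)
      tangent_not_smooth[OF assms(1)] tangent_not_smooth[OF assms(2)]
    by (cases "smooth_near M p f") auto
qed

lemma tangentI:
  assumes "(U, \<phi>) \<in> M" "p \<in> U"
    and "\<And>f. smooth_near M p f \<Longrightarrow> v f = frechet_derivative (\<lambda>y. f (inv_into U \<phi> y)) (at (\<phi> p)) w"
    and "\<And>f. \<not> smooth_near M p f \<Longrightarrow> v f = 0"
  shows "v \<in> tangent_space M p"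
proof -
  have "v = (\<lambda>f. if smooth_near M p f
                   then frechet_derivative (f \<circ> inv_into U \<phi>) (at (\<phi> p)) w else 0)"
    using assms(3,4) by (auto simp: o_def fun_eq_iff)
  then show ?thesis
    using assms(1,2) by (auto simp: tangent_space_def)
qed

text \<open>By \<open>tangent_chart\<close> any two tangent vectors have directions in the same
  chart, and these add. The value 0 on functions not smooth near \<open>p\<close> is preserved by
  linear combinations.\<close>

lemma tangent_subspace: "subspace (tangent_space M p)"
proof -
  obtain U \<phi> where c: "(U, \<phi>) \<in> M" "p \<in> U"
    using chart_at .
  have lin: "linear (frechet_derivative (\<lambda>y. f (inv_into U \<phi> y)) (at (\<phi> p)))" if "smooth_near M p f" for f
    using linear_frechet_derivative[OF smooth_near_differentiable[OF that c]] .
  show ?thesis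
    unfolding subspace_def
  proof (intro conjI ballI allI)
    show "0 \<in> tangent_space M p"
      by (rule tangentI[OF c, of _ 0]) (use lin in \<open>simp_all add: linear_0\<close>)
    show "v + w \<in> tangent_space M p" if "v \<in> tangent_space M p" "w \<in> tangent_space M p" for v w
      by (rule tangentI[OF c, of _ "coords \<phi> v + coords \<phi> w"])
        (use lin tangent_chart[OF that(1) c] tangent_chart[OF that(2) c]
          tangent_not_smooth[OF that(1)] tangent_not_smooth[OF that(2)] in \<open>simp_all add: linear_add\<close>)
    show "a *\<^sub>R v \<in> tangent_space M p" if "v \<in> tangent_space M p" for v a
      by (rule tangentI[OF c, of _ "a *\<^sub>R coords \<phi> v"])
        (use lin tangent_chart[OF that c] tangent_not_smooth[OF that] in
          \<open>simp_all add: linear_cmul scaleR_fun_def\<close>)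
  qed
qed

lemmas tangent_0 = subspace_0[OF tangent_subspace]
lemmas tangent_plus = subspace_add[OF tangent_subspace]
lemmas tangent_minus = subspace_diff[OF tangent_subspace]
lemmas tangent_scaleR = subspace_scale[OF tangent_subspace]
lemmas tangent_sum = subspace_sum[OF tangent_subspace]

text \<open>If one of two locally equal functions fails to be smooth near \<open>p\<close>, so does
  the other, and both values are the default 0.\<close>

lemma tangent_local:
  assumes v: "v \<in> tangent_space M p" and V: "open V" "p \<in> V" "\<And>q. q \<in> V \<Longrightarrow> f q = h q"
  shows "v f = v h"
proof (cases "smooth_near M p h")
  case True
  then have f: "smooth_near M p f"
    using smooth_near_cong[OF V] by simp
  obtain U \<phi> where c: "(U, \<phi>) \<in> M" "p \<in> U"
    using chart_at .
  obtain H where H: "((\<lambda>y. h (inv_into U \<phi> y)) has_derivative H) (at (\<phi> p))" "v h = H (coords \<phi> v)"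
    using smooth_near_has_derivative[OF True c v] .
  have "((\<lambda>y. f (inv_into U \<phi> y)) has_derivative H) (at (\<phi> p))"
    by (rule has_derivative_transform_within_open[OF H(1) chart_open_image[OF c(1) V(1)]])
      (use c V chart_inv[OF c(1)] in auto)
  then show ?thesis
    using tangent_has_derivative[OF v c f] H(2) by simp
next
  case False
  then show ?thesis
    using smooth_near_cong[OF V] tangent_not_smooth[OF v] by simp
qed

lemma smooth_near_const: "smooth_near M p (\<lambda>_. c)"
  by (rule smooth_nearI[of UNIV]) (simp_all add: smooth_fun_const)

lemma smooth_near_common:
  assumes "smooth_near M p f" "smooth_near M p h"
  obtains W where "open W" "p \<in> W" "smooth_fun M W f" "smooth_fun M W h"
proof -
  obtain V W where VW: "open W" "p \<in> W" "smooth_fun M W f" "open V" "p \<in> V" "smooth_fun M V h"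
    using assms by (auto simp: smooth_near_def)
  show thesis
    by (rule that[of "V \<inter> W"])
      (use VW smooth_fun_subset[OF VW(3), of "V \<inter> W"] smooth_fun_subset[OF VW(6), of "V \<inter> W"] in auto)
qed

lemma smooth_near_add:
  assumes "smooth_near M p f" "smooth_near M p h"
  shows "smooth_near M p (\<lambda>q. f q + h q)"
  by (rule smooth_near_common[OF assms]) (auto intro: smooth_nearI smooth_fun_add)

lemma smooth_near_mult:
  assumes "smooth_near M p f" "smooth_near M p h"
  shows "smooth_near M p (\<lambda>q. f q * h q)"
  by (rule smooth_near_common[OF assms]) (auto intro: smooth_nearI smooth_fun_mult)

lemma smooth_near_exp: "smooth_near M p f \<Longrightarrow> smooth_near M p (\<lambda>q. exp (f q))"
  unfolding smooth_near_def using smooth_fun_exp by blast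

lemma smooth_near_sum:
  "(\<And>i. i \<in> I \<Longrightarrow> smooth_near M p (f i)) \<Longrightarrow> smooth_near M p (\<lambda>q. \<Sum>i\<in>I. f i q)"
  by (induction I rule: infinite_finite_induct) (simp_all add: smooth_near_const smooth_near_add)

lemma tangent_const:
  assumes v: "v \<in> tangent_space M p"
  shows "v (\<lambda>_. c) = 0"
proof -
  obtain U \<phi> where c: "(U, \<phi>) \<in> M" "p \<in> U"
    using chart_at .
  show ?thesis
    using tangent_has_derivative[OF v c smooth_near_const has_derivative_const] .
qed

lemma tangent_add:
  assumes v: "v \<in> tangent_space M p" and f: "smooth_near M p f" and h: "smooth_near M p h"
  shows "v (\<lambda>q. f q + h q) = v f + v h"
proof -
  obtain U \<phi> where c: "(U, \<phi>) \<in> M" "p \<in> U"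
    using chart_at .
  obtain F where F: "((\<lambda>y. f (inv_into U \<phi> y)) has_derivative F) (at (\<phi> p))" "v f = F (coords \<phi> v)"
    using smooth_near_has_derivative[OF f c v] .
  obtain H where H: "((\<lambda>y. h (inv_into U \<phi> y)) has_derivative H) (at (\<phi> p))" "v h = H (coords \<phi> v)"
    using smooth_near_has_derivative[OF h c v] .
  show ?thesis
    using tangent_has_derivative[OF v c smooth_near_add[OF f h] has_derivative_add[OF F(1) H(1)]] F H
    by simp
qed

lemma tangent_mult:
  assumes v: "v \<in> tangent_space M p" and f: "smooth_near M p f" and h: "smooth_near M p h"
  shows "v (\<lambda>q. f q * h q) = f p * v h + v f * h p"
proof -
  obtain U \<phi> where c: "(U, \<phi>) \<in> M" "p \<in> U"
    using chart_at .
  obtain F where F: "((\<lambda>y. f (inv_into U \<phi> y)) has_derivative F) (at (\<phi> p))" "v f = F (coords \<phi> v)"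
    using smooth_near_has_derivative[OF f c v] .
  obtain H where H: "((\<lambda>y. h (inv_into U \<phi> y)) has_derivative H) (at (\<phi> p))" "v h = H (coords \<phi> v)"
    using smooth_near_has_derivative[OF h c v] .
  show ?thesis
    using tangent_has_derivative[OF v c smooth_near_mult[OF f h] has_derivative_mult[OF F(1) H(1)]]
      F H chart_inv[OF c] by simp
qed

lemma tangent_exp:
  assumes v: "v \<in> tangent_space M p" and f: "smooth_near M p f"
  shows "v (\<lambda>q. exp (f q)) = v f * exp (f p)"
proof -
  obtain U \<phi> where c: "(U, \<phi>) \<in> M" "p \<in> U"
    using chart_at .
  obtain F where F: "((\<lambda>y. f (inv_into U \<phi> y)) has_derivative F) (at (\<phi> p))" "v f = F (coords \<phi> v)"
    using smooth_near_has_derivative[OF f c v] .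
  show ?thesis
    using tangent_has_derivative[OF v c smooth_near_exp[OF f] has_derivative_exp[OF F(1)]]
      F chart_inv[OF c] by simp
qed

lemma tangent_cmult:
  assumes v: "v \<in> tangent_space M p" and f: "smooth_near M p f"
  shows "v (\<lambda>q. c * f q) = c * v f"
  using tangent_mult[OF v smooth_near_const f] tangent_const[OF v] by simp

lemma tangent_function_sum:
  assumes v: "v \<in> tangent_space M p"
  shows "(\<And>i. i \<in> I \<Longrightarrow> smooth_near M p (f i)) \<Longrightarrow> v (\<lambda>q. \<Sum>i\<in>I. f i q) = (\<Sum>i\<in>I. v (f i))"
  by (induction I rule: infinite_finite_induct)
    (simp_all add: tangent_const[OF v] tangent_add[OF v] smooth_near_sum)

subsection \<open>Vector fields\<close>

lemma vfieldI:
  assumes "\<And>p. p \<in> W \<Longrightarrow> X p \<in> tangent_space M p" "\<And>p. p \<notin> W \<Longrightarrow> X p = 0"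
    and "\<And>V f. open V \<Longrightarrow> V \<subseteq> W \<Longrightarrow> smooth_fun M V f \<Longrightarrow> smooth_fun M V (\<lambda>p. X p f)"
  shows "X \<in> vector_fields M W"
  using assms by (auto simp: vector_fields_def)

lemma vfield_outside: "X \<in> vector_fields M W \<Longrightarrow> p \<notin> W \<Longrightarrow> X p = 0"
  by (auto simp: vector_fields_def)

lemma vfield_tangent: "X \<in> vector_fields M W \<Longrightarrow> X p \<in> tangent_space M p"
  using tangent_0[of p] by (cases "p \<in> W") (auto simp: vector_fields_def)

lemma vfield_smooth:
  "X \<in> vector_fields M W \<Longrightarrow> open V \<Longrightarrow> V \<subseteq> W \<Longrightarrow> smooth_fun M V f \<Longrightarrow> smooth_fun M V (\<lambda>p. X p f)"
  by (auto simp: vector_fields_def)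

lemma vfield_smooth_near:
  assumes "X \<in> vector_fields M W" "open W" "p \<in> W" "smooth_near M p f"
  shows "smooth_near M p (\<lambda>q. X q f)"
proof -
  obtain V where V: "open V" "p \<in> V" "smooth_fun M V f"
    using assms(4) by (auto simp: smooth_near_def)
  have "smooth_fun M (V \<inter> W) (\<lambda>q. X q f)"
    by (rule vfield_smooth[OF assms(1) _ _ smooth_fun_subset[OF V(3)]]) (use V assms in auto)
  then show ?thesis
    using V assms by (intro smooth_nearI[of "V \<inter> W"]) auto
qed

lemma vfield_add:
  "X \<in> vector_fields M W \<Longrightarrow> Y \<in> vector_fields M W \<Longrightarrow> X + Y \<in> vector_fields M W"
  by (rule vfieldI)
    (simp_all add: tangent_plus vfield_tangent vfield_outside[of X W] vfield_outside[of Y W]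
      smooth_fun_add vfield_smooth[of X W] vfield_smooth[of Y W])

lemma vfield_fscale:
  assumes "X \<in> vector_fields M W" "smooth_fun M W f"
  shows "fscale f X \<in> vector_fields M W"
proof (rule vfieldI)
  fix V h assume V: "open V" "V \<subseteq> W" "smooth_fun M V h"
  then show "smooth_fun M V (\<lambda>p. fscale f X p h)"
    by (simp add: fscale_def scaleR_fun_def smooth_fun_mult vfield_smooth[OF assms(1)] smooth_fun_subset[OF assms(2)])
qed (use assms in \<open>simp_all add: fscale_def tangent_scaleR vfield_tangent vfield_outside[of X W]\<close>)

end

lemma sum_function_apply: "(\<Sum>i\<in>I. F i) x = (\<Sum>i\<in>I. F i x)"
  by (induction I rule: infinite_finite_induct) simp_all

lemma sum_rotate: "(\<Sum>i\<in>A. \<Sum>j\<in>B. \<Sum>k\<in>D. F i j k) = (\<Sum>k\<in>D. \<Sum>i\<in>A. \<Sum>j\<in>B. F i j k)"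
proof -
  have "(\<Sum>j\<in>B. \<Sum>k\<in>D. F i j k) = (\<Sum>k\<in>D. \<Sum>j\<in>B. F i j k)" for i
    by (rule sum.swap)
  then show ?thesis
    using sum.swap[of "\<lambda>i k. \<Sum>j\<in>B. F i j k" D A] by simp
qed

lemma bilinear_expand:
  fixes G :: "real^'n \<Rightarrow> real^'m \<Rightarrow> 'v::real_vector"
  assumes "bilinear G"
  shows "G a b = (\<Sum>i\<in>UNIV. \<Sum>j\<in>UNIV. (a $ i * b $ j) *\<^sub>R G (axis i 1) (axis j 1))"
proof -
  have "G a b = G (\<Sum>i\<in>UNIV. a $ i *\<^sub>R axis i 1) (\<Sum>j\<in>UNIV. b $ j *\<^sub>R axis j 1)"
    using basis_expansion[of a] basis_expansion[of b] by (simp add: scalar_mult_eq_scaleR)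
  also have "\<dots> = (\<Sum>(i, j)\<in>UNIV \<times> UNIV. G (a $ i *\<^sub>R axis i 1) (b $ j *\<^sub>R axis j 1))"
    by (rule bilinear_sum[OF assms])
  finally show ?thesis
    by (simp add: sum.cartesian_product bilinear_lmul[OF assms] bilinear_rmul[OF assms] mult.commute)
qed

subsection \<open>Global frames\<close>

text \<open>\<open>C\<close> packs the structure constants into a bracket on R^n. The group is
  absent: left invariance will enter only through pointwise independence and the constancy of
  \<open>C\<close>.\<close>

locale frame = smooth_mfd M
  for M :: "('a::{t2_space,second_countable_topology}, real^'n) atlas" +
  fixes E :: "'n \<Rightarrow> 'a vfield" and C :: "real^'n \<Rightarrow> real^'n \<Rightarrow> real^'n"
  assumes frame_field: "E i \<in> vector_fields M UNIV"
    and frame_independent: "(\<Sum>i\<in>UNIV. c $ i *\<^sub>R E i p) = 0 \<Longrightarrow> c = 0"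
    and bilinear_C: "bilinear C"
    and frame_bracket: "lie_bracket M (E i) (E j) = (\<Sum>k\<in>UNIV. C (axis i 1) (axis j 1) $ k *\<^sub>R E k)"
begin

definition vec_at :: "'a \<Rightarrow> real^'n \<Rightarrow> 'a tvec" where
  "vec_at p c = (\<Sum>i\<in>UNIV. c $ i *\<^sub>R E i p)"

definition coef :: "'a \<Rightarrow> 'a tvec \<Rightarrow> real^'n" where
  "coef p v = (THE c. vec_at p c = v)"

lemma vec_at_apply: "vec_at p c f = (\<Sum>i\<in>UNIV. c $ i * E i p f)"
  by (simp add: vec_at_def sum_function_apply scaleR_fun_def)

lemma linear_vec_at: "linear (vec_at p)"
  by (rule linearI) (simp_all add: vec_at_def scaleR_left_distrib sum.distrib scaleR_sum_right)

lemmas vec_at_add = linear_add[OF linear_vec_at]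
lemmas vec_at_scaleR = linear_cmul[OF linear_vec_at]
lemmas vec_at_diff = linear_diff[OF linear_vec_at]
lemmas vec_at_0 = linear_0[OF linear_vec_at]

lemma vec_at_eq_0_iff: "vec_at p c = 0 \<longleftrightarrow> c = 0"
  using frame_independent[of c p] vec_at_0 by (auto simp: vec_at_def)

lemma vec_at_eq_iff [simp]: "vec_at p c = vec_at p d \<longleftrightarrow> c = d"
  using vec_at_eq_0_iff[of p "c - d"] by (auto simp: vec_at_diff)

lemma coef_vec_at [simp]: "coef p (vec_at p c) = c"
  by (simp add: coef_def)

lemma frame_tangent: "E i p \<in> tangent_space M p"
  using vfield_tangent[OF frame_field] .

lemma vec_at_tangent [simp]: "vec_at p c \<in> tangent_space M p"
  unfolding vec_at_def by (intro tangent_sum tangent_scaleR frame_tangent)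

definition frame_matrix :: "('a \<Rightarrow> real^'n) \<Rightarrow> 'a \<Rightarrow> real^'n^'n" where
  "frame_matrix \<phi> p = (\<chi> j i. E i p (\<lambda>q. \<phi> q $ j))"

lemma coords_vec_at: "coords \<phi> (vec_at p c) = frame_matrix \<phi> p *v c"
  by (simp add: vec_eq_iff vec_at_apply frame_matrix_def matrix_vector_mult_def mult.commute)

text \<open>Tangent vectors are determined by their coordinates, so an independent frame gives an
  injective matrix. It is square, because the frame has as many members as there are coordinates;
  hence it is invertible, and the frame also spans.\<close>

lemma det_frame_matrix:
  assumes "(U, \<phi>) \<in> M" "p \<in> U"
  shows "det (frame_matrix \<phi> p) \<noteq> 0"
proof -
  have "c = 0" if "frame_matrix \<phi> p *v c = 0" for c
  proof -
    have "coords \<phi> (vec_at p c) = coords \<phi> (vec_at p 0)"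
      using that by (simp add: coords_vec_at)
    from tangent_eqI[OF vec_at_tangent vec_at_tangent assms this] show ?thesis
      by simp
  qed
  then show ?thesis
    by (simp add: invertible_det_nz[symmetric] invertible_left_inverse matrix_left_invertible_ker)
qed

lemma tangent_vec_at:
  assumes v: "v \<in> tangent_space M p"
  obtains c where "v = vec_at p c"
proof -
  obtain U \<phi> where c: "(U, \<phi>) \<in> M" "p \<in> U"
    using chart_at .
  obtain a where "frame_matrix \<phi> p *v a = coords \<phi> v"
    using cramer[OF det_frame_matrix[OF c]] by blast
  then show thesis
    by (intro that[of a] tangent_eqI[OF v vec_at_tangent c]) (simp add: coords_vec_at)
qed

lemma vec_at_coef [simp]: "v \<in> tangent_space M p \<Longrightarrow> vec_at p (coef p v) = v"
  by (elim tangent_vec_at) simp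

lemma coef_add: "v \<in> tangent_space M p \<Longrightarrow> w \<in> tangent_space M p \<Longrightarrow> coef p (v + w) = coef p v + coef p w"
  by (metis coef_vec_at vec_at_add vec_at_coef)

lemma coef_scaleR: "v \<in> tangent_space M p \<Longrightarrow> coef p (c *\<^sub>R v) = c *\<^sub>R coef p v"
  by (metis coef_vec_at vec_at_scaleR vec_at_coef)

definition vsmooth :: "'a set \<Rightarrow> ('a \<Rightarrow> real^'n) \<Rightarrow> bool" where
  "vsmooth W a \<longleftrightarrow> (\<forall>k. smooth_fun M W (\<lambda>p. a p $ k))"

definition vsmooth_near :: "'a \<Rightarrow> ('a \<Rightarrow> real^'n) \<Rightarrow> bool" where
  "vsmooth_near p a \<longleftrightarrow> (\<forall>k. smooth_near M p (\<lambda>p. a p $ k))"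

definition cf :: "'a vfield \<Rightarrow> 'a \<Rightarrow> real^'n" where
  "cf X = (\<lambda>p. coef p (X p))"

definition comb :: "'a set \<Rightarrow> ('a \<Rightarrow> real^'n) \<Rightarrow> 'a vfield" where
  "comb W a = (\<lambda>p. if p \<in> W then vec_at p (a p) else 0)"

lemma vsmooth_near: "open W \<Longrightarrow> p \<in> W \<Longrightarrow> vsmooth W a \<Longrightarrow> vsmooth_near p a"
  by (auto simp: vsmooth_def vsmooth_near_def intro: smooth_nearI)

text \<open>Near each point Cramer's rule writes the frame coefficients as quotients of determinants
  whose entries are smooth: values of the fields on coordinate functions.\<close>

lemma vsmooth_cf:
  assumes X: "X \<in> vector_fields M W" and W: "open W"
  shows "vsmooth W (cf X)"
  unfolding vsmooth_def
proof (intro allI smooth_fun_local)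
  fix k p assume p: "p \<in> W"
  obtain U \<phi> where c: "(U, \<phi>) \<in> M" "p \<in> U"
    using chart_at .
  define V where "V = U \<inter> W"
  have V: "open V" "V \<subseteq> U" "V \<subseteq> W" "p \<in> V"
    using chart_open[OF c(1)] W c p by (auto simp: V_def)
  have co: "smooth_fun M V (\<lambda>q. \<phi> q $ j)" for j
    using smooth_fun_subset[OF smooth_fun_coord[OF c(1)] V(2)] .
  have A: "smooth_fun M V (\<lambda>p. frame_matrix \<phi> p $ i $ j)" for i j
    unfolding frame_matrix_def using vfield_smooth[OF frame_field V(1) _ co] by simp
  have b: "smooth_fun M V (\<lambda>p. coords \<phi> (X p) $ i)" for i
    using vfield_smooth[OF X V(1,3) co] by simp
  \<comment> \<open>Cramer's numerator: column \<open>k\<close> of the frame matrix is replaced by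
    the coordinates of the field.\<close>
  define D where "D = (\<lambda>p. \<chi> i j. if j = k then coords \<phi> (X p) $ i else frame_matrix \<phi> p $ i $ j)"
  have D: "smooth_fun M V (\<lambda>p. D p $ i $ j)" for i j
    unfolding D_def by (cases "j = k") (use A b in simp_all)
  have quotient: "smooth_fun M V (\<lambda>p. det (D p) * inverse (det (frame_matrix \<phi> p)))"
    by (intro smooth_fun_mult smooth_fun_inverse smooth_fun_det V(1) A D det_frame_matrix[OF c(1)])
      (use V in auto)
  have "det (D q) * inverse (det (frame_matrix \<phi> q)) = cf X q $ k" if "q \<in> V" for q
  proof -
    have q: "q \<in> U" using that V by auto
    have "frame_matrix \<phi> q *v cf X q = coords \<phi> (X q)"
      using coords_vec_at[of \<phi> q "cf X q"] vfield_tangent[OF X, of q] by (simp add: cf_def)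
    then have "cf X q = (\<chi> k. det (\<chi> i j. if j = k then coords \<phi> (X q) $ i else frame_matrix \<phi> q $ i $ j)
        / det (frame_matrix \<phi> q))"
      using cramer[OF det_frame_matrix[OF c(1) q]] by blast
    then have "cf X q $ k = det (D q) / det (frame_matrix \<phi> q)"
      by (simp add: D_def)
    then show ?thesis
      by (simp add: field_simps)
  qed
  then have "smooth_fun M V (\<lambda>p. cf X p $ k)"
    by (rule smooth_fun_cong[OF V(1) _ quotient])
  then show "\<exists>V. open V \<and> p \<in> V \<and> smooth_fun M V (\<lambda>p. cf X p $ k)"
    using V by blast
qed

lemma comb_field:
  assumes "open W" "vsmooth W a"
  shows "comb W a \<in> vector_fields M W"
proof (rule vfieldI)
  fix V f assume V: "open V" "V \<subseteq> W" "smooth_fun M V f"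
  have "smooth_fun M V (\<lambda>p. a p $ i)" for i
    using smooth_fun_subset[OF _ V(2)] assms(2) by (auto simp: vsmooth_def)
  then have "smooth_fun M V (\<lambda>p. \<Sum>i\<in>UNIV. a p $ i * E i p f)"
    using vfield_smooth[OF frame_field V(1) _ V(3)] by (intro smooth_fun_sum smooth_fun_mult V(1)) auto
  then show "smooth_fun M V (\<lambda>p. comb W a p f)"
    by (rule smooth_fun_cong[OF V(1), rotated]) (use V(2) in \<open>auto simp: comb_def vec_at_apply\<close>)
qed (simp_all add: comb_def)

lemma cf_comb [simp]: "p \<in> W \<Longrightarrow> cf (comb W a) p = a p"
  by (simp add: cf_def comb_def)

lemma vfield_at: "X \<in> vector_fields M W \<Longrightarrow> X p = vec_at p (cf X p)"
  by (simp add: cf_def vfield_tangent)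

lemma vfield_eq_combI:
  assumes "\<And>p. p \<in> W \<Longrightarrow> X p = vec_at p (a p)" "\<And>p. p \<notin> W \<Longrightarrow> X p = 0"
  shows "X = comb W a"
  using assms by (auto simp: comb_def)

lemma vfield_eqI:
  assumes "X \<in> vector_fields M W" "Y \<in> vector_fields M W" "\<And>p. p \<in> W \<Longrightarrow> cf X p = cf Y p"
  shows "X = Y"
proof
  fix p show "X p = Y p"
    using vfield_at[OF assms(1), of p] vfield_at[OF assms(2), of p] assms(3)[of p]
      vfield_outside[OF assms(1), of p] vfield_outside[OF assms(2), of p]
    by (cases "p \<in> W") simp_all
qed

lemma cf_add:
  assumes "X \<in> vector_fields M W" "Y \<in> vector_fields M W"
  shows "cf (X + Y) p = cf X p + cf Y p"
  using vfield_tangent[OF assms(1)] vfield_tangent[OF assms(2)] by (simp add: cf_def coef_add)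

lemma cf_fscale: "X \<in> vector_fields M W \<Longrightarrow> cf (fscale f X) p = f p *\<^sub>R cf X p"
  using vfield_tangent[of X W p] by (simp add: cf_def coef_scaleR fscale_def)

text \<open>The flat connection for which the frame is parallel, at one point.\<close>

definition deriv_along :: "'a tvec \<Rightarrow> ('a \<Rightarrow> real^'n) \<Rightarrow> real^'n" where
  "deriv_along v a = (\<chi> k. v (\<lambda>q. a q $ k))"

lemma deriv_along_nth [simp]: "deriv_along v a $ k = v (\<lambda>q. a q $ k)"
  by (simp add: deriv_along_def)

lemma deriv_along_add_vec: "deriv_along (v + w) a = deriv_along v a + deriv_along w a"
  by (simp add: vec_eq_iff)

lemma deriv_along_scaleR_vec: "deriv_along (c *\<^sub>R v) a = c *\<^sub>R deriv_along v a"
  by (simp add: vec_eq_iff scaleR_fun_def)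

lemma deriv_along_local:
  assumes "v \<in> tangent_space M p" "open V" "p \<in> V" "\<And>q. q \<in> V \<Longrightarrow> a q = b q"
  shows "deriv_along v a = deriv_along v b"
  unfolding vec_eq_iff deriv_along_nth
  by (intro allI tangent_local[OF assms(1-3)]) (simp add: assms(4))

lemma deriv_along_add:
  assumes "v \<in> tangent_space M p" "vsmooth_near p a" "vsmooth_near p b"
  shows "deriv_along v (\<lambda>q. a q + b q) = deriv_along v a + deriv_along v b"
  using assms(2,3) by (simp add: vec_eq_iff vsmooth_near_def tangent_add[OF assms(1)])

lemma vsmooth_bilinear:
  assumes "bilinear G" "open W" "vsmooth W a" "vsmooth W b"
  shows "vsmooth W (\<lambda>q. G (a q) (b q))"
  using assms(3,4) unfolding vsmooth_def bilinear_expand[OF assms(1), of "a _"]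
  by (auto intro!: smooth_fun_sum smooth_fun_mult smooth_fun_const assms(2))

lemma vsmooth_add: "open W \<Longrightarrow> vsmooth W a \<Longrightarrow> vsmooth W b \<Longrightarrow> vsmooth W (\<lambda>q. a q + b q)"
  by (simp add: vsmooth_def smooth_fun_add)

lemma vsmooth_diff: "open W \<Longrightarrow> vsmooth W a \<Longrightarrow> vsmooth W b \<Longrightarrow> vsmooth W (\<lambda>q. a q - b q)"
  by (simp add: vsmooth_def smooth_fun_diff)

lemma vsmooth_deriv_along:
  assumes "X \<in> vector_fields M W" "open W" "vsmooth W a"
  shows "vsmooth W (\<lambda>q. deriv_along (X q) a)"
  using vfield_smooth[OF assms(1,2)] assms(3) by (simp add: vsmooth_def)

lemma deriv_along_bilinear:
  assumes v: "v \<in> tangent_space M p" and G: "bilinear G" and a: "vsmooth_near p a" and b: "vsmooth_near p b"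
  shows "deriv_along v (\<lambda>q. G (a q) (b q)) = G (deriv_along v a) (b p) + G (a p) (deriv_along v b)"
proof -
  have "v (\<lambda>q. G (a q) (b q) $ k) = (G (deriv_along v a) (b p) + G (a p) (deriv_along v b)) $ k" for k
  proof -
    have sm: "smooth_near M p (\<lambda>q. a q $ i)" "smooth_near M p (\<lambda>q. b q $ i)" for i
      using a b by (simp_all add: vsmooth_near_def)
    have "v (\<lambda>q. G (a q) (b q) $ k) =
        v (\<lambda>q. \<Sum>i\<in>UNIV. \<Sum>j\<in>UNIV. a q $ i * b q $ j * G (axis i 1) (axis j 1) $ k)"
      by (simp add: bilinear_expand[OF G, of "a _"])
    also have "\<dots> = (\<Sum>i\<in>UNIV. \<Sum>j\<in>UNIV.
        (a p $ i * v (\<lambda>q. b q $ j) + v (\<lambda>q. a q $ i) * b p $ j) * G (axis i 1) (axis j 1) $ k)"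
      by (simp add: tangent_function_sum[OF v] smooth_near_sum smooth_near_mult smooth_near_const sm
          tangent_mult[OF v] tangent_const[OF v])
    also have "\<dots> = (G (deriv_along v a) (b p) + G (a p) (deriv_along v b)) $ k"
      by (simp add: bilinear_expand[OF G, of "deriv_along v a"] bilinear_expand[OF G, of "a p"]
          sum.distrib[symmetric] algebra_simps)
    finally show ?thesis .
  qed
  then show ?thesis by (simp add: vec_eq_iff)
qed

text \<open>Expanding the inner field in the frame and applying the product rule gives a first-order
  part and terms with two frame derivatives. In the difference of the two orders the latter combine
  to brackets of frame fields, that is, to \<open>C\<close>.\<close>

lemma bracket_at:
  assumes X: "X \<in> vector_fields M W" and Y: "Y \<in> vector_fields M W" and W: "open W" "p \<in> W"
  shows "lie_bracket M X Y p =
    vec_at p (deriv_along (X p) (cf Y) - deriv_along (Y p) (cf X) + C (cf X p) (cf Y p))"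
    (is "_ = vec_at p ?c")
proof
  fix f
  show "lie_bracket M X Y p f = vec_at p ?c f"
  proof (cases "smooth_near M p f")
    case False
    then show ?thesis
      using tangent_not_smooth[OF vec_at_tangent] by (simp add: lie_bracket_def)
  next
    case f: True
    have XY: "X p (\<lambda>q. Y q f) = (\<Sum>j\<in>UNIV. deriv_along (X p) (cf Y) $ j * E j p f)
        + (\<Sum>i\<in>UNIV. \<Sum>j\<in>UNIV. cf X p $ i * cf Y p $ j * E i p (\<lambda>q. E j q f))"
      if X: "X \<in> vector_fields M W" and Y: "Y \<in> vector_fields M W" for X Y
    proof -
      have Xp: "X p \<in> tangent_space M p"
        using vfield_tangent[OF X] .
      have sm: "smooth_near M p (\<lambda>q. cf Y q $ j)" "smooth_near M p (\<lambda>q. E j q f)" for j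
        using vsmooth_near[OF W vsmooth_cf[OF Y W(1)]] vfield_smooth_near[OF frame_field _ _ f]
        by (simp_all add: vsmooth_near_def)
      have "X p (\<lambda>q. Y q f) = X p (\<lambda>q. \<Sum>j\<in>UNIV. cf Y q $ j * E j q f)"
        by (rule tangent_local[OF Xp W]) (simp add: vfield_at[OF Y] vec_at_apply[symmetric])
      also have "\<dots> = (\<Sum>j\<in>UNIV. cf Y p $ j * X p (\<lambda>q. E j q f) + X p (\<lambda>q. cf Y q $ j) * E j p f)"
        by (simp add: tangent_function_sum[OF Xp] smooth_near_mult sm tangent_mult[OF Xp])
      also have "\<dots> = (\<Sum>j\<in>UNIV. deriv_along (X p) (cf Y) $ j * E j p f)
        + (\<Sum>j\<in>UNIV. \<Sum>i\<in>UNIV. cf X p $ i * cf Y p $ j * E i p (\<lambda>q. E j q f))"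
        by (subst (1) vfield_at[OF X])
          (simp add: vec_at_apply sum.distrib sum_distrib_left sum_distrib_right mult_ac)
      finally show ?thesis
        by (subst sum.swap) 
    qed
    have br: "E i p (\<lambda>q. E j q f) - E j p (\<lambda>q. E i q f) = (\<Sum>k\<in>UNIV. C (axis i 1) (axis j 1) $ k * E k p f)" for i j
      using fun_cong[OF fun_cong[OF frame_bracket[of i j], of p], of f] f
      by (simp add: lie_bracket_def sum_function_apply scaleR_fun_def)
    have "lie_bracket M X Y p f = (\<Sum>j\<in>UNIV. deriv_along (X p) (cf Y) $ j * E j p f)
        - (\<Sum>j\<in>UNIV. deriv_along (Y p) (cf X) $ j * E j p f)
        + ((\<Sum>i\<in>UNIV. \<Sum>j\<in>UNIV. cf X p $ i * cf Y p $ j * E i p (\<lambda>q. E j q f))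
          - (\<Sum>j\<in>UNIV. \<Sum>i\<in>UNIV. cf Y p $ j * cf X p $ i * E j p (\<lambda>q. E i q f)))"
      using f XY[OF X Y] XY[OF Y X] by (simp add: lie_bracket_def)
    also have "(\<Sum>j\<in>UNIV. \<Sum>i\<in>UNIV. cf Y p $ j * cf X p $ i * E j p (\<lambda>q. E i q f)) =
        (\<Sum>i\<in>UNIV. \<Sum>j\<in>UNIV. cf X p $ i * cf Y p $ j * E j p (\<lambda>q. E i q f))"
      by (subst sum.swap) (simp add: mult_ac)
    also have "(\<Sum>i\<in>UNIV. \<Sum>j\<in>UNIV. cf X p $ i * cf Y p $ j * E i p (\<lambda>q. E j q f))
          - (\<Sum>i\<in>UNIV. \<Sum>j\<in>UNIV. cf X p $ i * cf Y p $ j * E j p (\<lambda>q. E i q f)) =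
        (\<Sum>i\<in>UNIV. \<Sum>j\<in>UNIV. cf X p $ i * cf Y p $ j * (\<Sum>k\<in>UNIV. C (axis i 1) (axis j 1) $ k * E k p f))"
      by (simp add: sum_subtractf[symmetric] right_diff_distrib[symmetric] br)
    also have "\<dots> = (\<Sum>k\<in>UNIV. C (cf X p) (cf Y p) $ k * E k p f)"
      unfolding bilinear_expand[OF bilinear_C, of "cf X p"]
      by (simp add: sum_distrib_left sum_distrib_right mult_ac)
        (rule sum_rotate)
    finally show ?thesis
      by (simp add: vec_at_apply algebra_simps sum.distrib sum_subtractf)
  qed
qed

lemma bracket_eq_comb:
  assumes X: "X \<in> vector_fields M W" and Y: "Y \<in> vector_fields M W" and W: "open W"
  shows "lie_bracket M X Y =
    comb W (\<lambda>p. deriv_along (X p) (cf Y) - deriv_along (Y p) (cf X) + C (cf X p) (cf Y p))"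
proof (rule vfield_eq_combI)
  show "lie_bracket M X Y p = 0" if "p \<notin> W" for p
    using vfield_outside[OF X that] vfield_outside[OF Y that] by (auto simp: lie_bracket_def)
qed (rule bracket_at[OF assms])

lemma bracket_field:
  assumes X: "X \<in> vector_fields M W" and Y: "Y \<in> vector_fields M W" and W: "open W"
  shows "lie_bracket M X Y \<in> vector_fields M W"
  unfolding bracket_eq_comb[OF assms]
  by (intro comb_field[OF W] vsmooth_add[OF W] vsmooth_diff[OF W] vsmooth_deriv_along[OF X W]
      vsmooth_deriv_along[OF Y W] vsmooth_bilinear[OF bilinear_C W] vsmooth_cf[OF X W] vsmooth_cf[OF Y W])

subsection \<open>Connections with constant coefficients\<close>

text \<open>\<open>G\<close> collects the Christoffel symbols: the connection is the flat one of the
  frame plus this tensor with constant coefficients.\<close>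

definition conn :: "'a set \<Rightarrow> (real^'n \<Rightarrow> real^'n \<Rightarrow> real^'n) \<Rightarrow> 'a conn" where
  "conn W G Y Z = comb W (\<lambda>p. deriv_along (Y p) (cf Z) + G (cf Y p) (cf Z p))"

lemma vsmooth_conn:
  assumes "open W" "bilinear G" "Y \<in> vector_fields M W" "Z \<in> vector_fields M W"
  shows "vsmooth W (\<lambda>p. deriv_along (Y p) (cf Z) + G (cf Y p) (cf Z p))"
  by (intro vsmooth_add vsmooth_deriv_along[OF assms(3)] vsmooth_bilinear[OF assms(2)]
      vsmooth_cf[OF assms(3)] vsmooth_cf[OF assms(4)] assms(1))

lemma conn_field:
  assumes "open W" "bilinear G" "Y \<in> vector_fields M W" "Z \<in> vector_fields M W"
  shows "conn W G Y Z \<in> vector_fields M W"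
  unfolding conn_def by (rule comb_field[OF assms(1) vsmooth_conn[OF assms]])

lemma cf_conn: "p \<in> W \<Longrightarrow> cf (conn W G Y Z) p = deriv_along (Y p) (cf Z) + G (cf Y p) (cf Z p)"
  by (simp add: conn_def)

lemma torsion_conn:
  assumes G: "open W" "bilinear G" and X: "X \<in> vector_fields M W" and Y: "Y \<in> vector_fields M W"
  shows "torsion M (conn W G) X Y =
    comb W (\<lambda>p. G (cf X p) (cf Y p) - G (cf Y p) (cf X p) - C (cf X p) (cf Y p))"
proof (rule vfield_eq_combI)
  fix p assume "p \<in> W"
  then show "torsion M (conn W G) X Y p =
      vec_at p (G (cf X p) (cf Y p) - G (cf Y p) (cf X p) - C (cf X p) (cf Y p))"
    using bracket_at[OF X Y G(1)]
    by (simp add: torsion_def conn_def comb_def vec_at_diff[symmetric])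
next
  fix p assume "p \<notin> W"
  then show "torsion M (conn W G) X Y p = 0"
    using vfield_outside[OF bracket_field[OF X Y G(1)]] by (simp add: torsion_def conn_def comb_def)
qed

text \<open>Second derivatives of the coefficients of \<open>Z\<close> cancel against the derivative
  along the bracket. First-order terms cancel among themselves or against the first-order part of
  the bracket coefficients. \<open>G\<close> is constant and contributes no derivative.\<close>

lemma curvature_conn:
  assumes G: "open W" "bilinear G" and X: "X \<in> vector_fields M W" and Y: "Y \<in> vector_fields M W"
    and Z: "Z \<in> vector_fields M W"
  shows "curvature M (conn W G) X Y Z =
    comb W (\<lambda>p. G (cf X p) (G (cf Y p) (cf Z p)) - G (cf Y p) (G (cf X p) (cf Z p))
      - G (C (cf X p) (cf Y p)) (cf Z p))"
proof (rule vfield_eq_combI)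
  fix p assume p: "p \<in> W"
  have D: "deriv_along (X p) (cf (conn W G Y Z)) = deriv_along (X p) (\<lambda>q. deriv_along (Y q) (cf Z))
      + G (deriv_along (X p) (cf Y)) (cf Z p) + G (cf Y p) (deriv_along (X p) (cf Z))"
    if X: "X \<in> vector_fields M W" and Y: "Y \<in> vector_fields M W" for X Y
  proof -
    have Xp: "X p \<in> tangent_space M p"
      using vfield_tangent[OF X] .
    have "deriv_along (X p) (cf (conn W G Y Z)) =
        deriv_along (X p) (\<lambda>q. deriv_along (Y q) (cf Z) + G (cf Y q) (cf Z q))"
      by (rule deriv_along_local[OF Xp G(1) p]) (simp add: cf_conn)
    also have "\<dots> = deriv_along (X p) (\<lambda>q. deriv_along (Y q) (cf Z)) +
        deriv_along (X p) (\<lambda>q. G (cf Y q) (cf Z q))"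
      by (intro deriv_along_add[OF Xp] vsmooth_near[OF G(1) p] vsmooth_deriv_along[OF Y]
          vsmooth_bilinear[OF G(2)] vsmooth_cf[OF Y] vsmooth_cf[OF Z] G(1))
    also have "deriv_along (X p) (\<lambda>q. G (cf Y q) (cf Z q)) =
        G (deriv_along (X p) (cf Y)) (cf Z p) + G (cf Y p) (deriv_along (X p) (cf Z))"
      by (intro deriv_along_bilinear[OF Xp G(2)] vsmooth_near[OF G(1) p] vsmooth_cf[OF Y G(1)] vsmooth_cf[OF Z G(1)])
    finally show ?thesis by simp
  qed
  let ?B = "deriv_along (X p) (cf Y) - deriv_along (Y p) (cf X) + C (cf X p) (cf Y p)"
  have "smooth_near M p (\<lambda>q. cf Z q $ k)" for k
    using vsmooth_near[OF G(1) p vsmooth_cf[OF Z G(1)]] by (simp add: vsmooth_near_def)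
  \<comment> \<open>On smooth coefficient functions the bracket acts as the commutator of
    derivations, by definition.\<close>
  then have B: "deriv_along (lie_bracket M X Y p) (cf Z) =
      deriv_along (X p) (\<lambda>q. deriv_along (Y q) (cf Z)) - deriv_along (Y p) (\<lambda>q. deriv_along (X q) (cf Z))"
    by (simp add: vec_eq_iff lie_bracket_def)
  have cB: "cf (lie_bracket M X Y) p = ?B"
    using bracket_at[OF X Y G(1) p] by (simp add: cf_def)
  show "curvature M (conn W G) X Y Z p =
      vec_at p (G (cf X p) (G (cf Y p) (cf Z p)) - G (cf Y p) (G (cf X p) (cf Z p))
      - G (C (cf X p) (cf Y p)) (cf Z p))"
    using p
    by (simp add: curvature_def conn_def[of W G X "conn W G Y Z"] conn_def[of W G Y "conn W G X Z"]
        conn_def[of W G "lie_bracket M X Y"] comb_def vec_at_diff[symmetric] D[OF X Y] D[OF Y X] B cB cf_conn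
        bilinear_radd[OF G(2)] bilinear_ladd[OF G(2)] bilinear_lsub[OF G(2)])
next
  fix p assume "p \<notin> W"
  then show "curvature M (conn W G) X Y Z p = 0"
    by (simp add: curvature_def conn_def comb_def)
qed

end

lemma linear_expand:
  fixes K :: "real^'n \<Rightarrow> 'v::real_vector"
  assumes "linear K"
  shows "K a = (\<Sum>j\<in>UNIV. a $ j *\<^sub>R K (axis j 1))"
proof -
  have "K a = K (\<Sum>i\<in>UNIV. a $ i *\<^sub>R axis i 1)"
    using basis_expansion[of a] by (simp add: scalar_mult_eq_scaleR)
  then show ?thesis
    by (simp add: linear_sum[OF assms] linear_cmul[OF assms])
qed

section \<open>Connections that agree on fields with one of constant coefficients\<close>

context frame
begin

definition curv :: "(real^'n \<Rightarrow> real^'n \<Rightarrow> real^'n) \<Rightarrow> real^'n \<Rightarrow> real^'n \<Rightarrow> real^'n \<Rightarrow> real^'n" where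
  "curv G x y z = G x (G y z) - G y (G x z) - G (C x y) z"

definition tors :: "(real^'n \<Rightarrow> real^'n \<Rightarrow> real^'n) \<Rightarrow> real^'n \<Rightarrow> real^'n \<Rightarrow> real^'n" where
  "tors G x y = G x y - G y x - C x y"

text \<open>Equality is demanded on fields over \<open>W\<close> only, since a connection chosen by
  \<open>SOME\<close> is unspecified on other arguments.\<close>

definition agrees :: "'a set \<Rightarrow> 'a conn \<Rightarrow> (real^'n \<Rightarrow> real^'n \<Rightarrow> real^'n) \<Rightarrow> bool" where
  "agrees W D G \<longleftrightarrow> bilinear G \<and>
     (\<forall>Y\<in>vector_fields M W. \<forall>Z\<in>vector_fields M W. D Y Z = conn W G Y Z)"

lemma agreesD:
  assumes "agrees W D G" "Y \<in> vector_fields M W" "Z \<in> vector_fields M W"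
  shows "D Y Z = conn W G Y Z"
  using assms by (simp add: agrees_def)

lemma agrees_bilinear: "agrees W D G \<Longrightarrow> bilinear G"
  by (simp add: agrees_def)

lemma comb_0: "comb W (\<lambda>_. 0) = 0"
  by (auto simp: comb_def vec_at_0)

lemma vsmooth_const: "open W \<Longrightarrow> vsmooth W (\<lambda>_. c)"
  by (simp add: vsmooth_def smooth_fun_const)

lemma comb_const_field: "open W \<Longrightarrow> comb W (\<lambda>_. c) \<in> vector_fields M W"
  by (rule comb_field[OF _ vsmooth_const])

lemma comb_const_at: "p \<in> W \<Longrightarrow> v \<in> tangent_space M p \<Longrightarrow> comb W (\<lambda>_. coef p v) p = v"
  by (simp add: comb_def)

lemma curvature_agrees:
  assumes "open W" "agrees W D G"
    and X: "X \<in> vector_fields M W" and Y: "Y \<in> vector_fields M W" and Z: "Z \<in> vector_fields M W"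
  shows "curvature M D X Y Z = comb W (\<lambda>p. curv G (cf X p) (cf Y p) (cf Z p))"
proof -
  note G = agrees_bilinear[OF assms(2)] and D = agreesD[OF assms(2)]
  have "curvature M D X Y Z = curvature M (conn W G) X Y Z"
    \<comment> \<open>Each rewriting needs both arguments to be fields, including the inner
      derivatives and the bracket.\<close>
    unfolding curvature_def D[OF Y Z] D[OF X Z] D[OF bracket_field[OF X Y assms(1)] Z]
      D[OF X conn_field[OF assms(1) G Y Z]] D[OF Y conn_field[OF assms(1) G X Z]] ..
  then show ?thesis
    by (simp add: curvature_conn[OF assms(1) G X Y Z] curv_def)
qed

lemma torsion_agrees:
  assumes "open W" "agrees W D G" and X: "X \<in> vector_fields M W" and Y: "Y \<in> vector_fields M W"
  shows "torsion M D X Y = comb W (\<lambda>p. tors G (cf X p) (cf Y p))"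
  using torsion_conn[OF assms(1) agrees_bilinear[OF assms(2)] X Y]
  by (simp add: torsion_def agreesD[OF assms(2) X Y] agreesD[OF assms(2) Y X] tors_def)

lemma flat_agrees:
  assumes "open W" "agrees W D G" "\<And>x y z. curv G x y z = 0"
  shows "flat_connection M W D"
  using curvature_agrees[OF assms(1,2)] by (simp add: flat_connection_def assms(3) comb_0)

lemma deriv_along_const: "v \<in> tangent_space M p \<Longrightarrow> deriv_along v (\<lambda>_. c) = 0"
  by (simp add: vec_eq_iff tangent_const)

text \<open>Parallelism is tested on fields with constant coefficients. There the derivatives
  vanish, and the connection and its torsion act as \<open>G\<close> and
  \<open>tors G\<close>.\<close>

lemma parallel_torsion_agrees:
  assumes "agrees UNIV D G" "parallel_torsion M UNIV D"
  shows "G x (tors G y z) = tors G (G x y) z + tors G y (G x z)"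
proof -
  \<comment> \<open>Types are inhabited, so there is a point at which the fields can be
    compared.\<close>
  obtain p :: 'a where True by simp
  define X where "X = comb UNIV (\<lambda>_. x)"
  define Y where "Y = comb UNIV (\<lambda>_. y)"
  define Z where "Z = comb UNIV (\<lambda>_. z)"
  note f = comb_const_field[OF open_UNIV]
  have cf: "cf (comb UNIV (\<lambda>_. c)) = (\<lambda>_. c)" for c
    by (rule ext) simp
  have cc: "D (comb UNIV (\<lambda>_. a)) (comb UNIV (\<lambda>_. b)) = comb UNIV (\<lambda>_. G a b)" for a b
    unfolding agreesD[OF assms(1) f f] conn_def cf
    by (simp add: deriv_along_const[OF vfield_tangent[OF f]])
  have tt: "torsion M D (comb UNIV (\<lambda>_. a)) (comb UNIV (\<lambda>_. b)) = comb UNIV (\<lambda>_. tors G a b)" for a b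
    unfolding torsion_agrees[OF open_UNIV assms(1) f f] cf ..
  have "D X (torsion M D Y Z) - torsion M D (D X Y) Z - torsion M D Y (D X Z) = 0"
    using assms(2) f unfolding parallel_torsion_def X_def Y_def Z_def by blast
  then have "comb UNIV (\<lambda>_. G x (tors G y z)) - comb UNIV (\<lambda>_. tors G (G x y) z)
      - comb UNIV (\<lambda>_. tors G y (G x z)) = 0"
    unfolding X_def Y_def Z_def tt cc .
  from fun_cong[OF this, of p] have "vec_at p (G x (tors G y z) - tors G (G x y) z - tors G y (G x z)) = 0"
    by (simp add: comb_def vec_at_diff)
  then show ?thesis
    by (simp add: vec_at_eq_0_iff algebra_simps)
qed

lemma deriv_along_scaleR:
  assumes v: "v \<in> tangent_space M p" and f: "smooth_near M p f" and a: "vsmooth_near p a"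
  shows "deriv_along v (\<lambda>q. f q *\<^sub>R a q) = f p *\<^sub>R deriv_along v a + v f *\<^sub>R a p"
  using a by (simp add: vec_eq_iff tangent_mult[OF v f] vsmooth_near_def)

lemma deriv_along_linear:
  assumes v: "v \<in> tangent_space M p" and K: "linear K" and a: "vsmooth_near p a"
  shows "deriv_along v (\<lambda>q. K (a q)) = K (deriv_along v a)"
proof -
  have sm: "smooth_near M p (\<lambda>q. a q $ i)" for i
    using a by (simp add: vsmooth_near_def)
  have "v (\<lambda>q. K (a q) $ k) = K (deriv_along v a) $ k" for k
    unfolding linear_expand[OF K, of "a _"] linear_expand[OF K, of "deriv_along v a"]
    by (simp add: tangent_function_sum[OF v] smooth_near_mult smooth_near_const sm
        tangent_mult[OF v] tangent_const[OF v])
  then show ?thesis by (simp add: vec_eq_iff)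
qed

lemma vsmooth_linear:
  assumes "open W" "linear K" "vsmooth W a"
  shows "vsmooth W (\<lambda>q. K (a q))"
  using assms(3) unfolding vsmooth_def linear_expand[OF assms(2), of "a _"]
  by (simp add: smooth_fun_sum smooth_fun_mult smooth_fun_const assms(1))

subsection \<open>Endomorphisms with constant coefficients\<close>

text \<open>One matrix describes the endomorphism in the frame at every point, as for left-invariant
  structures.\<close>

definition const_endo :: "'a endo \<Rightarrow> (real^'n \<Rightarrow> real^'n) \<Rightarrow> bool" where
  "const_endo J K \<longleftrightarrow> linear K \<and> (\<forall>p c. J p (vec_at p c) = vec_at p (K c))"

lemma endo_app_eq_comb:
  assumes "const_endo J K" "X \<in> vector_fields M W"
  shows "endo_app W J X = comb W (\<lambda>p. K (cf X p))"
proof (rule vfield_eq_combI)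
  show "endo_app W J X p = vec_at p (K (cf X p))" if "p \<in> W" for p
    using that assms(1) by (simp add: endo_app_def vfield_at[OF assms(2)] const_endo_def)
qed (simp add: endo_app_def)

lemma endo_app_field:
  assumes "const_endo J K" "open W" "X \<in> vector_fields M W"
  shows "endo_app W J X \<in> vector_fields M W"
proof -
  have "linear K"
    using assms(1) by (simp add: const_endo_def)
  then show ?thesis
    unfolding endo_app_eq_comb[OF assms(1,3)]
    by (intro comb_field[OF assms(2)] vsmooth_linear[OF assms(2) _ vsmooth_cf[OF assms(3,2)]])
qed

lemma const_endo_at:
  "const_endo J K \<Longrightarrow> v \<in> tangent_space M p \<Longrightarrow> J p v = vec_at p (K (coef p v))"
  by (metis const_endo_def vec_at_coef)

lemma const_endo_smooth:
  assumes J: "const_endo J K"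
  shows "smooth_endo M W J"
proof -
  have "linear K"
    using J by (simp add: const_endo_def)
  then show ?thesis
    by (simp add: smooth_endo_def endo_on_def endo_app_field[OF J] const_endo_at[OF J] coef_add coef_scaleR
        tangent_plus tangent_scaleR linear_add linear_cmul vec_at_add vec_at_scaleR)
qed

text \<open>A constant \<open>K\<close> commutes with the componentwise derivative, so only its
  commutator with \<open>G\<close> survives.\<close>

lemma endo_deriv_agrees:
  assumes W: "open W" and D: "agrees W D G" and J: "const_endo J K"
    and Y: "Y \<in> vector_fields M W" and Z: "Z \<in> vector_fields M W"
  shows "endo_deriv W D J Y Z = comb W (\<lambda>p. G (cf Y p) (K (cf Z p)) - K (G (cf Y p) (cf Z p)))"
proof (rule vfield_eq_combI)
  note JZ = endo_app_field[OF J W Z] and YZ = conn_field[OF W agrees_bilinear[OF D] Y Z]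
  have K: "linear K"
    using J by (simp add: const_endo_def)
  have eq: "endo_deriv W D J Y Z = conn W G Y (endo_app W J Z) - endo_app W J (conn W G Y Z)"
    by (simp add: endo_deriv_def agreesD[OF D Y JZ] agreesD[OF D Y Z])
  fix p
  {
    assume p: "p \<in> W"
    have "deriv_along (Y p) (cf (endo_app W J Z)) = deriv_along (Y p) (\<lambda>q. K (cf Z q))"
      by (rule deriv_along_local[OF vfield_tangent[OF Y] W p]) (simp add: endo_app_eq_comb[OF J Z])
    also have "\<dots> = K (deriv_along (Y p) (cf Z))"
      by (rule deriv_along_linear[OF vfield_tangent[OF Y] K vsmooth_near[OF W p vsmooth_cf[OF Z W]]])
    finally have 1: "deriv_along (Y p) (cf (endo_app W J Z)) = K (deriv_along (Y p) (cf Z))" .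
    have 2: "cf (endo_app W J Z) p = K (cf Z p)"
      using p by (simp add: endo_app_eq_comb[OF J Z])
    have "conn W G Y (endo_app W J Z) p =
        vec_at p (K (deriv_along (Y p) (cf Z)) + G (cf Y p) (K (cf Z p)))"
      using p by (simp add: conn_def comb_def 1 2)
    moreover have "endo_app W J (conn W G Y Z) p =
        vec_at p (K (deriv_along (Y p) (cf Z)) + K (G (cf Y p) (cf Z p)))"
      using p by (simp add: endo_app_eq_comb[OF J YZ]) (simp add: comb_def cf_conn linear_add[OF K])
    ultimately show "endo_deriv W D J Y Z p = vec_at p (G (cf Y p) (K (cf Z p)) - K (G (cf Y p) (cf Z p)))"
      by (simp add: eq vec_at_diff[symmetric])
  next
    assume "p \<notin> W"
    then show "endo_deriv W D J Y Z p = 0"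
      by (simp add: eq conn_def endo_app_def comb_def)
  }
qed

lemma parallel_endo_agrees:
  assumes "open W" "agrees W D G" "const_endo J K" "\<And>x y. G x (K y) = K (G x y)"
  shows "parallel_endo M W D J"
  using endo_deriv_agrees[OF assms(1-3)] by (simp add: parallel_endo_def assms(4) comb_0)

text \<open>The sum comes from \<open>endo_deriv_agrees\<close> with the field \<open>Z\<close>
  replaced by its image under the endomorphism, which explains the repeated
  \<open>K \<alpha>\<close>.\<close>

lemma agrees_HG_connection:
  assumes W: "open W" and D: "agrees W (levi_civita M W h) G"
    and H: "\<And>\<alpha>. \<alpha> \<in> {1..3} \<Longrightarrow> const_endo (H \<alpha>) (K \<alpha>)"
  shows "agrees W (HG_connection M W H h)
    (\<lambda>y z. G y z + (1/4) *\<^sub>R (\<Sum>\<alpha>=1..3. G y (K \<alpha> (K \<alpha> z)) - K \<alpha> (G y (K \<alpha> z))))"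
    (is "agrees _ _ ?G")
  unfolding agrees_def
proof (intro conjI ballI)
  note G = agrees_bilinear[OF D]
  have K: "linear (K \<alpha>)" if "\<alpha> \<in> {1..3}" for \<alpha>
    using H[OF that] by (simp add: const_endo_def)
  show "bilinear ?G"
    unfolding bilinear_def
    by (intro conjI allI linearI)
      (simp_all add: bilinear_radd[OF G] bilinear_ladd[OF G] bilinear_rmul[OF G] bilinear_lmul[OF G]
        linear_add[OF K] linear_cmul[OF K] sum.distrib sum_subtractf scaleR_sum_right algebra_simps)
  fix Y Z assume Y: "Y \<in> vector_fields M W" and Z: "Z \<in> vector_fields M W"
  have e: "endo_deriv W (levi_civita M W h) (H \<alpha>) Y (endo_app W (H \<alpha>) Z) =
      comb W (\<lambda>p. G (cf Y p) (K \<alpha> (K \<alpha> (cf Z p))) - K \<alpha> (G (cf Y p) (K \<alpha> (cf Z p))))"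
    if \<alpha>: "\<alpha> \<in> {1..3}" for \<alpha>
    unfolding endo_deriv_agrees[OF W D H[OF \<alpha>] Y endo_app_field[OF H[OF \<alpha>] W Z]]
    by (auto simp: comb_def endo_app_eq_comb[OF H[OF \<alpha>] Z] cf_def)
  show "HG_connection M W H h Y Z = conn W ?G Y Z"
  proof
    fix p
    show "HG_connection M W H h Y Z p = conn W ?G Y Z p"
      by (cases "p \<in> W")
        (simp_all add: HG_connection_def agreesD[OF D Y Z] e conn_def comb_def scaleR_fun_def[where 'b = "'a tvec"]
          sum_function_apply[of _ _ p] vec_at_add vec_at_scaleR linear_sum[OF linear_vec_at])
  qed
qed

subsection \<open>The Levi-Civita connection\<close>

text \<open>The difference tensor is symmetric in its first two arguments and, lowered with the metric,
  antisymmetric in the last two, hence zero.\<close>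

lemma levi_civita_unique:
  assumes W: "open W" and h: "pseudo_metric M W h"
    and D: "is_levi_civita M W h D" and D': "is_levi_civita M W h D'"
    and X: "X \<in> vector_fields M W" and Y: "Y \<in> vector_fields M W"
  shows "D X Y = D' X Y"
proof
  fix p
  note lin = is_levi_civita_def linear_connection_def
  have DV: "D X Y \<in> vector_fields M W" "D' X Y \<in> vector_fields M W"
    if "X \<in> vector_fields M W" "Y \<in> vector_fields M W" for X Y
    using that D D' unfolding lin by auto
  show "D X Y p = D' X Y p"
  proof (cases "p \<in> W")
    case False
    then show ?thesis
      using vfield_outside[OF DV(1)[OF X Y]] vfield_outside[OF DV(2)[OF X Y]] by simp
  next
    case p: True
    have hs: "h p v w = h p w v" and ha: "h p (u + v) w = h p u w + h p v w"
      and hc: "h p (c *\<^sub>R v) w = c * h p v w"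
      if "u \<in> tangent_space M p" "v \<in> tangent_space M p" "w \<in> tangent_space M p" for u v w c
    proof -
      have "\<forall>p\<in>W. \<forall>v\<in>tangent_space M p. \<forall>w\<in>tangent_space M p. h p v w = h p w v \<and>
          (\<forall>c. h p (c *\<^sub>R v) w = c * h p v w) \<and>
          (\<forall>u\<in>tangent_space M p. h p (u + v) w = h p u w + h p v w)"
        using h by (simp add: pseudo_metric_def bilinear_sym_on_def)
      note bspec[OF bspec[OF bspec[OF this p] that(2)] that(3)]
      then show "h p v w = h p w v" "h p (u + v) w = h p u w + h p v w" "h p (c *\<^sub>R v) w = c * h p v w"
        using that(1) by blast+
    qed
    have hd: "h p (u - v) w = h p u w - h p v w"
      if "u \<in> tangent_space M p" "v \<in> tangent_space M p" "w \<in> tangent_space M p" for u v w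
      using ha[of "u" "(- 1) *\<^sub>R v" w] hc[of v v w "- 1"] that tangent_scaleR[of v p "- 1"]
      by simp
    define S where "S = (\<lambda>X Y. D X Y p - D' X Y p)"
    have St: "S X Y \<in> tangent_space M p" if "X \<in> vector_fields M W" "Y \<in> vector_fields M W" for X Y
      unfolding S_def by (intro tangent_minus vfield_tangent[OF DV(1)[OF that]] vfield_tangent[OF DV(2)[OF that]])
    have tor: "D X Y - D Y X = lie_bracket M X Y" "D' X Y - D' Y X = lie_bracket M X Y"
      if "X \<in> vector_fields M W" "Y \<in> vector_fields M W" for X Y
    proof -
      have "torsion M D X Y = 0" "torsion M D' X Y = 0"
        using that D D' by (simp_all add: is_levi_civita_def)
      then show "D X Y - D Y X = lie_bracket M X Y" "D' X Y - D' Y X = lie_bracket M X Y"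
        by (simp_all add: torsion_def)
    qed
    have sym: "S X Y = S Y X" if "X \<in> vector_fields M W" "Y \<in> vector_fields M W" for X Y
    proof -
      have "(D X Y - D Y X) p = (D' X Y - D' Y X) p"
        unfolding tor[OF that] ..
      then show ?thesis
        by (simp add: S_def algebra_simps)
    qed
    have anti: "h p (S X Y) (Z p) = - h p (S X Z) (Y p)"
      if X: "X \<in> vector_fields M W" and Y: "Y \<in> vector_fields M W" and Z: "Z \<in> vector_fields M W" for X Y Z
    proof -
      have "h p (D X Y p) (Z p) + h p (Y p) (D X Z p) = h p (D' X Y p) (Z p) + h p (Y p) (D' X Z p)"
        using D D' X Y Z p by (simp add: is_levi_civita_def)
      then show ?thesis
        unfolding S_def
        using hd[OF vfield_tangent[OF DV(1)[OF X Y]] vfield_tangent[OF DV(2)[OF X Y]] vfield_tangent[OF Z]]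
          hd[OF vfield_tangent[OF DV(1)[OF X Z]] vfield_tangent[OF DV(2)[OF X Z]] vfield_tangent[OF Y]]
          hs[OF _ vfield_tangent[OF Y] vfield_tangent[OF DV(1)[OF X Z]]]
          hs[OF _ vfield_tangent[OF Y] vfield_tangent[OF DV(2)[OF X Z]]] tangent_0
        by fastforce
    qed
    have "h p (S X Y) w = 0" if w: "w \<in> tangent_space M p" for w
    proof -
      \<comment> \<open>The relations above hold for fields, so \<open>w\<close> is extended with
        constant coefficients. Antisymmetry and symmetry, used three times each, then lead back to
        the start with the opposite sign.\<close>
      define Z where "Z = comb W (\<lambda>_. coef p w)"
      have Z: "Z \<in> vector_fields M W" "Z p = w"
        using comb_const_field[OF W] comb_const_at[OF p w] by (simp_all add: Z_def)
      have "h p (S X Y) (Z p) = - h p (S X Y) (Z p)"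
        using anti[OF X Y Z(1)] anti[OF Z(1) X Y] anti[OF Y Z(1) X] sym[OF X Z(1)] sym[OF Z(1) Y] sym[OF Y X]
        by simp
      then show ?thesis by (simp add: Z(2))
    qed
    then have "S X Y = 0"
      using h p St[OF X Y] unfolding pseudo_metric_def by blast
    then show ?thesis by (simp add: S_def)
  qed
qed

end

section \<open>Levi-Civita connections of a metric with constant coefficients and of its conformal
  changes\<close>

locale metric_frame = frame M E C
  for M :: "('a::{t2_space,second_countable_topology}, real^'n) atlas"
    and E :: "'n \<Rightarrow> 'a vfield" and C :: "real^'n \<Rightarrow> real^'n \<Rightarrow> real^'n" +
  fixes g :: "'a bform" and B :: "real^'n \<Rightarrow> real^'n \<Rightarrow> real"
  assumes bilinear_B: "bilinear B" and B_sym: "B x y = B y x"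
    and B_nondegenerate: "(\<And>y. B x y = 0) \<Longrightarrow> x = 0"
    and g_vec_at: "g p (vec_at p x) (vec_at p y) = B x y"
begin

lemma g_at: "v \<in> tangent_space M p \<Longrightarrow> w \<in> tangent_space M p \<Longrightarrow> g p v w = B (coef p v) (coef p w)"
  by (metis g_vec_at vec_at_coef)

lemma smooth_fun_B:
  assumes "open W" "vsmooth W a" "vsmooth W b"
  shows "smooth_fun M W (\<lambda>q. B (a q) (b q))"
  using assms(2,3) unfolding vsmooth_def bilinear_expand[OF bilinear_B, of "a _"]
  by (simp add: smooth_fun_sum smooth_fun_mult smooth_fun_const assms(1))

lemma tangent_B:
  assumes v: "v \<in> tangent_space M p" and a: "vsmooth_near p a" and b: "vsmooth_near p b"
  shows "v (\<lambda>q. B (a q) (b q)) = B (deriv_along v a) (b p) + B (a p) (deriv_along v b)"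
proof -
  have sm: "smooth_near M p (\<lambda>q. a q $ i)" "smooth_near M p (\<lambda>q. b q $ i)" for i
    using a b by (simp_all add: vsmooth_near_def)
  show ?thesis
    unfolding bilinear_expand[OF bilinear_B, of "a _"] bilinear_expand[OF bilinear_B, of "deriv_along v a"]
    by (simp add: tangent_function_sum[OF v] smooth_near_sum smooth_near_mult smooth_near_const sm
        tangent_mult[OF v] tangent_const[OF v] sum.distrib[symmetric] algebra_simps)
qed

lemma pseudo_metric_conformal:
  assumes W: "open W" and u: "smooth_fun M W u"
  shows "pseudo_metric M W (conformal u g)"
  unfolding pseudo_metric_def
proof (intro conjI ballI allI impI)
  show "bilinear_sym_on M W (conformal u g)"
    unfolding bilinear_sym_on_def
    by (simp add: conformal_def g_at coef_add coef_scaleR tangent_plus tangent_scaleR B_sym[of "coef _ _" "coef _ _"]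
        bilinear_ladd[OF bilinear_B] bilinear_lmul[OF bilinear_B] algebra_simps)
  fix p v assume p: "p \<in> W" and v: "v \<in> tangent_space M p"
    and "\<forall>w\<in>tangent_space M p. conformal u g p v w = 0"
  then have "B (coef p v) y = 0" for y
    using g_at[OF v vec_at_tangent[of p y]] by (auto simp: conformal_def)
  then have "coef p v = 0"
    by (rule B_nondegenerate)
  then show "v = 0"
    using vec_at_coef[OF v] by (simp add: vec_at_0)
next
  fix V X Y assume *: "open V \<and> V \<subseteq> W \<and> X \<in> vector_fields M V \<and> Y \<in> vector_fields M V"
  then have V: "open V" "V \<subseteq> W" and X: "X \<in> vector_fields M V" and Y: "Y \<in> vector_fields M V"
    by auto
  have "smooth_fun M V (\<lambda>p. exp (2 * u p) * B (cf X p) (cf Y p))"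
    by (intro smooth_fun_mult smooth_fun_exp smooth_fun_const smooth_fun_subset[OF u] smooth_fun_B
        vsmooth_cf[OF X] vsmooth_cf[OF Y] V)
  then show "smooth_fun M V (\<lambda>p. conformal u g p (X p) (Y p))"
    using vfield_tangent[OF X] vfield_tangent[OF Y] by (simp add: conformal_def g_at cf_def)
qed

text \<open>The componentwise derivative supplies the Leibniz term, and \<open>G\<close> is
  tensorial in both arguments.\<close>

lemma linear_connection_conn:
  assumes W: "open W" and G: "bilinear G"
  shows "linear_connection M W (conn W G)"
  unfolding linear_connection_def
proof (intro ballI conjI allI impI)
  fix X Y assume X: "X \<in> vector_fields M W" and Y: "Y \<in> vector_fields M W"
  note cX = conn_field[OF W G X]
  show "conn W G X Y \<in> vector_fields M W"
    using cX[OF Y] .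
  fix Z assume Z: "Z \<in> vector_fields M W"
  show "conn W G (X + Y) Z = conn W G X Z + conn W G Y Z"
  proof (rule vfield_eqI)
    fix p assume "p \<in> W"
    then show "cf (conn W G (X + Y) Z) p = cf (conn W G X Z + conn W G Y Z) p"
      by (simp add: cf_add[OF cX[OF Z] conn_field[OF W G Y Z]] cf_conn cf_add[OF X Y] deriv_along_add_vec
          bilinear_ladd[OF G])
  qed (intro conn_field vfield_add X Y Z W G)+
  show "conn W G X (Y + Z) = conn W G X Y + conn W G X Z"
  proof (rule vfield_eqI)
    fix p assume p: "p \<in> W"
    have "cf (Y + Z) = (\<lambda>q. cf Y q + cf Z q)"
      by (rule ext) (rule cf_add[OF Y Z])
    then show "cf (conn W G X (Y + Z)) p = cf (conn W G X Y + conn W G X Z) p"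
      using p by (simp add: cf_add[OF cX[OF Y] cX[OF Z]] cf_conn
          deriv_along_add[OF vfield_tangent[OF X] vsmooth_near[OF W p vsmooth_cf[OF Y W]]
            vsmooth_near[OF W p vsmooth_cf[OF Z W]]] bilinear_radd[OF G])
  qed (intro conn_field vfield_add X Y Z W G)+
next
  fix X Y f assume X: "X \<in> vector_fields M W" and Y: "Y \<in> vector_fields M W" and f: "smooth_fun M W f"
  note cXY = conn_field[OF W G X Y]
  show "conn W G (fscale f X) Y = fscale f (conn W G X Y)"
  proof (rule vfield_eqI)
    fix p assume "p \<in> W"
    then show "cf (conn W G (fscale f X) Y) p = cf (fscale f (conn W G X Y)) p"
      by (simp add: cf_fscale[OF cXY] cf_conn cf_fscale[OF X] bilinear_lmul[OF G] scaleR_right_distrib)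
        (simp add: fscale_def deriv_along_scaleR_vec)
  qed (intro conn_field vfield_fscale X Y f W G)+
  have Xf: "smooth_fun M W (\<lambda>p. X p f)"
    using vfield_smooth[OF X W _ f] by simp
  show "conn W G X (fscale f Y) = fscale f (conn W G X Y) + fscale (\<lambda>p. X p f) Y"
  proof (rule vfield_eqI)
    fix p assume p: "p \<in> W"
    have "cf (fscale f Y) = (\<lambda>q. f q *\<^sub>R cf Y q)"
      by (rule ext) (rule cf_fscale[OF Y])
    then show "cf (conn W G X (fscale f Y)) p = cf (fscale f (conn W G X Y) + fscale (\<lambda>p. X p f) Y) p"
      using p by (simp add: cf_add[OF vfield_fscale[OF cXY f] vfield_fscale[OF Y Xf]] cf_fscale[OF cXY]
          cf_fscale[OF Y] cf_conn bilinear_rmul[OF G] scaleR_right_distrib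
          deriv_along_scaleR[OF vfield_tangent[OF X] smooth_nearI[OF W p f] vsmooth_near[OF W p vsmooth_cf[OF Y W]]])
  qed (intro conn_field vfield_fscale vfield_add X Y f W G Xf)+
qed

text \<open>The right side of \<open>G_metric\<close> accounts for the factor e^{2u}, whose
  logarithmic derivative along \<open>x\<close> is 2 du(x). The differential of \<open>u\<close> has
  the constant coefficients \<open>c\<close>; taking u = 0 and c = 0 gives the metric
  \<open>g\<close> itself.\<close>

lemma is_levi_civita_conn:
  assumes W: "open W" and u: "smooth_fun M W u"
    and du: "\<And>p v. p \<in> W \<Longrightarrow> v \<in> tangent_space M p \<Longrightarrow> v u = c \<bullet> coef p v"
    and G: "bilinear G" and G_torsion: "\<And>x y. G x y - G y x = C x y"
    and G_metric: "\<And>x y z. B (G x y) z + B y (G x z) = 2 * (c \<bullet> x) * B y z"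
  shows "is_levi_civita M W (conformal u g) (conn W G)"
  unfolding is_levi_civita_def
proof (intro conjI ballI)
  show "linear_connection M W (conn W G)"
    by (rule linear_connection_conn[OF W G])
  fix X Y assume X: "X \<in> vector_fields M W" and Y: "Y \<in> vector_fields M W"
  show "torsion M (conn W G) X Y = 0"
    by (simp add: torsion_conn[OF W G X Y] G_torsion comb_0)
  fix Z p assume Z: "Z \<in> vector_fields M W" and p: "p \<in> W"
  note Xp = vfield_tangent[OF X, of p]
  have su: "smooth_near M p (\<lambda>q. 2 * u q)" "smooth_near M p u"
    using smooth_nearI[OF W p] u smooth_fun_cmult[OF W u] by auto
  have sY: "vsmooth_near p (cf Y)" and sZ: "vsmooth_near p (cf Z)"
    by (rule vsmooth_near[OF W p vsmooth_cf[OF Y W]], rule vsmooth_near[OF W p vsmooth_cf[OF Z W]])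
  have sB: "smooth_near M p (\<lambda>q. B (cf Y q) (cf Z q))"
    by (rule smooth_nearI[OF W p smooth_fun_B[OF W vsmooth_cf[OF Y W] vsmooth_cf[OF Z W]]])
  have dX: "X p u = c \<bullet> cf X p"
    using du[OF p Xp] by (simp add: cf_def)
  have "X p (\<lambda>q. conformal u g q (Y q) (Z q)) = X p (\<lambda>q. exp (2 * u q) * B (cf Y q) (cf Z q))"
    using vfield_tangent[OF Y] vfield_tangent[OF Z] by (simp add: conformal_def g_at cf_def)
  also have "\<dots> = exp (2 * u p) * (B (deriv_along (X p) (cf Y)) (cf Z p) + B (cf Y p) (deriv_along (X p) (cf Z))
      + 2 * (c \<bullet> cf X p) * B (cf Y p) (cf Z p))"
    by (simp add: tangent_mult[OF Xp smooth_near_exp[OF su(1)] sB] tangent_exp[OF Xp su(1)]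
        tangent_cmult[OF Xp su(2)] tangent_B[OF Xp sY sZ] dX)
      (simp add: algebra_simps)
  also have "\<dots> = exp (2 * u p) * (B (deriv_along (X p) (cf Y) + G (cf X p) (cf Y p)) (cf Z p)
      + B (cf Y p) (deriv_along (X p) (cf Z) + G (cf X p) (cf Z p)))"
    by (simp add: G_metric[symmetric] bilinear_ladd[OF bilinear_B] bilinear_radd[OF bilinear_B])
  also have "\<dots> = conformal u g p (conn W G X Y p) (Z p) + conformal u g p (Y p) (conn W G X Z p)"
    using p by (simp add: conformal_def vfield_at[OF Y] vfield_at[OF Z] conn_def comb_def g_vec_at algebra_simps)
  finally show "X p (\<lambda>q. conformal u g q (Y q) (Z q)) =
      conformal u g p (conn W G X Y p) (Z p) + conformal u g p (Y p) (conn W G X Z p)" .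
qed

text \<open>The explicit connection shows that the \<open>SOME\<close> in \<open>levi_civita\<close>
  has a witness; uniqueness then identifies the choice with it on fields.\<close>

lemma agrees_levi_civita:
  assumes W: "open W" and u: "smooth_fun M W u"
    and du: "\<And>p v. p \<in> W \<Longrightarrow> v \<in> tangent_space M p \<Longrightarrow> v u = c \<bullet> coef p v"
    and G: "bilinear G" and G_torsion: "\<And>x y. G x y - G y x = C x y"
    and G_metric: "\<And>x y z. B (G x y) z + B y (G x z) = 2 * (c \<bullet> x) * B y z"
  shows "agrees W (levi_civita M W (conformal u g)) G"
proof -
  have lc: "is_levi_civita M W (conformal u g) (conn W G)"
    by (rule is_levi_civita_conn[OF assms])
  have "is_levi_civita M W (conformal u g) (levi_civita M W (conformal u g))"
    unfolding levi_civita_def by (rule someI[of "is_levi_civita M W (conformal u g)", OF lc])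
  from levi_civita_unique[OF W pseudo_metric_conformal[OF W u] this lc] show ?thesis
    using G by (simp add: agrees_def)
qed

text \<open>Extensions by constant coefficients exist, so \<open>extend\<close> returns a field with
  the right value at \<open>p\<close>. The curvature formula sees only the coefficients at
  \<open>p\<close>, so the particular extension is immaterial.\<close>

lemma riemann_agrees:
  assumes G: "agrees UNIV (levi_civita M UNIV g) G"
    and "x \<in> tangent_space M p" "y \<in> tangent_space M p" "z \<in> tangent_space M p" "w \<in> tangent_space M p"
  shows "riemann M UNIV g p x y z w = B (curv G (coef p x) (coef p y) (coef p z)) (coef p w)"
proof -
  have ext: "extend M UNIV p v \<in> vector_fields M UNIV \<and> extend M UNIV p v p = v"
    if "v \<in> tangent_space M p" for v
    unfolding extend_def
    by (rule someI[of _ "comb UNIV (\<lambda>_. coef p v)"])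
      (use comb_const_at[OF _ that] comb_const_field in auto)
  then have cf: "cf (extend M UNIV p v) p = coef p v" if "v \<in> tangent_space M p" for v
    using that by (simp add: cf_def)
  show ?thesis
    unfolding riemann_def
    using curvature_agrees[OF open_UNIV G, of "extend M UNIV p x" "extend M UNIV p y" "extend M UNIV p z"]
      ext assms(2-5) cf by (simp add: comb_def g_at)
qed

end

section \<open>The Poincare lemma on a ball\<close>

text \<open>The potential is h(x), the integral over t in [0,1] of F(z + t(x - z)) . (x - z). It is
  differentiated under the integral sign. Symmetry of \<open>F'\<close> turns the derivative of the
  integrand into the inner product with d/dt of t F(z + t(x - z)), which integrates to F(x).\<close>

lemma poincare_ball:
  fixes F :: "'e::euclidean_space \<Rightarrow> 'e"
  assumes F: "\<And>x. x \<in> ball z r \<Longrightarrow> (F has_derivative F' x) (at x)"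
    and cont: "\<And>v. continuous_on (ball z r) (\<lambda>x. F' x v)"
    and sym: "\<And>x v w. x \<in> ball z r \<Longrightarrow> F' x v \<bullet> w = F' x w \<bullet> v"
  obtains h where "\<And>x. x \<in> ball z r \<Longrightarrow> (h has_derivative (\<lambda>v. F x \<bullet> v)) (at x)"
proof -
  define c where "c = (\<lambda>x t. z + t *\<^sub>R (x - z))"
  have c_in: "c x t \<in> ball z r" if "x \<in> ball z r" "t \<in> cbox 0 1" for x and t :: real
  proof -
    have "t * norm (x - z) \<le> 1 * norm (x - z)"
      using that(2) by (intro mult_right_mono) auto
    then show ?thesis
      using that by (simp add: c_def dist_norm norm_minus_commute)
  qed
  have lin: "linear (F' x)" if "x \<in> ball z r" for x
    using F[OF that] by (rule has_derivative_linear)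
  define f where "f = (\<lambda>x t. F (c x t) \<bullet> (x - z))"
  \<comment> \<open>\<open>G x t\<close> is the derivative of t F(c x t) in t, and also the gradient
    of \<open>f x t\<close> in x.\<close>
  define G where "G = (\<lambda>x t. t *\<^sub>R F' (c x t) (x - z) + F (c x t))"
  have F_cont: "continuous_on (ball z r) F"
    using F by (meson continuous_at_imp_continuous_on has_derivative_continuous)
  have c_cont: "continuous_on (ball z r \<times> cbox 0 1) (\<lambda>(x, t). c x t)"
    unfolding c_def split_beta by (intro continuous_intros)
  have c_img: "(\<lambda>(x, t). c x t) ` (ball z r \<times> cbox 0 1) \<subseteq> ball z r"
    using c_in by auto
  \<comment> \<open>Continuity of \<open>F'\<close> is given for fixed directions only, so the
    varying direction x - z is expanded in a basis.\<close>
  have G_eq: "G x t = t *\<^sub>R (\<Sum>b\<in>Basis. ((x - z) \<bullet> b) *\<^sub>R F' (c x t) b) + F (c x t)"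
    if "x \<in> ball z r" "t \<in> cbox 0 1" for x t
  proof -
    have "F' (c x t) (x - z) = F' (c x t) (\<Sum>b\<in>Basis. ((x - z) \<bullet> b) *\<^sub>R b)"
      by (simp add: euclidean_representation)
    then show ?thesis
      using lin[OF c_in[OF that]] by (simp add: G_def linear_sum linear_cmul)
  qed
  have G_cont: "continuous_on (ball z r \<times> cbox 0 1) (\<lambda>(x, t). G x t)"
  proof -
    have 1: "continuous_on (ball z r \<times> cbox 0 1) (\<lambda>q. F' (c (fst q) (snd q)) b)" for b
      using continuous_on_compose2[OF cont c_cont c_img, of b] by (simp add: split_beta)
    have 2: "continuous_on (ball z r \<times> cbox 0 1) (\<lambda>q. F (c (fst q) (snd q)))"
      using continuous_on_compose2[OF F_cont c_cont c_img] by (simp add: split_beta)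
    have "continuous_on (ball z r \<times> cbox 0 1) (\<lambda>q. snd q *\<^sub>R (\<Sum>b\<in>Basis. ((fst q - z) \<bullet> b) *\<^sub>R
        F' (c (fst q) (snd q)) b) + F (c (fst q) (snd q)))"
      by (intro continuous_intros 1 2)
    then show ?thesis
      by (rule continuous_on_cong[THEN iffD1, rotated 2]) (auto simp: G_eq)
  qed
  have slice: "continuous_on (cbox 0 1) (\<lambda>t. H x t)"
    if "continuous_on (ball z r \<times> cbox 0 1) (\<lambda>(x, t). H x t)" "x \<in> ball z r"
    for H :: "'e \<Rightarrow> real \<Rightarrow> 'f::real_normed_vector" and x
  proof -
    have "continuous_on (cbox 0 1) (\<lambda>t. (x, t))"
      by (intro continuous_intros)
    moreover have "Pair x ` cbox 0 1 \<subseteq> ball z r \<times> cbox 0 1"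
      using that(2) by blast
    ultimately show ?thesis
      using continuous_on_compose2[OF that(1)] by fastforce
  qed
  have f_deriv: "((\<lambda>x. f x t) has_derivative blinfun_apply (blinfun_inner_right (G x t))) (at x within ball z r)"
    if x: "x \<in> ball z r" and t: "t \<in> cbox 0 1" for x t
  proof -
    have "((\<lambda>x. c x t) has_derivative (\<lambda>v. t *\<^sub>R v)) (at x)"
      unfolding c_def by (auto intro!: derivative_eq_intros)
    then have "((\<lambda>x. F (c x t)) has_derivative (\<lambda>v. F' (c x t) (t *\<^sub>R v))) (at x)"
      by (rule has_derivative_compose) (rule F[OF c_in[OF x t]])
    then have "((\<lambda>x. f x t) has_derivative (\<lambda>v. F (c x t) \<bullet> v + F' (c x t) (t *\<^sub>R v) \<bullet> (x - z))) (at x)"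
      unfolding f_def by (auto intro!: derivative_eq_intros)
    moreover have "F (c x t) \<bullet> v + F' (c x t) (t *\<^sub>R v) \<bullet> (x - z) = G x t \<bullet> v" for v
      using lin[OF c_in[OF x t]] sym[OF c_in[OF x t], of v "x - z"]
      by (simp add: G_def linear_cmul inner_add_left)
    ultimately show ?thesis
      by (simp add: has_derivative_at_withinI)
  qed
  have f_int: "f x integrable_on cbox 0 1" if "x \<in> ball z r" for x
  proof (rule integrable_continuous)
    have "continuous_on (cbox 0 1) (\<lambda>t. F (c x t))"
      using continuous_on_compose2[OF F_cont slice[OF c_cont that]] c_in[OF that] by blast
    then show "continuous_on (cbox 0 1) (f x)"
      unfolding f_def by (intro continuous_intros)
  qed
  have G_int: "(G x has_integral F x) (cbox 0 1)" if x: "x \<in> ball z r" for x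
  proof -
    have "((\<lambda>t. t *\<^sub>R F (c x t)) has_vector_derivative G x t) (at t within {0..1})" if "t \<in> {0..1}" for t
    proof -
      have "((\<lambda>t. c x t) has_derivative (\<lambda>s. s *\<^sub>R (x - z))) (at t within {0..1})"
        unfolding c_def by (auto intro!: derivative_eq_intros)
      moreover have "(F has_derivative F' (c x t)) (at (c x t))"
        using F c_in[OF x] that by simp
      ultimately have "((\<lambda>t. F (c x t)) has_derivative (\<lambda>s. F' (c x t) (s *\<^sub>R (x - z)))) (at t within {0..1})"
        by (rule has_derivative_compose)
      then have "((\<lambda>t. t *\<^sub>R F (c x t)) has_derivative
          (\<lambda>s. t *\<^sub>R F' (c x t) (s *\<^sub>R (x - z)) + s *\<^sub>R F (c x t))) (at t within {0..1})"
        by (auto intro!: derivative_eq_intros)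
      moreover have "linear (F' (c x t))"
        using lin c_in[OF x] that by simp
      ultimately show ?thesis
        by (simp add: has_vector_derivative_def G_def linear_cmul scaleR_add_right mult.commute add.commute)
    qed
    then have "(G x has_integral 1 *\<^sub>R F (c x 1) - 0 *\<^sub>R F (c x 0)) {0..1}"
      by (intro fundamental_theorem_of_calculus) auto
    then show ?thesis by (simp add: c_def)
  qed
  have "((\<lambda>x. integral (cbox 0 1) (f x)) has_derivative (\<lambda>v. F x \<bullet> v)) (at x)" if x: "x \<in> ball z r" for x
  proof -
    have "continuous_on (ball z r \<times> cbox 0 1) (\<lambda>(x, t). blinfun_inner_right (G x t))"
      using bounded_linear.continuous_on[OF bounded_linear_blinfun_inner_right G_cont]
      by (simp add: split_beta)
    then have "((\<lambda>x. integral (cbox 0 1) (f x)) has_derivative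
        integral (cbox 0 1) (\<lambda>t. blinfun_inner_right (G x t))) (at x within ball z r)"
      by (intro leibniz_rule f_deriv f_int x convex_ball)
    moreover have "integral (cbox 0 1) (\<lambda>t. blinfun_inner_right (G x t)) = blinfun_inner_right (F x)"
      using has_integral_linear[OF G_int[OF x] bounded_linear_blinfun_inner_right] by (simp add: o_def integral_unique)
    ultimately show ?thesis
      using at_within_open[OF x open_ball] by simp
  qed
  then show thesis by (rule that)
qed

section \<open>Coordinate fields and local potentials of closed forms\<close>

context smooth_mfd
begin

text \<open>The partial derivative in the coordinate \<open>m\<close>, with the default 0 that the
  conventions for tangent vectors and for fields on \<open>U\<close> require.\<close>

definition coord_field :: "'a set \<Rightarrow> ('a \<Rightarrow> real^'n) \<Rightarrow> 'n \<Rightarrow> 'a vfield" where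
  "coord_field U \<phi> m = (\<lambda>p f. if p \<in> U \<and> smooth_near M p f
     then frechet_derivative (\<lambda>y. f (inv_into U \<phi> y)) (at (\<phi> p)) (axis m 1) else 0)"

lemma coord_field_field:
  assumes c: "(U, \<phi>) \<in> M"
  shows "coord_field U \<phi> m \<in> vector_fields M U"
proof (rule vfieldI)
  show "coord_field U \<phi> m p \<in> tangent_space M p" if "p \<in> U" for p
    using that by (intro tangentI[OF c that]) (simp_all add: coord_field_def)
  show "coord_field U \<phi> m p = 0" if "p \<notin> U" for p
    using that by (simp add: coord_field_def fun_eq_iff)
  fix V f assume V: "open V" "V \<subseteq> U" "smooth_fun M V f"
  have im: "\<phi> ` (U \<inter> V) = \<phi> ` V"
    using V(2) by (simp add: Int_absorb1)
  have "Ck_on (Suc k) (\<phi> ` V) (\<lambda>y. f (inv_into U \<phi> y))" for k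
    using smooth_funD[OF V(3) c] unfolding im smooth_on_def by blast
  \<comment> \<open>A derivative in a fixed direction is C^k because the function is C^(k+1), for
    every k.\<close>
  then have "smooth_on (\<phi> ` V) (\<lambda>y. frechet_derivative (\<lambda>y. f (inv_into U \<phi> y)) (at y) (axis m 1))"
    by (simp add: smooth_on_def)
  from smooth_fun_chart[OF c V(2,1) this]
  show "smooth_fun M V (\<lambda>p. coord_field U \<phi> m p f)"
    by (rule smooth_fun_cong[OF V(1), rotated])
      (use V smooth_nearI[OF V(1) _ V(3)] in \<open>auto simp: coord_field_def\<close>)
qed

lemma coord_field_coord:
  assumes c: "(U, \<phi>) \<in> M" and p: "p \<in> U"
  shows "coord_field U \<phi> m p (\<lambda>q. \<phi> q $ j) = axis m 1 $ j"
proof -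
  have "((\<lambda>y. \<phi> (inv_into U \<phi> y) $ j) has_derivative (\<lambda>v. v $ j)) (at (\<phi> p))"
    by (rule has_derivative_transform_within_open[OF
          bounded_linear.has_derivative[OF bounded_linear_vec_nth has_derivative_ident]
          chart_open_image_domain[OF c]])
      (use p in \<open>auto simp: f_inv_into_f\<close>)
  then have "frechet_derivative (\<lambda>y. \<phi> (inv_into U \<phi> y) $ j) (at (\<phi> p)) = (\<lambda>v. v $ j)"
    using frechet_derivative_at by metis
  then show ?thesis
    using p smooth_nearI[OF chart_open[OF c] p smooth_fun_coord[OF c]] by (simp add: coord_field_def)
qed

lemma tangent_eq_coord_fields:
  assumes c: "(U, \<phi>) \<in> M" and p: "p \<in> U" and v: "v \<in> tangent_space M p"
  shows "v = (\<Sum>m\<in>UNIV. coords \<phi> v $ m *\<^sub>R coord_field U \<phi> m p)"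
proof (rule tangent_eqI[OF v _ c p])
  show "(\<Sum>m\<in>UNIV. coords \<phi> v $ m *\<^sub>R coord_field U \<phi> m p) \<in> tangent_space M p"
    by (intro tangent_sum tangent_scaleR vfield_tangent[OF coord_field_field[OF c]])
  have "(\<Sum>m\<in>UNIV. coords \<phi> v $ m *\<^sub>R coord_field U \<phi> m p) (\<lambda>q. \<phi> q $ j) = coords \<phi> v $ j" for j
    by (simp add: sum_function_apply scaleR_fun_def coord_field_coord[OF c p] axis_def if_distrib cong: if_cong)
  then show "coords \<phi> v = coords \<phi> (\<Sum>m\<in>UNIV. coords \<phi> v $ m *\<^sub>R coord_field U \<phi> m p)"
    by (simp add: vec_eq_iff)
qed

end

context frame
begin

text \<open>A tangent vector is determined by its values on the coordinate functions. Coordinate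
  fields take these to locally constant functions, which a second field annihilates.\<close>

lemma bracket_coord_fields:
  assumes c: "(U, \<phi>) \<in> M"
  shows "lie_bracket M (coord_field U \<phi> m) (coord_field U \<phi> n) p = 0"
proof (cases "p \<in> U")
  case False
  then show ?thesis
    using vfield_outside[OF bracket_field[OF coord_field_field[OF c] coord_field_field[OF c] chart_open[OF c]]]
    by simp
next
  case p: True
  note cf = coord_field_field[OF c]
  have "lie_bracket M (coord_field U \<phi> m) (coord_field U \<phi> n) p (\<lambda>q. \<phi> q $ j) = 0" for j
  proof -
    have "coord_field U \<phi> m p (\<lambda>q. coord_field U \<phi> n q (\<lambda>q. \<phi> q $ j)) = 0" for m n
    proof -
      have "coord_field U \<phi> m p (\<lambda>q. coord_field U \<phi> n q (\<lambda>q. \<phi> q $ j)) = coord_field U \<phi> m p (\<lambda>_. axis n 1 $ j)"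
        by (rule tangent_local[OF vfield_tangent[OF cf] chart_open[OF c] p]) (rule coord_field_coord[OF c])
      then show ?thesis
        by (simp add: tangent_const[OF vfield_tangent[OF cf]])
    qed
    then show ?thesis
      by (simp add: lie_bracket_def)
  qed
  then have "coords \<phi> (lie_bracket M (coord_field U \<phi> m) (coord_field U \<phi> n) p) = coords \<phi> 0"
    by (simp add: vec_eq_iff)
  then show ?thesis
    by (rule tangent_eqI[OF vfield_tangent[OF bracket_field[OF cf cf chart_open[OF c]]] tangent_0 c p])
qed

text \<open>The form with constant frame coefficients \<open>a\<close> is closed once it kills
  \<open>C\<close>. In a chart its components are the functions \<open>\<theta> m\<close>, and
  commuting coordinate fields make their partial derivatives symmetric, as the Poincare lemma
  demands.\<close>

lemma local_potential:
  assumes closed: "\<And>x y. a \<bullet> C x y = 0"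
  obtains W u where "open W" "p \<in> W" "smooth_fun M W u"
    "\<And>q v. q \<in> W \<Longrightarrow> v \<in> tangent_space M q \<Longrightarrow> v u = a \<bullet> coef q v"
proof -
  obtain U \<phi> where c: "(U, \<phi>) \<in> M" "p \<in> U"
    using chart_at .
  note U = chart_open[OF c(1)]
  let ?d = "coord_field U \<phi>"
  note d = coord_field_field[OF c(1)]
  define \<theta> where "\<theta> = (\<lambda>m q. a \<bullet> cf (?d m) q)"
  have a_expand: "a \<bullet> w = (\<Sum>k\<in>UNIV. a $ k * w $ k)" for w
    by (simp add: inner_vec_def)
  have \<theta>_smooth: "smooth_fun M U (\<theta> m)" for m
    using vsmooth_cf[OF d U] unfolding \<theta>_def a_expand vsmooth_def
    by (intro smooth_fun_sum smooth_fun_cmult U) blast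
  have d\<theta>: "?d m q (\<theta> n) = ?d n q (\<theta> m)" if q: "q \<in> U" for m n q
  proof -
    have "?d m q (\<theta> n) = a \<bullet> deriv_along (?d m q) (cf (?d n))" for m n
    proof -
      have "smooth_near M q (\<lambda>q. cf (?d n) q $ k)" for k
        using vsmooth_near[OF U q vsmooth_cf[OF d U]] by (simp add: vsmooth_near_def)
      then show ?thesis
        unfolding \<theta>_def a_expand
        by (simp add: tangent_function_sum[OF vfield_tangent[OF d]] tangent_cmult[OF vfield_tangent[OF d]]
            smooth_near_mult smooth_near_const)
    qed
    \<comment> \<open>The left side is the frame coefficient vector of the bracket of two coordinate
      fields. Pairing with \<open>a\<close> removes the \<open>C\<close> term.\<close>
    moreover have "deriv_along (?d m q) (cf (?d n)) - deriv_along (?d n q) (cf (?d m)) + C (cf (?d m) q) (cf (?d n) q) = 0"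
      using bracket_at[OF d d U q, of m n] bracket_coord_fields[OF c(1)] by (simp add: vec_at_eq_0_iff)
    then have "a \<bullet> (deriv_along (?d m q) (cf (?d n)) - deriv_along (?d n q) (cf (?d m)) + C (cf (?d m) q) (cf (?d n) q)) = 0"
      by (simp only: inner_zero_right)
    then have "a \<bullet> deriv_along (?d m q) (cf (?d n)) = a \<bullet> deriv_along (?d n q) (cf (?d m))"
      using closed by (simp add: inner_add_right inner_diff_right)
    ultimately show ?thesis by simp
  qed
  define F where "F = (\<lambda>y. \<chi> m. \<theta> m (inv_into U \<phi> y))"
  define F' where "F' = (\<lambda>y v. \<chi> m. frechet_derivative (\<lambda>y. \<theta> m (inv_into U \<phi> y)) (at y) v)"
  have Ck: "Ck_on k (\<phi> ` U) (\<lambda>y. \<theta> m (inv_into U \<phi> y))" for k m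
    using smooth_funD[OF \<theta>_smooth c(1)] unfolding smooth_on_def Int_absorb by blast
  have F_deriv: "(F has_derivative F' y) (at y)" if "y \<in> \<phi> ` U" for y
  proof -
    have "((\<lambda>y. \<theta> m (inv_into U \<phi> y)) has_derivative frechet_derivative (\<lambda>y. \<theta> m (inv_into U \<phi> y)) (at y)) (at y)" for m
      by (rule Ck_on_has_derivative[OF Ck that])
    then have "(F has_derivative F' y) (at y within UNIV)"
      unfolding F_def F'_def by (intro has_derivative_componentwise_within[THEN iffD2])
        (auto simp: Basis_vec_def inner_axis)
    then show ?thesis by simp
  qed
  \<comment> \<open>The Poincare lemma is available on balls, so the chart image is shrunk to
    one.\<close>
  obtain r where r: "r > 0" "ball (\<phi> p) r \<subseteq> \<phi> ` U"
    using chart_open_image_domain[OF c(1)] c(2) by (meson imageI open_contains_ball)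
  have F'_cont: "continuous_on (ball (\<phi> p) r) (\<lambda>y. F' y v)" for v
    unfolding F'_def
  proof (intro continuous_on_vec_lambda)
    fix m
    have "Ck_on 0 (\<phi> ` U) (\<lambda>y. frechet_derivative (\<lambda>y. \<theta> m (inv_into U \<phi> y)) (at y) v)"
      using Ck[of "Suc 0" m] by simp
    then show "continuous_on (ball (\<phi> p) r) (\<lambda>y. frechet_derivative (\<lambda>y. \<theta> m (inv_into U \<phi> y)) (at y) v)"
      using r(2) continuous_on_subset by auto
  qed
  have F'_sym: "F' y v \<bullet> w = F' y w \<bullet> v" if y: "y \<in> ball (\<phi> p) r" for y v w
  proof -
    obtain q where q: "q \<in> U" "y = \<phi> q"
      using y r(2) by auto
    have "F' y (axis n 1) $ m = ?d n q (\<theta> m)" for m n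
      using q smooth_nearI[OF U q(1) \<theta>_smooth] by (simp add: F'_def coord_field_def)
    then have s: "F' y (axis n 1) $ m = F' y (axis m 1) $ n" for m n
      using d\<theta>[OF q(1)] by simp
    have lin: "linear (F' y)"
      using F_deriv y r(2) by (blast intro: has_derivative_linear)
    have "F' y v \<bullet> w = (\<Sum>m\<in>UNIV. \<Sum>n\<in>UNIV. v $ n * w $ m * F' y (axis n 1) $ m)" for v w
      unfolding linear_expand[OF lin, of v] by (simp add: inner_vec_def sum_distrib_left sum_distrib_right mult_ac)
    note e = this
    show ?thesis
      unfolding e[of v w] e[of w v] by (subst sum.swap) (simp add: s mult_ac)
  qed
  obtain h where h: "\<And>y. y \<in> ball (\<phi> p) r \<Longrightarrow> (h has_derivative (\<lambda>v. F y \<bullet> v)) (at y)"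
    using poincare_ball[of "\<phi> p" r F F'] F_deriv F'_cont F'_sym r(2) by (metis subsetD)
  define W where "W = {q \<in> U. \<phi> q \<in> ball (\<phi> p) r}"
  have W: "open W" "W \<subseteq> U" "p \<in> W"
    using continuous_open_preimage[OF chart_continuous[OF c(1)] U open_ball, of "\<phi> p" r] c(2) r(1)
    by (auto simp: W_def vimage_def Int_def)
  have h_smooth: "smooth_on (ball (\<phi> p) r) h"
  proof (rule smooth_onI_derivative[OF open_ball h])
    fix v
    show "smooth_on (ball (\<phi> p) r) (\<lambda>y. F y \<bullet> v)"
      unfolding smooth_on_def
    proof
      fix k
      have "Ck_on k (ball (\<phi> p) r) (\<lambda>y. \<Sum>m\<in>UNIV. \<theta> m (inv_into U \<phi> y) * v $ m)"
        by (intro Ck_on_sum Ck_on_mult Ck_on_const Ck_on_subset[OF Ck r(2)] open_ball)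
      then show "Ck_on k (ball (\<phi> p) r) (\<lambda>y. F y \<bullet> v)"
        by (simp add: F_def inner_vec_def)
    qed
  qed
  have u_smooth: "smooth_fun M W (\<lambda>q. h (\<phi> q))"
    by (rule smooth_fun_chart[OF c(1) W(2,1) smooth_on_subset[OF h_smooth]]) (auto simp: W_def)
  show thesis
  proof (rule that[OF W(1,3) u_smooth])
    fix q v assume q: "q \<in> W" and v: "v \<in> tangent_space M q"
    have qU: "q \<in> U" and qb: "\<phi> q \<in> ball (\<phi> p) r"
      using q by (auto simp: W_def)
    have "((\<lambda>y. h (\<phi> (inv_into U \<phi> y))) has_derivative (\<lambda>v. F (\<phi> q) \<bullet> v)) (at (\<phi> q))"
      by (rule has_derivative_transform_within_open[OF h[OF qb] open_ball qb])
        (use r(2) in \<open>auto simp: f_inv_into_f subset_iff\<close>)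
    from tangent_has_derivative[OF v c(1) qU smooth_nearI[OF W(1) q u_smooth] this]
    have "v (\<lambda>q. h (\<phi> q)) = (\<Sum>m\<in>UNIV. coords \<phi> v $ m * \<theta> m q)"
      using chart_inv[OF c(1) qU] by (simp add: F_def inner_vec_def mult.commute)
    moreover have "coef q v = (\<Sum>m\<in>UNIV. coords \<phi> v $ m *\<^sub>R cf (?d m) q)"
    proof -
      have "v = (\<Sum>m\<in>UNIV. coords \<phi> v $ m *\<^sub>R vec_at q (cf (?d m) q))"
        using tangent_eq_coord_fields[OF c(1) qU v] vfield_at[OF d] by simp
      also have "\<dots> = vec_at q (\<Sum>m\<in>UNIV. coords \<phi> v $ m *\<^sub>R cf (?d m) q)"
        by (simp add: linear_sum[OF linear_vec_at] vec_at_scaleR)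
      finally show ?thesis
        using coef_vec_at by metis
    qed
    ultimately show "v (\<lambda>q. h (\<phi> q)) = a \<bullet> coef q v"
      by (simp add: \<theta>_def inner_sum_right)
  qed
qed

end

section \<open>Bases of a tangent space\<close>

lemma matrix_inv_unique:
  fixes A :: "'k::field^'n^'n"
  assumes "A ** A' = mat 1"
  shows "matrix_inv A = A'"
proof -
  have "A ** matrix_inv A = mat 1 \<and> matrix_inv A ** A = mat 1"
    unfolding matrix_inv_def
    by (rule someI[of _ A']) (use assms matrix_left_right_inverse in auto)
  then have "matrix_inv A = matrix_inv A ** (A ** A')"
    by (simp add: assms)
  also have "\<dots> = A'"
    using \<open>A ** matrix_inv A = mat 1 \<and> matrix_inv A ** A = mat 1\<close> by (simp add: matrix_mul_assoc)
  finally show ?thesis .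
qed

lemma is_basis_in:
  assumes "is_basis e S"
  shows "e i \<in> S"
  using assms span_superset[of "range e"] by (auto simp: is_basis_def)

lemma is_basis_independent:
  fixes e :: "'n::finite \<Rightarrow> 'v::real_vector"
  assumes e: "is_basis e S" and s: "(\<Sum>i\<in>UNIV. c $ i *\<^sub>R e i) = 0"
  shows "c = 0"
proof -
  have inj: "inj e" and ind: "independent (range e)"
    using e by (auto simp: is_basis_def)
  define u where "u = (\<lambda>v. c $ (inv_into UNIV e v))"
  have u0: "(\<Sum>v\<in>range e. u v *\<^sub>R v) = 0"
    using s by (simp add: u_def sum.reindex[OF inj] inv_f_f[OF inj])
  have "dependent (range e)" if "\<exists>v\<in>range e. u v \<noteq> 0"
    unfolding dependent_finite[OF finite_imageI[OF finite]]
    by (rule exI[of _ u]) (rule conjI[OF that u0])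
  then have "\<forall>v\<in>range e. u v = 0"
    using ind by blast
  then have "c $ i = 0" for i
    by (simp add: u_def inv_f_f[OF inj])
  then show ?thesis by (simp add: vec_eq_iff)
qed

context frame
begin

text \<open>Provides the witness for the basis that \<open>contract\<close> selects with
  \<open>SOME\<close>.\<close>

lemma is_basis_frame: "is_basis (\<lambda>i. E i p) (tangent_space M p)"
proof -
  have axis: "vec_at p (axis i 1) = E i p" for i
    by (simp add: vec_at_def axis_def if_distrib[of "\<lambda>x. x *\<^sub>R _"] cong: if_cong)
  have inj: "inj (\<lambda>i. E i p)"
  proof (rule injI)
    fix i j assume "E i p = E j p"
    then have "vec_at p (axis i 1) = vec_at p (axis j 1)"
      by (simp add: axis)
    then show "i = j" by (simp add: axis_eq_axis)
  qed
  moreover have "independent (range (\<lambda>i. E i p))"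
  proof
    assume "dependent (range (\<lambda>i. E i p))"
    then obtain c where c: "\<exists>v\<in>range (\<lambda>i. E i p). c v \<noteq> 0" "(\<Sum>v\<in>range (\<lambda>i. E i p). c v *\<^sub>R v) = 0"
      by (auto simp: dependent_finite)
    from c(2) have "vec_at p (\<chi> i. c (E i p)) = 0"
      by (simp add: vec_at_def sum.reindex[OF inj])
    then show False
      using c(1) by (auto simp: vec_at_eq_0_iff vec_eq_iff)
  qed
  moreover have "span (range (\<lambda>i. E i p)) = tangent_space M p"
  proof
    show "span (range (\<lambda>i. E i p)) \<subseteq> tangent_space M p"
      by (rule span_minimal[OF _ tangent_subspace]) (auto simp: frame_tangent)
    show "tangent_space M p \<subseteq> span (range (\<lambda>i. E i p))"
    proof
      fix v assume "v \<in> tangent_space M p"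
      then have "v = (\<Sum>i\<in>UNIV. coef p v $ i *\<^sub>R E i p)"
        using vec_at_coef[of v p] by (simp add: vec_at_def)
      then show "v \<in> span (range (\<lambda>i. E i p))"
        using span_sum[of UNIV "\<lambda>i. coef p v $ i *\<^sub>R E i p" "range (\<lambda>i. E i p)"]
        by (simp add: span_scale span_base)
    qed
  qed
  ultimately show ?thesis
    by (simp add: is_basis_def)
qed

lemma basis_coef_det:
  fixes e :: "'n \<Rightarrow> 'a tvec"
  assumes e: "is_basis e (tangent_space M p)"
  shows "det (\<chi> i j. coef p (e i) $ j) \<noteq> 0" and "e i \<in> tangent_space M p"
proof -
  show et: "e i \<in> tangent_space M p" for i
    using is_basis_in[OF e] .
  let ?P = "\<chi> i j. coef p (e i) $ j"
  have "c = 0" if c: "c v* ?P = 0" for c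
  proof -
    have "(\<Sum>i\<in>UNIV. c $ i *\<^sub>R coef p (e i)) = 0"
      using c by (simp add: vec_eq_iff vector_matrix_mult_def mult.commute)
    then have "vec_at p (\<Sum>i\<in>UNIV. c $ i *\<^sub>R coef p (e i)) = 0"
      by (simp add: vec_at_0)
    then have "(\<Sum>i\<in>UNIV. c $ i *\<^sub>R e i) = 0"
      by (simp add: linear_sum[OF linear_vec_at] vec_at_scaleR et)
    then show ?thesis
      by (rule is_basis_independent[OF e])
  qed
  then have "\<forall>c. transpose ?P *v c = 0 \<longrightarrow> c = 0"
    by (metis transpose_matrix_vector)
  then have "det (transpose ?P) \<noteq> 0"
    by (simp only: invertible_det_nz[symmetric] invertible_left_inverse matrix_left_invertible_ker)
  then show "det ?P \<noteq> 0" by (simp add: det_transpose)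
qed

end

section \<open>Contraction and Ricci curvature in an orthonormal frame\<close>

locale orthonormal_frame = metric_frame M E C g B
  for M :: "('a::{t2_space,second_countable_topology}, real^'n) atlas"
    and E :: "'n \<Rightarrow> 'a vfield" and C :: "real^'n \<Rightarrow> real^'n \<Rightarrow> real^'n"
    and g :: "'a bform" and B :: "real^'n \<Rightarrow> real^'n \<Rightarrow> real" +
  fixes \<eta> :: "'n \<Rightarrow> real"
  assumes \<eta>_sq: "\<eta> i * \<eta> i = 1" and B_axis: "B (axis i 1) (axis j 1) = (if i = j then \<eta> i else 0)"
begin

definition trace_form :: "(real^'n \<Rightarrow> real^'n \<Rightarrow> real) \<Rightarrow> real" where
  "trace_form F = (\<Sum>i\<in>UNIV. \<eta> i * F (axis i 1) (axis i 1))"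

text \<open>\<open>contract\<close> works in an arbitrary basis. With \<open>P\<close> its matrix in
  the frame, the Gram matrix is P N P^T and the contracted form is P H P^T. As N squares to 1, the
  inverse Gram matrix is Q^T N Q, where Q is inverse to P; cyclicity of the trace then removes the
  change of basis and leaves the trace of N H.\<close>

lemma contract_eq_trace:
  assumes F: "bilinear F" and b: "\<And>v w. v \<in> tangent_space M p \<Longrightarrow> w \<in> tangent_space M p \<Longrightarrow> b v w = F (coef p v) (coef p w)"
  shows "contract M g p b = trace_form F"
proof -
  define e :: "'n \<Rightarrow> 'a tvec" where "e = (SOME e. is_basis e (tangent_space M p))"
  have e: "is_basis e (tangent_space M p)"
    unfolding e_def
    by (rule someI[of "\<lambda>e. is_basis e (tangent_space M p)", OF is_basis_frame])
  note et = basis_coef_det(2)[OF e]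
  define P where "P = (\<chi> i j. coef p (e i) $ j)"
  define N :: "real^'n^'n" where "N = (\<chi> i j. B (axis i 1) (axis j 1))"
  define H where "H = (\<chi> i j. F (axis i 1) (axis j 1))"
  obtain Q where Q: "P ** Q = mat 1" "Q ** P = mat 1"
    using basis_coef_det(1)[OF e] unfolding P_def invertible_det_nz[symmetric] invertible_def by blast
  have NN: "N ** N = mat 1"
    by (simp add: N_def B_axis matrix_matrix_mult_def mat_def vec_eq_iff if_distrib[of "\<lambda>x. x * _"] \<eta>_sq cong: if_cong)
  have Nt: "transpose N = N"
    by (simp add: N_def transpose_def B_sym)
  have form: "(\<chi> i j. L (coef p (e i)) (coef p (e j))) = P ** (\<chi> i j. L (axis i 1) (axis j 1)) ** transpose P"
    if "bilinear L" for L :: "real^'n \<Rightarrow> real^'n \<Rightarrow> real"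
  proof -
    have "L (coef p (e i)) (coef p (e j)) = (\<Sum>k\<in>UNIV. \<Sum>m\<in>UNIV. P $ i $ m * L (axis m 1) (axis k 1) * P $ j $ k)" for i j
      unfolding bilinear_expand[OF that, of "coef p (e i)"] by (subst sum.swap) (simp add: P_def mult_ac)
    then show ?thesis
      by (simp add: vec_eq_iff matrix_matrix_mult_def transpose_def sum_distrib_right)
  qed
  have Qt: "transpose P ** transpose Q = mat 1"
    by (simp add: matrix_transpose_mul[symmetric] Q)
  have "(\<chi> i j. g p (e i) (e j)) = P ** N ** transpose P"
    using form[OF bilinear_B] by (simp add: g_at et N_def)
  moreover have "(P ** N ** transpose P) ** (transpose Q ** N ** Q) = mat 1"
  proof -
    have "(P ** N ** transpose P) ** (transpose Q ** N ** Q) = P ** (N ** (transpose P ** transpose Q) ** N) ** Q"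
      by (simp add: matrix_mul_assoc)
    then show ?thesis by (simp add: Qt NN Q)
  qed
  ultimately have inv: "matrix_inv (\<chi> i j. g p (e i) (e j)) = transpose Q ** N ** Q"
    using matrix_inv_unique by metis
  have "contract M g p b = (\<Sum>i\<in>UNIV. \<Sum>j\<in>UNIV. (transpose Q ** N ** Q) $ i $ j * b (e i) (e j))"
    by (simp add: contract_def Let_def e_def[symmetric] inv)
  also have "\<dots> = (\<Sum>i\<in>UNIV. \<Sum>j\<in>UNIV. transpose (transpose Q ** N ** Q) $ j $ i * (P ** H ** transpose P) $ i $ j)"
    using form[OF F] by (simp add: b et H_def[symmetric] vec_eq_iff transpose_def)
  also have "\<dots> = trace (transpose (transpose Q ** N ** Q) ** (P ** H ** transpose P))"
    unfolding trace_def matrix_matrix_mult_def[of "transpose _"] by (subst sum.swap) simp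
  also have "transpose (transpose Q ** N ** Q) = transpose Q ** N ** Q"
    by (simp add: matrix_transpose_mul Nt matrix_mul_assoc)
  also have "(transpose Q ** N ** Q) ** (P ** H ** transpose P) = transpose Q ** (N ** (Q ** P) ** H ** transpose P)"
    by (simp add: matrix_mul_assoc)
  also have "trace \<dots> = trace (N ** H ** (transpose P ** transpose Q))"
    by (subst trace_mul_sym) (simp add: Q matrix_mul_assoc)
  also have "\<dots> = trace (N ** H)"
    by (simp add: Qt)
  also have "\<dots> = trace_form F"
    by (simp add: trace_def trace_form_def N_def H_def matrix_matrix_mult_def B_axis if_distrib[of "\<lambda>x. x * _"] cong: if_cong)
  finally show ?thesis .
qed

lemma B_axis_left: "B (axis i 1) z = \<eta> i * z $ i"
  unfolding linear_expand[of "B (axis i 1)" z, OF conjunct1[OF bilinear_B[unfolded bilinear_def], rule_format]]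
  by (simp add: B_axis if_distrib cong: if_cong)

text \<open>Contracting the metric with a covector returns the covector, because the signs
  \<open>\<eta> i\<close> square to 1.\<close>

lemma trace_B_left:
  assumes "linear f"
  shows "(\<Sum>i\<in>UNIV. \<eta> i * (B (axis i 1) z * f (axis i 1))) = (f z :: real)"
proof -
  have eq: "\<eta> i * (B (axis i 1) z * f (axis i 1)) = z $ i * f (axis i 1)" for i
    using \<eta>_sq[of i] by (simp add: B_axis_left mult.assoc[symmetric])
  show ?thesis
    unfolding eq using linear_expand[OF assms, of z] by simp
qed

lemma trace_form_B: "trace_form B = real CARD('n)"
  by (simp add: trace_form_def B_axis \<eta>_sq)

text \<open>In dimension 4, contraction of g KN A gives rho = -2 A - (tr A) g and tau = -6 tr A.
  Solving yields A = -(1/2) rho + (tau/12) g, which is put back into g KN A.\<close>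

lemma kulkarni_nomizu_curvature:
  assumes dim: "CARD('n) = 4" and G: "agrees UNIV (levi_civita M UNIV g) G"
    and A: "bilinear A" and A_sym: "\<And>x y. A x y = A y x"
    and R: "\<And>x y z w. B (curv G x y z) w = kulkarni_nomizu B A x y z w"
    and xyzw: "x \<in> tangent_space M p" "y \<in> tangent_space M p" "z \<in> tangent_space M p" "w \<in> tangent_space M p"
  shows "riemann M UNIV g p x y z w =
     - (1/2) * kulkarni_nomizu (g p) (ricci M UNIV g p) x y z w
     + scalar_curvature M UNIV g p / 12 * kulkarni_nomizu (g p) (g p) x y z w"
proof -
  have linA: "linear (A x)" and linA': "linear (\<lambda>x. A x y)" for x y
    using A by (simp_all add: bilinear_def)
  have ricci: "ricci M UNIV g p y z = - 2 * A (coef p y) (coef p z) - trace_form A * B (coef p y) (coef p z)"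
    if y: "y \<in> tangent_space M p" and z: "z \<in> tangent_space M p" for y z
  proof -
    have "bilinear (\<lambda>x w. kulkarni_nomizu B A x (coef p y) (coef p z) w)"
      unfolding kulkarni_nomizu_def bilinear_def
      by (intro conjI allI linearI)
        (simp_all add: bilinear_ladd[OF A] bilinear_radd[OF A] bilinear_lmul[OF A] bilinear_rmul[OF A]
          bilinear_ladd[OF bilinear_B] bilinear_radd[OF bilinear_B] bilinear_lmul[OF bilinear_B]
          bilinear_rmul[OF bilinear_B] algebra_simps)
    then have "ricci M UNIV g p y z = trace_form (\<lambda>x w. kulkarni_nomizu B A x (coef p y) (coef p z) w)"
      unfolding ricci_def by (rule contract_eq_trace) (simp add: riemann_agrees[OF G _ y z] R)
    \<comment> \<open>Of the four terms, the first and third contract to A each, the second to -(tr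
      A) g, and the last to -4 A since the trace of the metric is the dimension.\<close>
    also have "\<dots> = (\<Sum>i\<in>UNIV. \<eta> i * (B (axis i 1) (coef p z) * A (coef p y) (axis i 1)))
        - B (coef p y) (coef p z) * (\<Sum>i\<in>UNIV. \<eta> i * A (axis i 1) (axis i 1))
        + (\<Sum>i\<in>UNIV. \<eta> i * (B (axis i 1) (coef p y) * A (axis i 1) (coef p z)))
        - (\<Sum>i\<in>UNIV. \<eta> i * B (axis i 1) (axis i 1)) * A (coef p y) (coef p z)"
      by (simp add: trace_form_def kulkarni_nomizu_def B_sym[of "coef p y" "axis _ 1"] algebra_simps
          sum.distrib sum_subtractf sum_distrib_left sum_distrib_right)
    also have "\<dots> = - 2 * A (coef p y) (coef p z) - trace_form A * B (coef p y) (coef p z)"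
      using trace_B_left[OF linA, of "coef p z" "coef p y"] trace_B_left[OF linA', of "coef p y" "coef p z"] trace_form_B dim
      by (simp add: trace_form_def)
    finally show ?thesis .
  qed
  have "bilinear (\<lambda>y z. - 2 * A y z - trace_form A * B y z)"
    unfolding bilinear_def
    by (intro conjI allI linearI)
      (simp_all add: bilinear_ladd[OF A] bilinear_radd[OF A] bilinear_lmul[OF A] bilinear_rmul[OF A]
        bilinear_ladd[OF bilinear_B] bilinear_radd[OF bilinear_B] bilinear_lmul[OF bilinear_B]
        bilinear_rmul[OF bilinear_B] algebra_simps)
  then have "scalar_curvature M UNIV g p = trace_form (\<lambda>y z. - 2 * A y z - trace_form A * B y z)"
    unfolding scalar_curvature_def by (rule contract_eq_trace) (rule ricci)
  also have "\<dots> = - 2 * trace_form A - trace_form A * trace_form B"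
    by (simp add: trace_form_def[of "\<lambda>y z. _ y z - _ y z"] trace_form_def[of A] trace_form_def[of B] algebra_simps
        sum_subtractf sum_negf sum_distrib_left sum_distrib_right)
  finally have sc: "scalar_curvature M UNIV g p = - 6 * trace_form A"
    by (simp add: trace_form_B dim)
  show ?thesis
    unfolding riemann_agrees[OF G xyzw] R sc kulkarni_nomizu_def
    by (simp add: ricci xyzw g_at algebra_simps)
qed

end

subsection \<open>The algebraic data in dimension four\<close>

definition vec4 :: "real \<Rightarrow> real \<Rightarrow> real \<Rightarrow> real \<Rightarrow> real^4" where
  "vec4 a b c d = (\<chi> i. if i = 1 then a else if i = 2 then b else if i = 3 then c else d)"

lemma vec4_nth [simp]:
  "vec4 a b c d $ 1 = a" "vec4 a b c d $ 2 = b" "vec4 a b c d $ 3 = c" "vec4 a b c d $ 4 = d"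
  by (simp_all add: vec4_def)

lemma inner_4: "x \<bullet> y = x$1 * y$1 + x$2 * y$2 + x$3 * y$3 + x$4 * y$4" for x y :: "real^4"
  by (simp add: inner_vec_def sum_4)

lemma vec_eq_iff_4: "x = y \<longleftrightarrow> x$1 = y$1 \<and> x$2 = y$2 \<and> x$3 = y$3 \<and> x$4 = y$4" for x y :: "real^4"
  by (simp add: vec_eq_iff forall_4)

lemma axis_4: "axis 1 1 = vec4 1 0 0 0" "axis 2 1 = vec4 0 1 0 0"
  "axis 3 1 = vec4 0 0 1 0" "axis 4 1 = vec4 0 0 0 1"
  by (simp_all add: vec_eq_iff_4 axis_def)

definition rot :: "real^4 \<Rightarrow> real^4" where
  "rot z = vec4 (- z$2) (z$1) (- z$4) (z$3)"

definition Jm :: "nat \<Rightarrow> real^4 \<Rightarrow> real^4" where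
  "Jm \<alpha> z = (if \<alpha> = 1 then vec4 (- z$2) (z$1) (z$4) (- z$3)
     else if \<alpha> = 2 then vec4 (- z$3) (- z$4) (z$1) (z$2)
     else vec4 (z$4) (- z$3) (z$2) (- z$1))"

definition neutral :: "real^4 \<Rightarrow> real^4 \<Rightarrow> real" where
  "neutral x y = x$1 * y$1 + x$2 * y$2 - x$3 * y$3 - x$4 * y$4"

definition lee :: "real^4 \<Rightarrow> real^4" where
  "lee l = vec4 (l$4) (l$3) (- l$2) (- l$1)"

definition lee_rot :: "real^4 \<Rightarrow> real^4" where
  "lee_rot l = vec4 (- l$3) (l$4) (l$1) (- l$2)"

text \<open>The vector dual to alpha under the neutral metric, hence the sign changes in the last
  two entries.\<close>

definition lee_vec :: "real^4 \<Rightarrow> real^4" where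
  "lee_vec l = vec4 (l$4) (l$3) (l$2) (l$1)"

text \<open>With \<open>rot\<close> as multiplication by \<open>i\<close> on \<open>\<complex>\<^sup>2\<close>, the three maps \<open>J\<close> are complex linear and the
  bracket is \<open>\<omega>(x) y - \<omega>(y) x\<close> for the complex valued form \<open>\<omega> = lee + i lee_rot\<close>.\<close>

definition struct :: "real^4 \<Rightarrow> real^4 \<Rightarrow> real^4 \<Rightarrow> real^4" where
  "struct l x y = (lee l \<bullet> x) *\<^sub>R y - (lee l \<bullet> y) *\<^sub>R x + (lee_rot l \<bullet> x) *\<^sub>R rot y - (lee_rot l \<bullet> y) *\<^sub>R rot x"

text \<open>Conformal change of \<open>chr_conf\<close>: the terms alpha(x) y + alpha(y) x - g(x,y)
  alpha^# are subtracted, with alpha^# = \<open>lee_vec l\<close>.\<close>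

definition chr_g :: "real^4 \<Rightarrow> real^4 \<Rightarrow> real^4 \<Rightarrow> real^4" where
  "chr_g l x y = (lee_rot l \<bullet> x) *\<^sub>R rot y - (lee l \<bullet> y) *\<^sub>R x + neutral x y *\<^sub>R lee_vec l"

definition chr_conf :: "real^4 \<Rightarrow> real^4 \<Rightarrow> real^4 \<Rightarrow> real^4" where
  "chr_conf l x y = (lee l \<bullet> x) *\<^sub>R y + (lee_rot l \<bullet> x) *\<^sub>R rot y"

definition chr_HG :: "real^4 \<Rightarrow> real^4 \<Rightarrow> real^4 \<Rightarrow> real^4" where
  "chr_HG l x y = (1/2 * (lee_rot l \<bullet> x)) *\<^sub>R rot y"

lemma linear_rot: "linear rot"
  by (rule linearI) (simp_all add: rot_def vec_eq_iff_4)

lemma linear_Jm: "linear (Jm \<alpha>)"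
  by (rule linearI) (simp_all add: Jm_def vec_eq_iff_4)

lemma rot_rot: "rot (rot x) = - x"
  by (simp add: rot_def vec_eq_iff_4)

lemma Jm_rot: "Jm \<alpha> (rot x) = rot (Jm \<alpha> x)"
  by (simp add: rot_def Jm_def vec_eq_iff_4)

lemma bilinear_neutral: "bilinear neutral"
  unfolding bilinear_def by (intro conjI allI linearI) (simp_all add: neutral_def algebra_simps)

lemma neutral_sym: "neutral x y = neutral y x"
  by (simp add: neutral_def)

lemma neutral_rot: "neutral (rot x) y = - neutral x (rot y)"
  by (simp add: neutral_def rot_def)

lemma neutral_lee_vec: "neutral (lee_vec l) y = lee l \<bullet> y"
  by (simp add: neutral_def lee_vec_def lee_def inner_4)

text \<open>Complex linearity of omega, omega(i x) = i omega(x), in real and imaginary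
  parts.\<close>

lemma lee_inner_rot: "lee l \<bullet> rot x = - (lee_rot l \<bullet> x)" and lee_rot_inner_rot: "lee_rot l \<bullet> rot x = lee l \<bullet> x"
  by (simp_all add: lee_def lee_rot_def rot_def inner_4)

lemmas rot_linear = linear_add[OF linear_rot] linear_diff[OF linear_rot] linear_cmul[OF linear_rot]
  linear_neg[OF linear_rot] rot_rot
lemmas Jm_linear = linear_add[OF linear_Jm] linear_diff[OF linear_Jm] linear_cmul[OF linear_Jm] Jm_rot
lemmas neutral_bilinear = bilinear_ladd[OF bilinear_neutral] bilinear_lsub[OF bilinear_neutral]
  bilinear_lmul[OF bilinear_neutral] bilinear_radd[OF bilinear_neutral] bilinear_rsub[OF bilinear_neutral]
  bilinear_rmul[OF bilinear_neutral] bilinear_lneg[OF bilinear_neutral] bilinear_rneg[OF bilinear_neutral]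
lemmas lee_simps = lee_inner_rot lee_rot_inner_rot inner_add_right inner_diff_right

lemma bilinear_struct: "bilinear (struct l)"
  unfolding bilinear_def
  by (intro conjI allI linearI) (simp_all add: struct_def rot_linear lee_simps algebra_simps)

lemma bilinear_chr_g: "bilinear (chr_g l)"
  unfolding bilinear_def
  by (intro conjI allI linearI) (simp_all add: chr_g_def rot_linear neutral_bilinear lee_simps algebra_simps)

lemma bilinear_chr_conf: "bilinear (chr_conf l)"
  unfolding bilinear_def
  by (intro conjI allI linearI) (simp_all add: chr_conf_def rot_linear lee_simps algebra_simps)

text \<open>Complex linearity gives omega([x, y]) = omega(x) omega(y) - omega(y) omega(x) =
  0.\<close>

lemma lee_struct: "lee l \<bullet> struct l x y = 0" and lee_rot_struct: "lee_rot l \<bullet> struct l x y = 0"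
  by (simp_all add: struct_def lee_simps)

lemma chr_conf_Jm: "chr_conf l x (Jm \<alpha> y) = Jm \<alpha> (chr_conf l x y)"
  by (simp add: chr_conf_def Jm_linear)

text \<open>As each \<open>Jm \<alpha>\<close> squares to -1 for these indices, the left side
  projects the operator \<open>chr_g l y\<close> onto the commutant of the three maps.
  \<open>rot\<close> lies in the commutant, and the part - alpha(z) y + g(y,z) alpha^# projects to -
  (1/2) beta(y) rot z.\<close>

lemma chr_HG_eq:
  "chr_g l y z + (1/4) *\<^sub>R (\<Sum>\<alpha>=1..3. chr_g l y (Jm \<alpha> (Jm \<alpha> z)) - Jm \<alpha> (chr_g l y (Jm \<alpha> z))) = chr_HG l y z"
proof -
  have sum3: "(\<Sum>\<alpha>=1..3::nat. f \<alpha>) = f 1 + f 2 + f 3" for f :: "nat \<Rightarrow> real^4"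
    by (simp add: numeral_3_eq_3 numeral_2_eq_2)
  show ?thesis
    unfolding sum3
    by (simp add: chr_g_def chr_HG_def Jm_def vec_eq_iff_4 rot_def inner_4 neutral_def lee_def
        lee_rot_def lee_vec_def field_simps)
qed

lemma Jm_quaternion:
  "(\<alpha>, \<beta>, \<gamma>) \<in> {(1, 2, 3), (2, 3, 1), (3, 1, 2)} \<Longrightarrow> Jm \<alpha> x = Jm \<beta> (Jm \<gamma> x) \<and> Jm \<alpha> x = - Jm \<gamma> (Jm \<beta> x)"
  by (auto simp: Jm_def vec_eq_iff_4)

lemma Jm_Jm: "\<alpha> \<in> {1..3} \<Longrightarrow> Jm \<alpha> (Jm \<alpha> x) = - x"
  by (auto simp: Jm_def vec_eq_iff_4)

lemma neutral_Jm: "\<alpha> \<in> {1..3} \<Longrightarrow> neutral x y = eps \<alpha> * neutral (Jm \<alpha> x) (Jm \<alpha> y)"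
  by (auto simp: Jm_def neutral_def eps_def)

text \<open>The negative of the Schouten tensor of \<open>g\<close>; the sign matches the order of
  arguments in \<open>kulkarni_nomizu\<close>.\<close>

definition schouten :: "real^4 \<Rightarrow> real^4 \<Rightarrow> real^4 \<Rightarrow> real" where
  "schouten l x y = neutral (lee_vec l) (lee_vec l) / 2 * neutral x y - (lee_rot l \<bullet> x) * (lee_rot l \<bullet> y)"

lemma bilinear_schouten: "bilinear (schouten l)"
  unfolding bilinear_def
  by (intro conjI allI linearI) (simp_all add: schouten_def neutral_bilinear lee_simps algebra_simps)

text \<open>Once structure constants are expanded, only the values of g, alpha and beta remain. The
  particular relations are alpha(alpha^#) = |alpha|^2, beta(alpha^#) = 0, and that i alpha^# is dual
  to beta.\<close>

lemma chr_g_curvature: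
  "neutral (chr_g l x (chr_g l y z) - chr_g l y (chr_g l x z) - chr_g l (struct l x y) z) w =
    kulkarni_nomizu neutral (schouten l) x y z w"
proof -
  have lv: "neutral x (lee_vec l) = lee l \<bullet> x" for x
    using neutral_lee_vec[of l x] by (simp add: neutral_sym)
  have b: "neutral (rot (lee_vec l)) x = lee_rot l \<bullet> x" for x
    by (simp add: neutral_rot neutral_lee_vec lee_inner_rot)
  have "chr_g l (struct l x y) z = neutral (struct l x y) z *\<^sub>R lee_vec l - (lee l \<bullet> z) *\<^sub>R struct l x y"
    by (simp add: chr_g_def lee_rot_struct)
  moreover have "lee l \<bullet> lee_vec l = neutral (lee_vec l) (lee_vec l)"
    by (simp add: neutral_lee_vec)
  moreover have "lee_rot l \<bullet> lee_vec l = 0"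
    by (simp add: inner_4 lee_rot_def lee_vec_def)
  ultimately show ?thesis
    using neutral_sym[of x y] neutral_sym[of x z] neutral_sym[of y z]
    by (simp add: chr_g_def struct_def kulkarni_nomizu_def schouten_def rot_linear neutral_bilinear lee_simps
        lv neutral_lee_vec b neutral_rot neutral_sym[of "rot _"]
        algebra_simps)
qed

text \<open>With t the torsion, the condition reads (beta(x)/2) (i t(y,z) - t(iy,z) - t(y,iz)) = 0,
  and the bracketed vector is (1/2) alpha(y) iz - (1/2) alpha(z) iy - beta(y) z + beta(z) y. For y =
  X1 and z = X3 the vectors y, iy, z, iz form the frame, so the four components are the entries of
  \<open>l\<close> up to nonzero factors. The values of beta on the frame are these entries up to
  sign, and each choice of \<open>x\<close> below pairs an entry with itself.\<close>

lemma chr_HG_not_parallel: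
  fixes l :: "real^4"
  defines "t \<equiv> \<lambda>x y. chr_HG l x y - chr_HG l y x - struct l x y"
  assumes par: "\<And>x y z. chr_HG l x (t y z) = t (chr_HG l x y) z + t y (chr_HG l x z)"
  shows "l = 0"
proof -
  let ?y = "vec4 1 0 0 0" and ?z = "vec4 0 0 1 0"
  have eq: "(chr_HG l x (t ?y ?z)) $ k = (t (chr_HG l x ?y) ?z + t ?y (chr_HG l x ?z)) $ k" for x k
    using par by simp
  note defs = t_def chr_HG_def struct_def rot_def inner_4 lee_def lee_rot_def
  have "l$3 = 0"
    using eq[of "vec4 1 0 0 0" 3] by (simp add: defs)
  moreover have "l$4 = 0"
    using eq[of "vec4 0 1 0 0" 4] by (simp add: defs)
  moreover have "l$1 = 0"
    using eq[of "vec4 0 0 1 0" 1] by (simp add: defs)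
  moreover have "l$2 = 0"
    using eq[of "vec4 0 0 0 1" 2] by (simp add: defs)
  ultimately show ?thesis
    by (simp add: vec_eq_iff_4)
qed

definition sig :: "4 \<Rightarrow> real" where
  "sig i = (if i = 1 \<or> i = 2 then 1 else - 1)"

lemma neutral_axis: "neutral (axis i 1) (axis j 1) = (if i = j then sig i else 0)"
  by (simp add: neutral_def axis_def sig_def) (use exhaust_4 in fastforce)

lemma neutral_nondegenerate: "(\<And>y. neutral x y = 0) \<Longrightarrow> x = 0"
proof -
  assume h: "\<And>y. neutral x y = 0"
  show "x = 0"
    using h[of "vec4 1 0 0 0"] h[of "vec4 0 1 0 0"] h[of "vec4 0 0 1 0"] h[of "vec4 0 0 0 1"]
    by (simp add: neutral_def vec_eq_iff_4)
qed

section \<open>Metric and endomorphisms recovered from their values on the frame\<close>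

context frame
begin

lemma bilinear_sym_on_vec_at:
  assumes g: "bilinear_sym_on M UNIV g" and B: "bilinear B"
    and gE: "\<And>i j. g p (E i p) (E j p) = B (axis i 1) (axis j 1)"
  shows "g p (vec_at p x) (vec_at p y) = B x y"
proof -
  have "\<forall>p\<in>UNIV. \<forall>v\<in>tangent_space M p. \<forall>w\<in>tangent_space M p. g p v w = g p w v \<and>
      (\<forall>c. g p (c *\<^sub>R v) w = c * g p v w) \<and>
      (\<forall>u\<in>tangent_space M p. g p (u + v) w = g p u w + g p v w)"
    using g by (simp add: bilinear_sym_on_def)
  note h = bspec[OF bspec[OF bspec[OF this UNIV_I]]]
  have gs: "g p v w = g p w v" and gc: "g p (c *\<^sub>R v) w = c * g p v w"
    if "v \<in> tangent_space M p" "w \<in> tangent_space M p" for v w c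
    using h[OF that] by blast+
  have ga: "g p (u + v) w = g p u w + g p v w"
    if "u \<in> tangent_space M p" "v \<in> tangent_space M p" "w \<in> tangent_space M p" for u v w
    using h[OF that(2,3)] that(1) by blast
  have g0: "g p 0 w = 0" if "w \<in> tangent_space M p" for w
    using gc[OF that that, of 0] by simp
  \<comment> \<open>Additivity is available on tangent vectors only, so the induction has to check
    that each partial sum is tangent.\<close>
  have sum: "g p (\<Sum>i\<in>I. x $ i *\<^sub>R E i p) w = (\<Sum>i\<in>I. x $ i * g p (E i p) w)"
    if w: "w \<in> tangent_space M p" for I w x
  proof (induction I rule: infinite_finite_induct)
    case (insert i I)
    have "(\<Sum>i\<in>I. x $ i *\<^sub>R E i p) \<in> tangent_space M p"
      by (intro tangent_sum tangent_scaleR frame_tangent)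
    from ga[OF tangent_scaleR[OF frame_tangent] this w] show ?case
      unfolding sum.insert[OF insert(1,2)] by (simp only: gc[OF frame_tangent w] insert(3))
  qed (simp_all only: sum.infinite sum.empty g0[OF w] not_False_eq_True)
  have "g p (vec_at p x) (vec_at p y) = (\<Sum>i\<in>UNIV. x $ i * g p (vec_at p y) (E i p))"
    using sum[OF vec_at_tangent, where I = UNIV] gs[OF frame_tangent vec_at_tangent]
    by (simp add: vec_at_def[of p x])
  also have "\<dots> = (\<Sum>i\<in>UNIV. x $ i * (\<Sum>j\<in>UNIV. y $ j * B (axis i 1) (axis j 1)))"
    using sum[OF frame_tangent] gs[OF frame_tangent frame_tangent] by (simp add: vec_at_def gE)
  also have "\<dots> = B x y"
    by (simp add: bilinear_expand[OF B, of x] sum_distrib_left mult_ac)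
  finally show ?thesis .
qed

lemma const_endoI:
  assumes J: "endo_on M UNIV J" and K: "linear K" and JE: "\<And>i p. J p (E i p) = vec_at p (K (axis i 1))"
  shows "const_endo J K"
  unfolding const_endo_def
proof (intro conjI allI K)
  fix p c
  have Ja: "J p (v + w) = J p v + J p w" and Jc: "J p (r *\<^sub>R v) = r *\<^sub>R J p v"
    if "v \<in> tangent_space M p" "w \<in> tangent_space M p" for v w r
    using J that unfolding endo_on_def by blast+
  have J0: "J p 0 = 0"
    using Jc[OF tangent_0 tangent_0, of 0] by simp
  have "J p (\<Sum>i\<in>I. c $ i *\<^sub>R E i p) = (\<Sum>i\<in>I. c $ i *\<^sub>R J p (E i p))" for I
  proof (induction I rule: infinite_finite_induct)
    case (insert i I)
    have "(\<Sum>i\<in>I. c $ i *\<^sub>R E i p) \<in> tangent_space M p"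
      by (intro tangent_sum tangent_scaleR frame_tangent)
    from Ja[OF tangent_scaleR[OF frame_tangent] this] show ?case
      unfolding sum.insert[OF insert(1,2)]
      by (simp only: Jc[OF frame_tangent frame_tangent] insert(3))
  qed (simp_all only: sum.infinite sum.empty J0 not_False_eq_True)
  then have "J p (vec_at p c) = (\<Sum>i\<in>UNIV. c $ i *\<^sub>R vec_at p (K (axis i 1)))"
    by (simp add: vec_at_def[of p c] JE)
  also have "\<dots> = vec_at p (K c)"
    by (simp add: linear_expand[OF K, of c] linear_sum[OF linear_vec_at] vec_at_scaleR)
  finally show "J p (vec_at p c) = vec_at p (K c)" .
qed

end

section \<open>The claims for the four-dimensional frame\<close>

locale lck_frame = orthonormal_frame M E "struct l" g neutral sig
  for M :: "('a::{t2_space,second_countable_topology}, real^4) atlas"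
    and E :: "4 \<Rightarrow> 'a vfield" and l :: "real^4" and g :: "'a bform" +
  fixes J :: "nat \<Rightarrow> 'a endo"
  assumes J_const: "\<alpha> \<in> {1..3} \<Longrightarrow> const_endo (J \<alpha>) (Jm \<alpha>)"
begin

lemma conformal_0: "conformal (\<lambda>_. 0) g = g"
  by (simp add: conformal_def)

lemma agrees_g: "agrees UNIV (levi_civita M UNIV g) (chr_g l)"
proof -
  have "agrees UNIV (levi_civita M UNIV (conformal (\<lambda>_. 0) g)) (chr_g l)"
  proof (rule agrees_levi_civita[OF open_UNIV smooth_fun_const[OF open_UNIV] _ bilinear_chr_g, of 0])
    show "v (\<lambda>_. 0) = 0 \<bullet> coef p v" if "v \<in> tangent_space M p" for p v
      using tangent_const[OF that] by simp
    show "chr_g l x y - chr_g l y x = struct l x y" for x y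
      by (simp add: chr_g_def struct_def neutral_sym)
    show "neutral (chr_g l x y) z + neutral y (chr_g l x z) = 2 * (0 \<bullet> x) * neutral y z" for x y z
      using neutral_sym[of x y] neutral_sym[of x z] neutral_sym[of y "lee_vec l"]
      by (simp add: chr_g_def neutral_bilinear neutral_lee_vec neutral_rot algebra_simps)
  qed
  then show ?thesis by (simp add: conformal_0)
qed

lemma agrees_conformal:
  assumes W: "open W" "smooth_fun M W u" "\<And>q v. q \<in> W \<Longrightarrow> v \<in> tangent_space M q \<Longrightarrow> v u = lee l \<bullet> coef q v"
  shows "agrees W (levi_civita M W (conformal u g)) (chr_conf l)"
proof (rule agrees_levi_civita[OF W bilinear_chr_conf])
  show "chr_conf l x y - chr_conf l y x = struct l x y" for x y
    by (simp add: chr_conf_def struct_def)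
  \<comment> \<open>\<open>rot\<close> is skew for the neutral metric, so only the real part
    alpha(x) of omega(x) rescales it.\<close>
  show "neutral (chr_conf l x y) z + neutral y (chr_conf l x z) = 2 * (lee l \<bullet> x) * neutral y z" for x y z
    by (simp add: chr_conf_def neutral_bilinear neutral_rot algebra_simps)
qed

lemma agrees_HG: "agrees UNIV (HG_connection M UNIV J g) (chr_HG l)"
  by (rule agrees_HG_connection[OF open_UNIV agrees_g, of J Jm, unfolded chr_HG_eq]) (rule J_const)

text \<open>The relations among the J do not involve the metric, and compatibility is homogeneous in
  it, so the conformal factor cancels. The case u = 0 is the original structure.\<close>

lemma almost_HG_conformal:
  assumes W: "open W" "smooth_fun M W u"
  shows "almost_HG M W J (conformal u g)"
  unfolding almost_HG_def
proof (intro conjI ballI)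
  show "4 dvd CARD(4)" by simp
  show "smooth_endo M W (J \<alpha>)" if "\<alpha> \<in> {1..3}" for \<alpha>
    by (rule const_endo_smooth[OF J_const[OF that]])
  show "pseudo_metric M W (conformal u g)"
    by (rule pseudo_metric_conformal[OF W])
  have Jv: "J \<alpha> p (vec_at p c) = vec_at p (Jm \<alpha> c)" if "\<alpha> \<in> {1..3}" for \<alpha> p c
    using J_const[OF that] by (simp add: const_endo_def)
  note vec_at_neg = linear_neg[OF linear_vec_at]
  fix p x assume "x \<in> tangent_space M p"
  then obtain c where x: "x = vec_at p c"
    by (rule tangent_vec_at)
  {
    fix t :: "nat \<times> nat \<times> nat"
    assume "t \<in> {(1, 2, 3), (2, 3, 1), (3, 1, 2)}"
    moreover obtain \<alpha> \<beta> \<gamma> where t: "t = (\<alpha>, \<beta>, \<gamma>)"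
      by (cases t)
    ultimately have m: "(\<alpha>, \<beta>, \<gamma>) \<in> {(1, 2, 3), (2, 3, 1), (3, 1, 2)}"
      by simp
    then have r: "\<alpha> \<in> {1..3}" "\<beta> \<in> {1..3}" "\<gamma> \<in> {1..3}"
      by auto
    have "J \<alpha> p x = J \<beta> p (J \<gamma> p x)"
      unfolding x Jv[OF r(1)] Jv[OF r(2)] Jv[OF r(3)] using conjunct1[OF Jm_quaternion[OF m, of c]] by simp
    moreover have "J \<alpha> p x = - J \<gamma> p (J \<beta> p x)"
      unfolding x Jv[OF r(1)] Jv[OF r(2)] Jv[OF r(3)] vec_at_neg[symmetric]
      using conjunct2[OF Jm_quaternion[OF m, of c]] by simp
    ultimately show "case t of (\<alpha>, \<beta>, \<gamma>) \<Rightarrow> J \<alpha> p x = J \<beta> p (J \<gamma> p x) \<and> J \<alpha> p x = - J \<gamma> p (J \<beta> p x)"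
      by (simp add: t)
  next
    fix \<alpha> :: nat assume \<alpha>: "\<alpha> \<in> {1..3}"
    show "J \<alpha> p (J \<alpha> p x) = - x"
      by (simp add: x Jv[OF \<alpha>] Jm_Jm[OF \<alpha>] vec_at_neg)
    fix y assume "y \<in> tangent_space M p"
    then obtain d where y: "y = vec_at p d"
      by (rule tangent_vec_at)
    show "conformal u g p x y = eps \<alpha> * conformal u g p (J \<alpha> p x) (J \<alpha> p y)"
      using neutral_Jm[OF \<alpha>, of c d] by (simp add: x y Jv[OF \<alpha>] conformal_def g_vec_at)
  }
qed

lemma flat_neighbourhood:
  obtains W u where "open W" "p \<in> W" "smooth_fun M W u"
    "agrees W (levi_civita M W (conformal u g)) (chr_conf l)"
proof -
  obtain W u where W: "open W" "p \<in> W" "smooth_fun M W u"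
    and du: "\<And>q v. q \<in> W \<Longrightarrow> v \<in> tangent_space M q \<Longrightarrow> v u = lee l \<bullet> coef q v"
    using local_potential[OF lee_struct, where p = p] by blast
  from agrees_conformal[OF W(1,3) du] W show thesis
    by (intro that)
qed

lemma curv_chr_conf: "curv (chr_conf l) x y z = 0"
proof -
  have "chr_conf l (struct l x y) z = 0"
    by (simp add: chr_conf_def lee_struct lee_rot_struct)
  then show ?thesis
    by (simp add: curv_def chr_conf_def rot_linear algebra_simps)
qed

lemma curv_chr_HG: "curv (chr_HG l) x y z = 0"
proof -
  have "chr_HG l (struct l x y) z = 0"
    by (simp add: chr_HG_def lee_rot_struct)
  then show ?thesis
    by (simp add: curv_def chr_HG_def rot_linear algebra_simps)
qed

lemma locally_conformal: "locally_conformal_pseudo_hyper_kaehler M J g"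
  unfolding locally_conformal_pseudo_hyper_kaehler_def
proof (intro conjI allI)
  show "almost_HG M UNIV J g"
    by (rule almost_HG_conformal[OF open_UNIV smooth_fun_const[OF open_UNIV, of 0], unfolded conformal_0])
  fix p
  obtain W u where W: "open W" "p \<in> W" "smooth_fun M W u"
    and D: "agrees W (levi_civita M W (conformal u g)) (chr_conf l)"
    by (rule flat_neighbourhood[of p])
  have "pseudo_hyper_kaehler M W J (conformal u g)"
    unfolding pseudo_hyper_kaehler_def
  proof (intro conjI ballI)
    show "almost_HG M W J (conformal u g)"
      by (rule almost_HG_conformal[OF W(1,3)])
    show "parallel_endo M W (levi_civita M W (conformal u g)) (J \<alpha>)" if "\<alpha> \<in> {1..3}" for \<alpha>
      by (rule parallel_endo_agrees[OF W(1) D J_const[OF that]]) (rule chr_conf_Jm)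
  qed
  then show "\<exists>W u. open W \<and> p \<in> W \<and> smooth_fun M W u \<and> pseudo_hyper_kaehler M W J (conformal u g)"
    by (intro exI[of _ W] exI[of _ u] conjI W)
qed

lemma conformally_flat: "locally_conformally_flat M g"
  unfolding locally_conformally_flat_def
proof
  fix p
  obtain W u where W: "open W" "p \<in> W" "smooth_fun M W u"
    and D: "agrees W (levi_civita M W (conformal u g)) (chr_conf l)"
    by (rule flat_neighbourhood[of p])
  show "\<exists>W u. open W \<and> p \<in> W \<and> smooth_fun M W u \<and> flat_connection M W (levi_civita M W (conformal u g))"
    by (intro exI[of _ W] exI[of _ u] conjI W flat_agrees[OF W(1) D curv_chr_conf])
qed

lemma D_flat: "flat_connection M UNIV (HG_connection M UNIV J g)"
  by (rule flat_agrees[OF open_UNIV agrees_HG curv_chr_HG])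

lemma torsion_not_parallel:
  assumes "l \<noteq> 0"
  shows "\<not> parallel_torsion M UNIV (HG_connection M UNIV J g)"
proof
  assume "parallel_torsion M UNIV (HG_connection M UNIV J g)"
  from parallel_torsion_agrees[OF agrees_HG this, unfolded tors_def] have "l = 0"
    by (rule chr_HG_not_parallel)
  then show False
    using assms by simp
qed

lemma curvature_form:
  assumes "x \<in> tangent_space M p" "y \<in> tangent_space M p" "z \<in> tangent_space M p" "w \<in> tangent_space M p"
  shows "riemann M UNIV g p x y z w =
     - (1/2) * kulkarni_nomizu (g p) (ricci M UNIV g p) x y z w
     + scalar_curvature M UNIV g p / 12 * kulkarni_nomizu (g p) (g p) x y z w"
proof (rule kulkarni_nomizu_curvature[OF _ agrees_g bilinear_schouten _ _ assms])
  show "schouten l x y = schouten l y x" for x y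
    by (simp add: schouten_def neutral_sym)
  show "neutral (curv (chr_g l) x y z) w = kulkarni_nomizu neutral (schouten l) x y z w" for x y z w
    unfolding curv_def by (rule chr_g_curvature)
qed simp

end

section \<open>Left-invariant fields as a frame\<close>

lemma left_invariant_independent:
  assumes L: "group L" "carrier L = UNIV" and X: "is_basis X (lie_algebra L M)"
    and 0: "(\<Sum>i\<in>UNIV. c $ i *\<^sub>R X i p) = 0"
  shows "c = 0"
proof (rule is_basis_independent[OF X])
  define V where "V = (\<Sum>i\<in>UNIV. c $ i *\<^sub>R X i)"
  have "V \<in> span (range X)"
    unfolding V_def by (intro span_sum span_scale span_base) simp
  then have V: "V \<in> lie_algebra L M"
    using X by (simp add: is_basis_def)
  have Vp: "V p = 0"
    using 0 by (simp add: V_def sum_function_apply scaleR_fun_def[where 'b = "'a tvec"])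
  have "V q = 0" for q
  proof -
    \<comment> \<open>Left translation by q p^(-1) moves \<open>p\<close> to \<open>q\<close>, and
      its tangent map sends the zero vector to zero.\<close>
    define a where "a = q \<otimes>\<^bsub>L\<^esub> inv\<^bsub>L\<^esub> p"
    have q: "a \<otimes>\<^bsub>L\<^esub> p = q"
      using L by (simp add: a_def group.is_monoid monoid.m_assoc group.l_inv monoid.r_one)
    have "V (a \<otimes>\<^bsub>L\<^esub> p) = tangent_map M (\<lambda>x. a \<otimes>\<^bsub>L\<^esub> x) p (V p)"
      using V by (simp add: lie_algebra_def)
    also have "\<dots> = 0"
      by (simp add: Vp tangent_map_def fun_eq_iff)
    finally show ?thesis by (simp add: q)
  qed
  then show "(\<Sum>i\<in>UNIV. c $ i *\<^sub>R X i) = 0"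
    by (simp add: V_def fun_eq_iff)
qed

lemma lie_bracket_swap: "lie_bracket M Y X = - lie_bracket M X Y"
  by (simp add: lie_bracket_def fun_eq_iff)

theorem theorem18:
  fixes L :: "'a::{t2_space,second_countable_topology} monoid"
    and M :: "('a, real^4) atlas"
    and X :: "4 \<Rightarrow> 'a vfield"
    and l :: "real^4"
    and J :: "nat \<Rightarrow> 'a endo"
    and g :: "'a bform"
  assumes "lie_group L M"
    and "connected (UNIV :: 'a set)"
    and "is_basis X (lie_algebra L M)"
    and "lie_bracket M (X 1) (X 4) =
           l$1 *\<^sub>R X 1 + l$2 *\<^sub>R X 2 + l$3 *\<^sub>R X 3 + l$4 *\<^sub>R X 4"
    and "lie_bracket M (X 2) (X 3) =
           l$1 *\<^sub>R X 1 + l$2 *\<^sub>R X 2 + l$3 *\<^sub>R X 3 + l$4 *\<^sub>R X 4"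
    and "lie_bracket M (X 1) (X 3) =
           l$2 *\<^sub>R X 1 - l$1 *\<^sub>R X 2 + l$4 *\<^sub>R X 3 - l$3 *\<^sub>R X 4"
    and "- lie_bracket M (X 2) (X 4) =
           l$2 *\<^sub>R X 1 - l$1 *\<^sub>R X 2 + l$4 *\<^sub>R X 3 - l$3 *\<^sub>R X 4"
    and "lie_bracket M (X 1) (X 2) = 0"
    and "lie_bracket M (X 3) (X 4) = 0"
    and "\<exists>i. l$i \<noteq> 0"
    and "\<forall>\<alpha>\<in>{1..3}. endo_on M UNIV (J \<alpha>)"
    and "endo_app UNIV (J 1) (X 1) = X 2" "endo_app UNIV (J 1) (X 2) = - X 1"
        "endo_app UNIV (J 1) (X 3) = - X 4" "endo_app UNIV (J 1) (X 4) = X 3"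
    and "endo_app UNIV (J 2) (X 1) = X 3" "endo_app UNIV (J 2) (X 2) = X 4"
        "endo_app UNIV (J 2) (X 3) = - X 1" "endo_app UNIV (J 2) (X 4) = - X 2"
    and "endo_app UNIV (J 3) (X 1) = - X 4" "endo_app UNIV (J 3) (X 2) = X 3"
        "endo_app UNIV (J 3) (X 3) = - X 2" "endo_app UNIV (J 3) (X 4) = X 1"
    and "bilinear_sym_on M UNIV g"
    and "\<forall>p. g p (X 1 p) (X 1 p) = 1 \<and> g p (X 2 p) (X 2 p) = 1 \<and>
             g p (X 3 p) (X 3 p) = - 1 \<and> g p (X 4 p) (X 4 p) = - 1"
    and "\<forall>p i j. i \<noteq> j \<longrightarrow> g p (X i p) (X j p) = 0"
  shows
    "locally_conformal_pseudo_hyper_kaehler M J g \<and>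
     (locally_conformally_flat M g \<and>
      (\<forall>p. \<forall>x\<in>tangent_space M p. \<forall>y\<in>tangent_space M p.
           \<forall>z\<in>tangent_space M p. \<forall>w\<in>tangent_space M p.
         riemann M UNIV g p x y z w =
           - (1/2) * kulkarni_nomizu (g p) (ricci M UNIV g p) x y z w
           + scalar_curvature M UNIV g p / 12 * kulkarni_nomizu (g p) (g p) x y z w)) \<and>
     (flat_connection M UNIV (HG_connection M UNIV J g) \<and>
      \<not> parallel_torsion M UNIV (HG_connection M UNIV J g))"
proof -
  have grp: "group L" "carrier L = UNIV" and mfd: "smooth_mfd M"
    using assms(1) by (auto simp: lie_group_def smooth_mfd_def)
  have Xf: "X i \<in> vector_fields M UNIV" for i
    using is_basis_in[OF assms(3)] by (simp add: lie_algebra_def)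
  note br = assms(4-9)
  have b24: "lie_bracket M (X 2) (X 4) = - (l$2 *\<^sub>R X 1 - l$1 *\<^sub>R X 2 + l$4 *\<^sub>R X 3 - l$3 *\<^sub>R X 4)"
    using br(4) by (metis minus_minus)
  have bself: "lie_bracket M Y Y = 0" for Y
    by (simp add: lie_bracket_def fun_eq_iff)
  have bracket: "lie_bracket M (X i) (X j) = (\<Sum>k\<in>UNIV. struct l (axis i 1) (axis j 1) $ k *\<^sub>R X k)" for i j
  proof -
    \<comment> \<open>Of the sixteen brackets six are given, one of them negated; four vanish since
      both entries are equal, and antisymmetry yields the other six.\<close>
    have "\<forall>i j. lie_bracket M (X i) (X j) = (\<Sum>k\<in>UNIV. struct l (axis i 1) (axis j 1) $ k *\<^sub>R X k)"
      unfolding forall_4 sum_4 axis_4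
      by (simp add: struct_def lee_def lee_rot_def rot_def inner_4 bself br(1-3) b24 br(5,6)
          lie_bracket_swap[of M "X 2" "X 1"] lie_bracket_swap[of M "X 3" "X 1"] lie_bracket_swap[of M "X 4" "X 1"]
          lie_bracket_swap[of M "X 3" "X 2"] lie_bracket_swap[of M "X 4" "X 2"] lie_bracket_swap[of M "X 4" "X 3"])
    then show ?thesis by blast
  qed
  interpret smooth_mfd M by (rule mfd)
  interpret frame M X "struct l"
    by unfold_locales
      (use Xf left_invariant_independent[OF grp assms(3)] bilinear_struct bracket in auto)
  have gX: "g p (X i p) (X j p) = neutral (axis i 1) (axis j 1)" for p i j
    using assms(25,26) exhaust_4[of i] unfolding neutral_axis by (auto simp: sig_def)
  interpret orthonormal_frame M X "struct l" g neutral sig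
    by unfold_locales
      (use bilinear_neutral neutral_sym neutral_nondegenerate neutral_axis
        bilinear_sym_on_vec_at[OF assms(24) bilinear_neutral gX] in \<open>auto simp: sig_def\<close>)
  have JX: "J \<alpha> p (X i p) = vec_at p (Jm \<alpha> (axis i 1))" if "\<alpha> \<in> {1..3}" for \<alpha> p i
  proof -
    have "J \<alpha> p (X i p) = endo_app UNIV (J \<alpha>) (X i) p" for \<alpha> i
      by (simp add: endo_app_def)
    note e = this
    have "\<forall>i. J 1 p (X i p) = vec_at p (Jm 1 (axis i 1))" "\<forall>i. J 2 p (X i p) = vec_at p (Jm 2 (axis i 1))"
      "\<forall>i. J 3 p (X i p) = vec_at p (Jm 3 (axis i 1))"
      unfolding forall_4 axis_4 e assms(12-23) vec_at_def sum_4 by (simp_all add: Jm_def)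
    moreover have "\<alpha> = 1 \<or> \<alpha> = 2 \<or> \<alpha> = 3"
      using that by auto
    ultimately show ?thesis by blast
  qed
  interpret lck_frame M X l g J
    by unfold_locales (use const_endoI[OF _ linear_Jm JX] assms(11) in auto)
  have "l \<noteq> 0"
    using assms(10) by auto
  then show ?thesis
    using locally_conformal conformally_flat curvature_form D_flat torsion_not_parallel by blast
qed

end
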